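(* Let $F$ be a holomorphic vector field on a complex manifold $M$ of dimension $N$. Suppose that $F$ is linearizable at its isolated critical point $z_0\in M$, that the linearization matrix $A$ is diagonal, and that the ratios $\alpha_j/\alpha_k$ of all the eigenvalues $\alpha_1,\dots,\alpha_N$ of $A$ are positive real numbers. If an $F$-holomorphic function $\phi:M\to\mathbb{C}$ has a Taylor series at $z_0$, then $\phi$ is holomorphic on $\operatorname{Sat}(z_0,F)$.
   Context: A critical point of $F$ is a zero of $F$. The integral curves of $F$ are the complex integral curves, i.e. the images of holomorphic solutions (in complex time $\zeta$) of $z'=F(z)$; the maximal integral curves (leaves) partition $M$, and a critical point of $F$ is by itself a maximal integral curve. A function $\phi:M\to\mathbb{C}$ is $F$-holomorphic if its restrictions to the integral curves of $F$ are holomorphic (no regularity of $\phi$ on $M$ is otherwise assumed). $F$ is linearizable at a critical point $z_0$ if there is a biholomorphic mapping $H$ of a neighborhood of $z_0$ onto a neighborhood of $H(z_0)=0$ in $\mathbb{C}^N$ such that in the new coordinates $w$ one has $F(w)=Aw$, where $A$ is an $N\times N$ complex matrix (the linearization matrix). $\operatorname{Sat}(z_0,F)$ is the union of all maximal integral curves $L$ of $F$ in $M$ such that $L\cap U\neq\emptyset$ for every open neighborhood $U$ of $z_0$. A function $\phi$ has a Taylor series at $z_0$ if, in local holomorphic coordinates $z=(z_1,\dots,z_N)$ centered at $z_0$, there is a formal series $\sum_{j=0}^\infty\sum_{|k|+|m|=j}a_{km}z^k\bar z^m$ ($k,m$ multi-indices, $a_{km}\in\mathbb{C}$) such that for every $n\ge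 0$, $\left|\phi(z)-\sum_{j=0}^n\sum_{|k|+|m|=j}a_{km}z^k\bar z^m\right|=o(|z|^n)$ as $z\to0$. *)

theory Defs
  imports "HOL-Analysis.Analysis" "HOL-Library.Landau_Symbols"
begin

(* Only ever applied to open sets S: the Frechet derivative "at x" is the one over the reals,
   and holomorphy means that it exists and is complex linear. *)
definition holomorphic_fun_on :: "(complex^'n \<Rightarrow> complex) \<Rightarrow> (complex^'n) set \<Rightarrow> bool" where
  "holomorphic_fun_on f S \<longleftrightarrow>
     (\<forall>x\<in>S. \<exists>L. (f has_derivative L) (at x) \<and> (\<forall>k v. L (k *s v) = k * L v))"

definition holomorphic_map_on :: "(complex^'n \<Rightarrow> complex^'k) \<Rightarrow> (complex^'n) set \<Rightarrow> bool" where
  "holomorphic_map_on f S \<longleftrightarrow> (\<forall>i. holomorphic_fun_on (\<lambda>x. f x $ i) S)"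

(* A chart is a domain together with a coordinate map; the values of the coordinate map
   outside the domain are irrelevant. *)
type_synonym ('m, 'n) chart = "'m set \<times> ('m \<Rightarrow> (complex, 'n) vec)"

definition chart_inv :: "('m, 'n) chart \<Rightarrow> complex^'n \<Rightarrow> 'm" where
  "chart_inv \<kappa> = inv_into (fst \<kappa>) (snd \<kappa>)"

definition chart_image :: "('m, 'n) chart \<Rightarrow> (complex^'n) set" where
  "chart_image \<kappa> = snd \<kappa> ` fst \<kappa>"

definition is_chart :: "('m::topological_space, 'n::finite) chart \<Rightarrow> bool" where
  "is_chart \<kappa> \<longleftrightarrow> open (fst \<kappa>) \<and> open (chart_image \<kappa>) \<and>
     homeomorphism (fst \<kappa>) (chart_image \<kappa>) (snd \<kappa>) (chart_inv \<kappa>)"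

definition transition :: "('m, 'n) chart \<Rightarrow> ('m, 'n) chart \<Rightarrow> complex^'n \<Rightarrow> complex^'n" where
  "transition \<kappa> \<mu> = snd \<mu> \<circ> chart_inv \<kappa>"

definition compatible :: "('m, 'n::finite) chart \<Rightarrow> ('m, 'n) chart \<Rightarrow> bool" where
  "compatible \<kappa> \<mu> \<longleftrightarrow>
     holomorphic_map_on (transition \<kappa> \<mu>) (snd \<kappa> ` (fst \<kappa> \<inter> fst \<mu>)) \<and>
     holomorphic_map_on (transition \<mu> \<kappa>) (snd \<mu> ` (fst \<kappa> \<inter> fst \<mu>))"

(* The manifold is the whole type 'm, its complex dimension is CARD('n). The complex structure
   is a maximal atlas, so the elements of \<A> are exactly the local holomorphic coordinate systems
   of the manifold, that is, the biholomorphic maps of open subsets onto open subsets of C^N. *)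
definition complex_manifold ::
    "('m::{t2_space, second_countable_topology}, 'n::finite) chart set \<Rightarrow> bool" where
  "complex_manifold \<A> \<longleftrightarrow>
     (\<forall>\<kappa>\<in>\<A>. is_chart \<kappa>) \<and>
     (\<Union>\<kappa>\<in>\<A>. fst \<kappa>) = UNIV \<and>
     (\<forall>\<kappa>\<in>\<A>. \<forall>\<mu>\<in>\<A>. compatible \<kappa> \<mu>) \<and>
     (\<forall>\<kappa>. is_chart \<kappa> \<and> (\<forall>\<mu>\<in>\<A>. compatible \<kappa> \<mu>) \<longrightarrow> \<kappa> \<in> \<A>)"

(* For arbitrary S: holomorphic in a neighbourhood of S. *)
definition holomorphic_on_manifold ::
    "('m::topological_space, 'n::finite) chart set \<Rightarrow> ('m \<Rightarrow> complex) \<Rightarrow> 'm set \<Rightarrow> bool" where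
  "holomorphic_on_manifold \<A> \<phi> S \<longleftrightarrow>
     (\<exists>T. open T \<and> S \<subseteq> T \<and>
       (\<forall>\<kappa>\<in>\<A>. holomorphic_fun_on (\<phi> \<circ> chart_inv \<kappa>) (snd \<kappa> ` (fst \<kappa> \<inter> T))))"

(* A vector field is given by its components in every chart: F \<kappa> p is the component vector, in
   the coordinates \<kappa>, of the tangent vector at p. The components obey the transformation law
   of tangent vectors. *)
type_synonym ('m, 'n) vfield = "('m, 'n) chart \<Rightarrow> 'm \<Rightarrow> (complex, 'n) vec"

definition holomorphic_vector_field ::
    "('m, 'n::finite) chart set \<Rightarrow> ('m, 'n) vfield \<Rightarrow> bool" where
  "holomorphic_vector_field \<A> F \<longleftrightarrow>
     (\<forall>\<kappa>\<in>\<A>. holomorphic_map_on (F \<kappa> \<circ> chart_inv \<kappa>) (chart_image \<kappa>)) \<and>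
     (\<forall>\<kappa>\<in>\<A>. \<forall>\<mu>\<in>\<A>. \<forall>p \<in> fst \<kappa> \<inter> fst \<mu>.
        F \<mu> p = frechet_derivative (transition \<kappa> \<mu>) (at (snd \<kappa> p)) (F \<kappa> p))"

definition critical_point :: "('m, 'n::finite) chart set \<Rightarrow> ('m, 'n) vfield \<Rightarrow> 'm \<Rightarrow> bool" where
  "critical_point \<A> F p \<longleftrightarrow> (\<forall>\<kappa>\<in>\<A>. p \<in> fst \<kappa> \<longrightarrow> F \<kappa> p = 0)"

definition isolated_critical_point ::
    "('m::topological_space, 'n::finite) chart set \<Rightarrow> ('m, 'n) vfield \<Rightarrow> 'm \<Rightarrow> bool" where
  "isolated_critical_point \<A> F p \<longleftrightarrow> critical_point \<A> F p \<and>
     (\<exists>U. open U \<and> p \<in> U \<and> (\<forall>q\<in>U. critical_point \<A> F q \<longrightarrow> q = p))"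

definition solution ::
    "('m::topological_space, 'n::finite) chart set \<Rightarrow> ('m, 'n) vfield \<Rightarrow>
     complex set \<Rightarrow> (complex \<Rightarrow> 'm) \<Rightarrow> bool" where
  "solution \<A> F D \<gamma> \<longleftrightarrow> open D \<and> connected D \<and> continuous_on D \<gamma> \<and>
     (\<forall>\<zeta>\<in>D. \<forall>\<kappa>\<in>\<A>. \<gamma> \<zeta> \<in> fst \<kappa> \<longrightarrow>
        ((\<lambda>s. snd \<kappa> (\<gamma> s)) has_derivative (\<lambda>h. h *s F \<kappa> (\<gamma> \<zeta>))) (at \<zeta>))"

definition integral_curve ::
    "('m::topological_space, 'n::finite) chart set \<Rightarrow> ('m, 'n) vfield \<Rightarrow> 'm set \<Rightarrow> bool" where
  "integral_curve \<A> F C \<longleftrightarrow> (\<exists>D \<gamma>. solution \<A> F D \<gamma> \<and> C = \<gamma> ` D)"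

(* The maximal integral curve through p. Analytic continuation of a solution in complex time is
   in general multivalued (e.g. z' = 1/z on the punctured plane), so a maximal integral curve
   need not be the image of one single-valued solution on a domain of the plane; it is
   what is reached from p along chains of successively intersecting integral curves. *)
definition leaf_through ::
    "('m::topological_space, 'n::finite) chart set \<Rightarrow> ('m, 'n) vfield \<Rightarrow> 'm \<Rightarrow> 'm set" where
  "leaf_through \<A> F p = {(x, y). \<exists>C. integral_curve \<A> F C \<and> x \<in> C \<and> y \<in> C}\<^sup>* `` {p}"

definition maximal_integral_curve ::
    "('m::topological_space, 'n::finite) chart set \<Rightarrow> ('m, 'n) vfield \<Rightarrow> 'm set \<Rightarrow> bool" where
  "maximal_integral_curve \<A> F L \<longleftrightarrow> (\<exists>p. L = leaf_through \<A> F p)"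

definition Sat ::
    "('m::topological_space, 'n::finite) chart set \<Rightarrow> 'm \<Rightarrow> ('m, 'n) vfield \<Rightarrow> 'm set" where
  "Sat \<A> z0 F =
     \<Union>{L. maximal_integral_curve \<A> F L \<and> (\<forall>U. open U \<and> z0 \<in> U \<longrightarrow> L \<inter> U \<noteq> {})}"

(* Off the critical points complex time is a local holomorphic parameter on integral curves,
   and solutions through a critical point are constant. *)
definition F_holomorphic ::
    "('m::topological_space, 'n::finite) chart set \<Rightarrow> ('m, 'n) vfield \<Rightarrow> ('m \<Rightarrow> complex) \<Rightarrow> bool" where
  "F_holomorphic \<A> F \<phi> \<longleftrightarrow> (\<forall>D \<gamma>. solution \<A> F D \<gamma> \<longrightarrow> (\<phi> \<circ> \<gamma>) holomorphic_on D)"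

(* A is the linearization matrix; the linearizing biholomorphic map is a member of the
   maximal atlas. *)
definition linearizable_with ::
    "('m, 'n::finite) chart set \<Rightarrow> ('m, 'n) vfield \<Rightarrow> 'm \<Rightarrow> complex^'n^'n \<Rightarrow> bool" where
  "linearizable_with \<A> F z0 A \<longleftrightarrow>
     (\<exists>H\<in>\<A>. z0 \<in> fst H \<and> snd H z0 = 0 \<and> (\<forall>p \<in> fst H. F H p = A *v snd H p))"

definition diagonal_matrix :: "complex^'n^'n \<Rightarrow> bool" where
  "diagonal_matrix A \<longleftrightarrow> (\<forall>i j. i \<noteq> j \<longrightarrow> A $ i $ j = 0)"

definition is_eigenvalue :: "complex^'n^'n \<Rightarrow> complex \<Rightarrow> bool" where
  "is_eigenvalue A \<alpha> \<longleftrightarrow> (\<exists>v. v \<noteq> 0 \<and> A *v v = \<alpha> *s v)"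

definition monomial :: "complex^'n \<Rightarrow> ('n \<Rightarrow> nat) \<Rightarrow> ('n \<Rightarrow> nat) \<Rightarrow> complex" where
  "monomial z k m = (\<Prod>i\<in>UNIV. z $ i ^ k i) * (\<Prod>i\<in>UNIV. cnj (z $ i) ^ m i)"

definition bidegree :: "nat \<Rightarrow> (('n::finite \<Rightarrow> nat) \<times> ('n \<Rightarrow> nat)) set" where
  "bidegree j = {(k, m). (\<Sum>i\<in>UNIV. k i) + (\<Sum>i\<in>UNIV. m i) = j}"

(* Sums over infinite sets are 0 in HOL; the sum below is a genuine one. *)
lemma finite_bidegree: "finite (bidegree j :: (('n::finite \<Rightarrow> nat) \<times> ('n \<Rightarrow> nat)) set)"
proof (rule finite_subset)
  let ?B = "PiE UNIV (\<lambda>_. {..j}) :: ('n \<Rightarrow> nat) set"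
  show "(bidegree j :: (('n \<Rightarrow> nat) \<times> ('n \<Rightarrow> nat)) set) \<subseteq> ?B \<times> ?B"
  proof clarify
    fix k m :: "'n \<Rightarrow> nat"
    assume "(k, m) \<in> bidegree j"
    then have *: "sum k UNIV + sum m UNIV = j" by (simp add: bidegree_def)
    have "k i \<le> j" "m i \<le> j" for i
      using member_le_sum[of i UNIV k] member_le_sum[of i UNIV m] * by simp_all
    then show "k \<in> ?B \<and> m \<in> ?B" by auto
  qed
  show "finite (?B \<times> ?B)" by (intro finite_cartesian_product finite_PiE) auto
qed

(* The little-o is taken along the full neighbourhood filter of 0, not the punctured one: z = 0 is
   included, and the case n = 0 says that \<phi> is continuous at z0 with \<phi> z0 the constant term. *)
definition has_taylor_series_at ::
    "('m, 'n::finite) chart set \<Rightarrow> ('m \<Rightarrow> complex) \<Rightarrow> 'm \<Rightarrow> bool" where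
  "has_taylor_series_at \<A> \<phi> z0 \<longleftrightarrow>
     (\<exists>\<kappa>\<in>\<A>. z0 \<in> fst \<kappa> \<and> snd \<kappa> z0 = 0 \<and>
       (\<exists>a :: ('n \<Rightarrow> nat) \<Rightarrow> ('n \<Rightarrow> nat) \<Rightarrow> complex. \<forall>n.
          (\<lambda>z. cmod (\<phi> (chart_inv \<kappa> z) - (\<Sum>j\<le>n. \<Sum>(k, m)\<in>bidegree j. a k m * monomial z k m)))
            \<in> o[nhds 0](\<lambda>z. norm z ^ n)))"

end

(*
  Near z0, in the linearizing coordinates and in the rescaled complex time, phi is holomorphic along
  the curves zeta |-> (exp (r_i zeta) w_i)_i with all r_i > 0. The closure of each of them contains 0
  as Re zeta tends to -infinity, uniformly in Im zeta, so the Taylor series of phi becomes an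
  asymptotic expansion in exponentials exp (p zeta + q cnj zeta) of a bounded holomorphic function on
  the half-plane Re zeta < 0. There the terms with q > 0 cancel, an averaging argument bounds each
  remaining coefficient by sup |phi|, and the Phragmen-Lindelof principle shows that the remainder at
  level n is at most polynomial in n times exp (n Re zeta). Hence phi is a uniform limit of
  holomorphic polynomials near z0.

  Holomorphy then spreads along the leaves: composed with the local flow, phi is holomorphic in time
  for every initial point and jointly holomorphic for small times, so Hartogs' lemma on the Taylor
  coefficients in time applies. The log-subharmonicity behind that lemma is obtained by reflecting
  the zeros of a polynomial at the unit circle.
*)
theory Submission
  imports Defs "HOL-Complex_Analysis.Conformal_Mappings"
    "HOL-Computational_Algebra.Fundamental_Theorem_Algebra"
begin

text \<open>Off \<open>z0\<close> no regularity of phi across the leaves is assumed, not even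
  continuity, and the Taylor polynomials come with constants and radii that vary freely with the
  order. No estimate may therefore inherit a constant from the expansion. Phragmen-Lindelof meets
  this obstacle: the expansion only has to certify the order of decay, with whatever constant, while
  the resulting bound is in terms of sup |phi|. As the coefficients obey the same bound, the
  constant at level n merely counts the distinct weights up to n, and at Re zeta = -1 the factor exp
  (-n) beats this polynomial count.

  Positivity of the eigenvalue ratios enters through the time scale: after division by one
  eigenvalue all rates are real and positive, so all curves contract in the same half-plane and only
  finitely many monomials have weight at most n.

  Away from \<open>z0\<close> phi has no known bound along the flow except close to the place where
  holomorphy is already established. That is the setting of Hartogs' lemma: a small radius of
  convergence that is locally uniform, and a larger one that is only pointwise.\<close>

section \<open>Vector-valued derivatives and Cauchy's inequality\<close>

lemma norm_vector_smult: "norm (c *s (x :: complex^'n)) = cmod c * norm x"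
  unfolding norm_vec_def by (simp add: norm_mult L2_set_right_distrib)


lemma has_derivative_vecI:
  fixes f :: "'a::real_normed_vector \<Rightarrow> complex^'n"
  assumes "\<And>i. ((\<lambda>x. f x $ i) has_derivative (\<lambda>h. f' h $ i)) (at x within S)"
  shows "(f has_derivative f') (at x within S)"
proof (rule has_derivative_componentwise_within[THEN iffD2], rule ballI)
  fix b :: "complex^'n" assume "b \<in> Basis"
  then obtain i u where b: "b = axis i u" unfolding Basis_vec_def by blast
  show "((\<lambda>x. f x \<bullet> b) has_derivative (\<lambda>x. f' x \<bullet> b)) (at x within S)"
    unfolding b inner_axis by (rule has_derivative_inner_left[OF assms])
qed


lemma has_derivative_vector_smult_left:
  "((\<lambda>s. s *s v) has_derivative (\<lambda>h. h *s (v :: complex^'n))) F"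
proof (rule bounded_linear.has_derivative[OF _ has_derivative_ident])
  show "bounded_linear (\<lambda>s. s *s v)"
  proof (rule bounded_linear_intro)
    show "norm (x *s v) \<le> norm x * norm v" for x by (simp add: norm_vector_smult)
  qed (simp_all add: vec_eq_iff distrib_right)
qed

lemma higher_deriv_bound_cball:
  assumes f: "f holomorphic_on U" and sub: "cball \<xi> r \<subseteq> U" and "r > 0"
    and B: "\<And>x. x \<in> cball \<xi> r \<Longrightarrow> norm (f x) \<le> B"
  shows "norm ((deriv ^^ n) f \<xi>) \<le> fact n * B / r ^ n"
proof (rule Cauchy_inequality)
  show "f holomorphic_on ball \<xi> r"
    using f sub ball_subset_cball holomorphic_on_subset by blast
  show "continuous_on (cball \<xi> r) f"
    using holomorphic_on_imp_continuous_on[OF f] sub continuous_on_subset by blast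
  show "norm (f x) \<le> B" if "norm (\<xi> - x) = r" for x
    using that by (intro B) (simp add: dist_norm)
qed fact

lemma holomorphic_on_has_field_derivativeI:
  assumes "\<And>s. s \<in> A \<Longrightarrow> (g has_field_derivative g' s) (at s)"
  shows "g holomorphic_on A"
  unfolding holomorphic_on_def field_differentiable_def
  using has_field_derivative_at_within[OF assms] by blast

subsection \<open>Holomorphic functions of several variables\<close>

abbreviation fderiv :: "(complex^'n \<Rightarrow> complex) \<Rightarrow> complex^'n \<Rightarrow> complex^'n \<Rightarrow> complex" where
  "fderiv f x \<equiv> frechet_derivative f (at x)"

lemma holomorphic_funI:
  assumes "\<And>x. x \<in> S \<Longrightarrow> (f has_derivative L x) (at x)"
    and "\<And>x k v. x \<in> S \<Longrightarrow> L x (k *s v) = k * L x v"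
  shows "holomorphic_fun_on f S"
  unfolding holomorphic_fun_on_def
proof
  fix x assume "x \<in> S"
  with assms show "\<exists>L. (f has_derivative L) (at x) \<and> (\<forall>k v. L (k *s v) = k * L v)"
    by (intro exI[of _ "L x"]) simp
qed

lemma
  assumes "holomorphic_fun_on f S" "x \<in> S"
  shows holomorphic_fun_has_derivative: "(f has_derivative fderiv f x) (at x)"
    and fderiv_smult: "fderiv f x (k *s v) = k * fderiv f x v"
proof -
  obtain L where L: "(f has_derivative L) (at x)" "\<And>k v. L (k *s v) = k * L v"
    using assms unfolding holomorphic_fun_on_def by blast
  have "L = fderiv f x" by (rule frechet_derivative_at[OF L(1)])
  with L show "(f has_derivative fderiv f x) (at x)" "fderiv f x (k *s v) = k * fderiv f x v"
    by auto
qed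

lemma holomorphic_fun_on_subset: "holomorphic_fun_on f S \<Longrightarrow> T \<subseteq> S \<Longrightarrow> holomorphic_fun_on f T"
  unfolding holomorphic_fun_on_def by blast

lemma holomorphic_fun_on_continuous: "holomorphic_fun_on f S \<Longrightarrow> continuous_on S f"
  by (intro continuous_at_imp_continuous_on ballI has_derivative_continuous[OF holomorphic_fun_has_derivative])

lemma holomorphic_fun_on_const: "holomorphic_fun_on (\<lambda>_. c) S"
  by (rule holomorphic_funI[where L = "\<lambda>_ _. 0"]) auto

lemma holomorphic_fun_on_nth: "holomorphic_fun_on (\<lambda>x. x $ i) S"
  by (rule holomorphic_funI[where L = "\<lambda>_ h. h $ i"])
    (simp_all add: bounded_linear_imp_has_derivative bounded_linear_vec_nth)

lemma holomorphic_fun_on_add: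
  assumes "holomorphic_fun_on f S" "holomorphic_fun_on g S"
  shows "holomorphic_fun_on (\<lambda>x. f x + g x) S"
  by (rule holomorphic_funI[where L = "\<lambda>x h. fderiv f x h + fderiv g x h"])
    (simp_all add: has_derivative_add holomorphic_fun_has_derivative[OF assms(1)]
      holomorphic_fun_has_derivative[OF assms(2)]
      fderiv_smult[OF assms(1)] fderiv_smult[OF assms(2)] distrib_left)

lemma holomorphic_fun_on_mult:
  assumes "holomorphic_fun_on f S" "holomorphic_fun_on g S"
  shows "holomorphic_fun_on (\<lambda>x. f x * g x) S"
proof (rule holomorphic_funI[where L = "\<lambda>x h. f x * fderiv g x h + fderiv f x h * g x"])
  show "((\<lambda>x. f x * g x) has_derivative (\<lambda>h. f x * fderiv g x h + fderiv f x h * g x)) (at x)"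
    if "x \<in> S" for x
    using that by (intro has_derivative_mult holomorphic_fun_has_derivative[OF assms(1)]
      holomorphic_fun_has_derivative[OF assms(2)])
qed (simp add: fderiv_smult[OF assms(1)] fderiv_smult[OF assms(2)] algebra_simps)

lemma holomorphic_fun_on_cmult:
  "holomorphic_fun_on f S \<Longrightarrow> holomorphic_fun_on (\<lambda>x. c * f x) S"
  by (intro holomorphic_fun_on_mult holomorphic_fun_on_const)

lemma holomorphic_fun_on_diff:
  assumes "holomorphic_fun_on f S" "holomorphic_fun_on g S"
  shows "holomorphic_fun_on (\<lambda>x. f x - g x) S"
  using holomorphic_fun_on_add[OF assms(1) holomorphic_fun_on_cmult[OF assms(2), of "-1"]] by simp

lemma holomorphic_fun_on_sum:
  "(\<And>i. i \<in> I \<Longrightarrow> holomorphic_fun_on (f i) S) \<Longrightarrow> holomorphic_fun_on (\<lambda>x. \<Sum>i\<in>I. f i x) S"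
  by (induction I rule: infinite_finite_induct)
    (simp_all add: holomorphic_fun_on_add holomorphic_fun_on_const)

lemma holomorphic_fun_on_power:
  "holomorphic_fun_on f S \<Longrightarrow> holomorphic_fun_on (\<lambda>x. f x ^ n) S"
  by (induction n) (simp_all add: holomorphic_fun_on_mult holomorphic_fun_on_const)

lemma holomorphic_fun_on_prod:
  "(\<And>i. i \<in> I \<Longrightarrow> holomorphic_fun_on (f i) S) \<Longrightarrow> holomorphic_fun_on (\<lambda>x. \<Prod>i\<in>I. f i x) S"
  by (induction I rule: infinite_finite_induct)
    (simp_all add: holomorphic_fun_on_mult holomorphic_fun_on_const)

lemmas holomorphic_fun_intros = holomorphic_fun_on_const holomorphic_fun_on_nth
  holomorphic_fun_on_add holomorphic_fun_on_mult holomorphic_fun_on_diff holomorphic_fun_on_cmult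
  holomorphic_fun_on_sum holomorphic_fun_on_power holomorphic_fun_on_prod

lemma holomorphic_fun_on_cong:
  assumes "holomorphic_fun_on f S" "open S" "\<And>x. x \<in> S \<Longrightarrow> f x = g x"
  shows "holomorphic_fun_on g S"
proof (rule holomorphic_funI[where L = "fderiv f"])
  fix x assume x: "x \<in> S"
  show "(g has_derivative fderiv f x) (at x)"
    using has_derivative_transform_within_open[OF holomorphic_fun_has_derivative[OF assms(1) x] assms(2) x assms(3)] .
qed (simp add: fderiv_smult[OF assms(1)])

lemma holomorphic_map_has_derivative:
  assumes "holomorphic_map_on g S" "x \<in> S"
  shows "(g has_derivative (\<lambda>h. \<chi> i. fderiv (\<lambda>x. g x $ i) x h)) (at x)"
proof (rule has_derivative_vecI)
  fix i
  have "holomorphic_fun_on (\<lambda>x. g x $ i) S" using assms(1) by (simp add: holomorphic_map_on_def)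
  from holomorphic_fun_has_derivative[OF this assms(2)]
  show "((\<lambda>x. g x $ i) has_derivative (\<lambda>h. (\<chi> i. fderiv (\<lambda>x. g x $ i) x h) $ i)) (at x)"
    unfolding vec_lambda_beta .
qed

lemma holomorphic_map_on_continuous: "holomorphic_map_on g S \<Longrightarrow> continuous_on S g"
  by (intro continuous_at_imp_continuous_on ballI has_derivative_continuous[OF holomorphic_map_has_derivative])

lemma holomorphic_map_fderiv_smult:
  assumes "holomorphic_map_on g S" "x \<in> S"
  shows "frechet_derivative g (at x) (k *s v) = k *s frechet_derivative g (at x) v"
proof -
  have "fderiv (\<lambda>x. g x $ i) x (k *s v) = k * fderiv (\<lambda>x. g x $ i) x v" for i
    using assms by (intro fderiv_smult[of _ S]) (simp_all add: holomorphic_map_on_def)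
  then show ?thesis
    using frechet_derivative_at[OF holomorphic_map_has_derivative[OF assms], symmetric]
    by (simp add: vec_eq_iff)
qed

lemma holomorphic_map_has_frechet_derivative:
  assumes "holomorphic_map_on g S" "x \<in> S"
  shows "(g has_derivative frechet_derivative g (at x)) (at x)"
  using differentiableI[OF holomorphic_map_has_derivative[OF assms]] by (simp only: frechet_derivative_works)

lemma holomorphic_map_on_subset: "holomorphic_map_on g S \<Longrightarrow> T \<subseteq> S \<Longrightarrow> holomorphic_map_on g T"
  unfolding holomorphic_map_on_def using holomorphic_fun_on_subset by blast

lemma holomorphic_fun_on_compose:
  assumes g: "holomorphic_map_on g S" and f: "holomorphic_fun_on f T" and sub: "g ` S \<subseteq> T"
  shows "holomorphic_fun_on (\<lambda>x. f (g x)) S"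
proof (rule holomorphic_funI[where L = "\<lambda>x h. fderiv f (g x) (frechet_derivative g (at x) h)"])
  fix x assume x: "x \<in> S"
  then have gx: "g x \<in> T" using sub by auto
  show "((\<lambda>x. f (g x)) has_derivative (\<lambda>h. fderiv f (g x) (frechet_derivative g (at x) h))) (at x)"
    by (rule has_derivative_compose[OF holomorphic_map_has_frechet_derivative[OF g x]
          holomorphic_fun_has_derivative[OF f gx]])
  show "fderiv f (g x) (frechet_derivative g (at x) (k *s v)) = k * fderiv f (g x) (frechet_derivative g (at x) v)" for k v
    unfolding holomorphic_map_fderiv_smult[OF g x] fderiv_smult[OF f gx] ..
qed

lemma has_field_derivative_compose_holomorphic_fun:
  assumes f: "holomorphic_fun_on f S" and g: "(g has_derivative (\<lambda>h. h *s v)) (at s)" and "g s \<in> S"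
  shows "((\<lambda>s. f (g s)) has_field_derivative fderiv f (g s) v) (at s)"
proof -
  have "((\<lambda>s. f (g s)) has_derivative (\<lambda>h. fderiv f (g s) (h *s v))) (at s)"
    by (rule has_derivative_compose[OF g holomorphic_fun_has_derivative[OF f \<open>g s \<in> S\<close>]])
  then show ?thesis
    unfolding fderiv_smult[OF f \<open>g s \<in> S\<close>] has_field_derivative_def
    by (simp add: mult.commute[of _ "fderiv f (g s) v"])
qed

lemma holomorphic_fun_slice:
  assumes f: "holomorphic_fun_on f S" and "x + s *s v \<in> S"
  shows "((\<lambda>s. f (x + s *s v)) has_field_derivative fderiv f (x + s *s v) v) (at s)"
proof (rule has_field_derivative_compose_holomorphic_fun[OF f, where g = "\<lambda>s. x + s *s v"])
  show "x + s *s v \<in> S" by fact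
  show "((\<lambda>s. x + s *s v) has_derivative (\<lambda>h. h *s v)) (at s)"
    using has_derivative_add[OF has_derivative_const[of x] has_derivative_vector_smult_left, of v "at s"]
    by (simp only: add_0)
qed

text \<open>Cauchy's estimate in one variable on the complex line s |-> x + s v: the disc of radius
  \<open>r / norm v\<close> is mapped into \<open>cball x r\<close>.\<close>

lemma fderiv_cauchy_bound:
  assumes f: "holomorphic_fun_on f S" and "cball x r \<subseteq> S" "r > 0"
    and B: "\<And>y. y \<in> cball x r \<Longrightarrow> norm (f y) \<le> B"
  shows "norm (fderiv f x v) \<le> B / r * norm v"
proof (cases "v = 0")
  case True
  then show ?thesis
    using fderiv_smult[OF f, of x 0 v] assms by (simp add: subset_iff)
next
  case False
  define \<rho> where "\<rho> = r / norm v"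
  have \<rho>: "\<rho> > 0" using False assms by (simp add: \<rho>_def)
  have inb: "x + s *s v \<in> cball x r" if "norm s \<le> \<rho>" for s
    using that False by (simp add: dist_norm norm_vector_smult \<rho>_def field_simps)
  let ?g = "\<lambda>s. f (x + s *s v)"
  have der: "(?g has_field_derivative fderiv f (x + s *s v) v) (at s)" if "norm s \<le> \<rho>" for s
    using inb[OF that] assms(2) by (intro holomorphic_fun_slice[OF f]) auto
  have "norm ((deriv ^^ 1) ?g 0) \<le> fact 1 * B / \<rho> ^ 1"
  proof (rule higher_deriv_bound_cball[OF _ subset_refl \<rho>])
    show "?g holomorphic_on cball 0 \<rho>"
      by (rule holomorphic_on_has_field_derivativeI, rule der) simp
  qed (use inb B in auto)
  moreover have "deriv ?g 0 = fderiv f x v"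
    using der[of 0] \<rho> by (intro DERIV_imp_deriv) auto
  ultimately show ?thesis by (simp add: \<rho>_def)
qed

text \<open>Weierstrass' convergence theorem: by Cauchy's estimate the derivatives converge uniformly.\<close>

lemma holomorphic_fun_on_uniform_limit:
  fixes f :: "nat \<Rightarrow> complex^'n \<Rightarrow> complex"
  assumes "open S" and f: "\<And>n. holomorphic_fun_on (f n) S" and lim: "uniform_limit S f l sequentially"
  shows "holomorphic_fun_on l S"
proof -
  have "\<exists>L. (l has_derivative L) (at x) \<and> (\<forall>k v. L (k *s v) = k * L v)" if x: "x \<in> S" for x
  proof -
    obtain r where r: "r > 0" "cball x (2 * r) \<subseteq> S"
      using open_contains_cball[of S] assms(1) x
      by (metis field_sum_of_halves half_gt_zero mult_2)
    have sub: "cball y r \<subseteq> S" if "y \<in> ball x r" for y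
    proof -
      have "cball y r \<subseteq> cball x (2 * r)"
        using that by (intro cball_subset_cball_iff[THEN iffD2]) (auto simp: dist_commute)
      then show ?thesis using r by auto
    qed
    have fd: "(f n has_derivative fderiv (f n) y) (at y)" if "y \<in> ball x r" for n y
      using that sub[OF that] r by (intro holomorphic_fun_has_derivative[OF f]) auto
    have est: "\<exists>N. \<forall>n\<ge>N. \<forall>m\<ge>N. \<forall>y\<in>ball x r. \<forall>v. norm (fderiv (f n) y v - fderiv (f m) y v) \<le> e * norm v"
      if e: "e > 0" for e
    proof -
      have "uniformly_Cauchy_on S f" using lim by (rule uniformly_convergent_Cauchy[OF uniformly_convergentI])
      then obtain N where N: "\<And>n m y. n \<ge> N \<Longrightarrow> m \<ge> N \<Longrightarrow> y \<in> S \<Longrightarrow> dist (f m y) (f n y) < e * r"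
        unfolding uniformly_Cauchy_on_def using e r by (metis mult_pos_pos)
      show ?thesis
      proof (intro exI allI impI ballI)
        fix n m y v assume nm: "N \<le> n" "N \<le> m" and y: "y \<in> ball x r"
        have "norm (fderiv (\<lambda>z. f n z - f m z) y v) \<le> e * r / r * norm v"
        proof (rule fderiv_cauchy_bound[OF holomorphic_fun_on_diff[OF f f] sub[OF y] r(1)])
          show "norm (f n z - f m z) \<le> e * r" if "z \<in> cball y r" for z
            using N[OF nm(2) nm(1), of z] sub[OF y] that by (auto simp: dist_norm)
        qed
        moreover have "fderiv (\<lambda>z. f n z - f m z) y = (\<lambda>v. fderiv (f n) y v - fderiv (f m) y v)"
          by (rule frechet_derivative_at[symmetric]) (intro has_derivative_diff fd y)
        ultimately show "norm (fderiv (f n) y v - fderiv (f m) y v) \<le> e * norm v"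
          using r by simp
      qed
    qed
    have conv: "convergent (\<lambda>n. fderiv (f n) y v)" if y: "y \<in> ball x r" for y v
    proof (intro Cauchy_convergent CauchyI')
      fix e :: real assume "e > 0"
      then have "e / (norm v + 1) > 0" by (simp add: add_nonneg_pos)
      from est[OF this] obtain N where N: "\<And>n m. n \<ge> N \<Longrightarrow> m \<ge> N \<Longrightarrow>
          norm (fderiv (f n) y v - fderiv (f m) y v) \<le> e / (norm v + 1) * norm v"
        using y by blast
      have lt: "e / (norm v + 1) * norm v < e"
        using \<open>e > 0\<close> by (simp add: pos_divide_less_eq[OF add_nonneg_pos[OF norm_ge_zero zero_less_one]] distrib_left mult.commute)
      show "\<exists>M. \<forall>m\<ge>M. \<forall>n>m. dist (fderiv (f m) y v) (fderiv (f n) y v) < e"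
      proof (intro exI allI impI)
        fix m n assume "N \<le> m" "m < n"
        then show "dist (fderiv (f m) y v) (fderiv (f n) y v) < e"
          unfolding dist_norm by (intro le_less_trans[OF N lt]) auto
      qed
    qed
    define g' where "g' y v = lim (\<lambda>n. fderiv (f n) y v)" for y v
    have g': "(\<lambda>n. fderiv (f n) y v) \<longlonglongrightarrow> g' y v" if "y \<in> ball x r" for y v
      using conv[OF that] unfolding g'_def by (simp add: convergent_LIMSEQ_iff)
    have "\<exists>g. \<forall>y\<in>ball x r. (\<lambda>n. f n y) \<longlonglongrightarrow> g y \<and> (g has_derivative g' y) (at y within ball x r)"
    proof (rule has_derivative_sequence)
      show "convex (ball x r)" by simp
      show "(f n has_derivative fderiv (f n) y) (at y within ball x r)" if "y \<in> ball x r" for n y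
        using fd[OF that] by (rule has_derivative_at_withinI)
      show "x \<in> ball x r" using r by simp
      show "(\<lambda>n. f n x) \<longlonglongrightarrow> l x" using lim x by (rule tendsto_uniform_limitI)
      fix e :: real assume "e > 0"
      from est[OF this] obtain N where N: "\<And>n m y v. n \<ge> N \<Longrightarrow> m \<ge> N \<Longrightarrow> y \<in> ball x r \<Longrightarrow>
          norm (fderiv (f n) y v - fderiv (f m) y v) \<le> e * norm v" by blast
      show "\<forall>\<^sub>F n in sequentially. \<forall>y\<in>ball x r. \<forall>v. norm (fderiv (f n) y v - g' y v) \<le> e * norm v"
        unfolding eventually_sequentially
      proof (intro exI allI impI ballI)
        fix n y v assume n: "N \<le> n" and y: "y \<in> ball x r"
        have "(\<lambda>m. norm (fderiv (f n) y v - fderiv (f m) y v)) \<longlonglongrightarrow> norm (fderiv (f n) y v - g' y v)"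
          by (intro tendsto_intros g' y)
        then show "norm (fderiv (f n) y v - g' y v) \<le> e * norm v"
        proof (rule tendsto_upperbound)
          show "\<forall>\<^sub>F m in sequentially. norm (fderiv (f n) y v - fderiv (f m) y v) \<le> e * norm v"
            unfolding eventually_sequentially using N[OF n _ y] by blast
        qed simp
      qed
    qed
    then obtain g where g: "\<And>y. y \<in> ball x r \<Longrightarrow> (\<lambda>n. f n y) \<longlonglongrightarrow> g y"
        "\<And>y. y \<in> ball x r \<Longrightarrow> (g has_derivative g' y) (at y within ball x r)" by blast
    have xb: "x \<in> ball x r" using r by simp
    have gl: "g y = l y" if "y \<in> ball x r" for y
    proof (rule LIMSEQ_unique[OF g(1)[OF that] tendsto_uniform_limitI[OF lim]])
      show "y \<in> S" using sub[OF that] r by auto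
    qed
    have "(g has_derivative g' x) (at x)"
      using g(2)[OF xb] at_within_open[OF xb open_ball] by simp
    then have "(l has_derivative g' x) (at x)"
      by (rule has_derivative_transform_within_open[OF _ open_ball xb gl])
    moreover have "g' x (k *s v) = k * g' x v" for k v
    proof (rule LIMSEQ_unique[OF g'[OF xb]])
      show "(\<lambda>n. fderiv (f n) x (k *s v)) \<longlonglongrightarrow> k * g' x v"
        unfolding fderiv_smult[OF f x] by (intro tendsto_intros g' xb)
    qed
    ultimately show ?thesis by blast
  qed
  then show ?thesis unfolding holomorphic_fun_on_def by blast
qed

lemma holomorphic_fun_on_local:
  "(\<And>x. x \<in> S \<Longrightarrow> \<exists>U. x \<in> U \<and> holomorphic_fun_on f U) \<Longrightarrow> holomorphic_fun_on f S"
  unfolding holomorphic_fun_on_def by blast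

text \<open>The difference quotients with steps \<open>hh n\<close> are holomorphic, and Taylor's
  formula on the slices in direction \<open>v\<close> makes them converge to the derivative
  uniformly on a small ball, so Weierstrass' theorem applies. Iterated Lie derivatives and Taylor
  approximations of holomorphic functions rest on this.\<close>

lemma holomorphic_fun_on_directional_derivative:
  fixes v :: "complex^'n"
  assumes "open S" and f: "holomorphic_fun_on f S"
  shows "holomorphic_fun_on (\<lambda>x. fderiv f x v) S"
proof (rule holomorphic_fun_on_local)
  fix x assume "x \<in> S"
  then obtain r where r: "r > 0" "cball x (2 * r) \<subseteq> S"
    using open_contains_cball[of S] assms(1) by (metis field_sum_of_halves half_gt_zero mult_2)
  \<comment> \<open>Division by \<open>norm v + 1\<close> instead of \<open>norm v\<close> covers
    the case \<open>v = 0\<close>.\<close>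
  define \<rho> where "\<rho> = r / (norm v + 1)"
  have nv: "norm v + 1 > 0" by (simp add: add_nonneg_pos)
  have \<rho>: "\<rho> > 0" using r nv by (simp add: \<rho>_def)
  have inb: "y + s *s v \<in> cball x (2 * r)" if "y \<in> ball x r" "norm s \<le> \<rho>" for y s
  proof -
    have "norm (s *s v) \<le> \<rho> * (norm v + 1)"
      unfolding norm_vector_smult using that \<rho> by (intro mult_mono) auto
    also have "\<dots> = r" using nv by (simp add: \<rho>_def)
    finally have "dist y (y + s *s v) \<le> r" by (simp add: dist_norm)
    then show ?thesis using that dist_triangle[of x "y + s *s v" y] by (simp add: dist_commute)
  qed
  have "compact (f ` cball x (2 * r))"
    using holomorphic_fun_on_continuous[OF f] r
    by (intro compact_continuous_image) (auto intro: continuous_on_subset)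
  then obtain B where B: "\<And>y. y \<in> cball x (2 * r) \<Longrightarrow> norm (f y) \<le> B"
    using compact_imp_bounded[of "f ` cball x (2 * r)"] unfolding bounded_iff by (meson imageI)
  \<comment> \<open>Cauchy's bound for the second derivative in \<open>s\<close>: the 2 is
    \<open>fact 2\<close>, and discs of radius \<open>\<rho> / 2\<close> about points with
    \<open>norm s \<le> \<rho> / 2\<close> stay where the modulus of \<open>f\<close> is at most
    \<open>B\<close>.\<close>
  define C where "C = 2 * B / (\<rho> / 2) ^ 2"
  have est: "norm (f (y + h *s v) - f y - fderiv f y v * h) \<le> C * norm h ^ 2"
    if y: "y \<in> ball x r" and h: "norm h \<le> \<rho> / 2" for y h
  proof -
    let ?g = "\<lambda>s. f (y + s *s v)"
    have der: "(?g has_field_derivative fderiv f (y + s *s v) v) (at s)" if "norm s \<le> \<rho>" for s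
      using inb[OF y that] r by (intro holomorphic_fun_slice[OF f]) auto
    then have hol: "?g holomorphic_on ball 0 \<rho>"
      by (intro holomorphic_on_has_field_derivativeI[where g' = "\<lambda>s. fderiv f (y + s *s v) v"]) simp
    have hold: "(deriv ^^ i) ?g holomorphic_on ball 0 \<rho>" for i
      by (rule holomorphic_higher_deriv[OF hol open_ball])
    have "norm ((deriv ^^ 0) ?g h - (\<Sum>i\<le>1. (deriv ^^ i) ?g 0 * (h - 0) ^ i / fact i)) \<le> C * norm (h - 0) ^ Suc 1 / fact 1"
    proof (rule complex_Taylor[where S = "cball 0 (\<rho> / 2)" and f = "\<lambda>i. (deriv ^^ i) ?g"])
      fix i :: nat and s :: complex assume s: "s \<in> cball 0 (\<rho> / 2)"
      show "((deriv ^^ i) ?g has_field_derivative (deriv ^^ Suc i) ?g s) (at s within cball 0 (\<rho> / 2))"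
        using holomorphic_derivI[OF hold open_ball, of s] s \<rho> by (auto intro: has_field_derivative_at_within)
      have sub: "cball s (\<rho> / 2) \<subseteq> cball 0 \<rho>" using s by (auto intro!: cball_subset_cball_iff[THEN iffD2])
      have "norm ((deriv ^^ 2) ?g s) \<le> fact 2 * B / (\<rho> / 2) ^ 2"
      proof (rule higher_deriv_bound_cball[OF _ sub])
        show "?g holomorphic_on cball 0 \<rho>"
          by (rule holomorphic_on_has_field_derivativeI, rule der) simp
        show "norm (?g u) \<le> B" if "u \<in> cball s (\<rho> / 2)" for u
        proof -
          have "u \<in> cball 0 \<rho>" using sub that by blast
          then show ?thesis by (intro B inb y) simp
        qed
      qed (use \<rho> in simp)
      then show "norm ((deriv ^^ Suc 1) ?g s) \<le> C" by (simp add: C_def numeral_2_eq_2)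
    qed (use h \<rho> in auto)
    moreover have "deriv ?g 0 = fderiv f y v"
      using der[of 0] \<rho> by (intro DERIV_imp_deriv) auto
    ultimately show ?thesis by (simp add: algebra_simps power2_eq_square)
  qed
  have C0: "C \<ge> 0"
    using order.trans[OF norm_ge_zero B[of x]] r by (simp add: C_def)
  define hh where "hh n = \<rho> / 2 / of_nat (Suc n)" for n :: nat
  have hh: "hh n > 0" "hh n \<le> \<rho> / 2" for n
    using \<rho> by (auto simp: hh_def field_simps)
  have hh0: "hh \<longlonglongrightarrow> 0" unfolding hh_def
    by (rule LIMSEQ_Suc[OF lim_const_over_n])
  show "\<exists>U. x \<in> U \<and> holomorphic_fun_on (\<lambda>x. fderiv f x v) U"
  proof (intro exI conjI)
    show "x \<in> ball x r" using r by simp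
    show "holomorphic_fun_on (\<lambda>x. fderiv f x v) (ball x r)"
    proof (rule holomorphic_fun_on_uniform_limit[where f = "\<lambda>n y. inverse (of_real (hh n)) * (f (y + of_real (hh n) *s v) - f y)"])
      fix n
      have m: "holomorphic_map_on (\<lambda>y. y + of_real (hh n) *s v) (ball x r)"
        unfolding holomorphic_map_on_def by (auto intro!: holomorphic_fun_intros)
      have "norm (complex_of_real (hh n)) \<le> \<rho>" using hh[of n] \<rho> by simp
      from inb[OF _ this] r(2) have "(\<lambda>y. y + of_real (hh n) *s v) ` ball x r \<subseteq> S" by blast
      then show "holomorphic_fun_on (\<lambda>y. inverse (of_real (hh n)) * (f (y + of_real (hh n) *s v) - f y)) (ball x r)"
        using r by (intro holomorphic_fun_intros holomorphic_fun_on_compose[OF m f] holomorphic_fun_on_subset[OF f]) auto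
    next
      show "uniform_limit (ball x r) (\<lambda>n y. inverse (of_real (hh n)) * (f (y + of_real (hh n) *s v) - f y)) (\<lambda>x. fderiv f x v) sequentially"
      proof (rule uniform_limitI)
        fix e :: real assume "e > 0"
        have "(\<lambda>n. C * hh n) \<longlonglongrightarrow> C * 0" by (intro tendsto_intros hh0)
        then have "\<forall>\<^sub>F n in sequentially. C * hh n < e" using \<open>e > 0\<close> by (intro order_tendstoD) auto
        then show "\<forall>\<^sub>F n in sequentially. \<forall>y\<in>ball x r. dist (inverse (of_real (hh n)) * (f (y + of_real (hh n) *s v) - f y)) (fderiv f y v) < e"
        proof eventually_elim
          case (elim n)
          show ?case
          proof
            fix y assume y: "y \<in> ball x r"
            have h0: "complex_of_real (hh n) \<noteq> 0" using hh[of n] by simp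
            have "inverse (of_real (hh n)) * (f (y + of_real (hh n) *s v) - f y) - fderiv f y v
               = inverse (of_real (hh n)) * (f (y + of_real (hh n) *s v) - f y - fderiv f y v * of_real (hh n))"
              using h0 by (simp add: field_simps)
            also have "norm \<dots> \<le> inverse (hh n) * (C * hh n ^ 2)"
              unfolding norm_mult using est[OF y, of "of_real (hh n)"] hh[of n]
              by (intro mult_mono) (auto simp: norm_inverse)
            also have "\<dots> = C * hh n" using hh[of n] by (simp add: power2_eq_square field_simps)
            finally show "dist (inverse (of_real (hh n)) * (f (y + of_real (hh n) *s v) - f y)) (fderiv f y v) < e"
              using elim by (simp add: dist_norm)
          qed
        qed
      qed
    qed simp
  qed
qed

lemma fderiv_expand:
  assumes "holomorphic_fun_on f S" "x \<in> S"
  shows "fderiv f x v = (\<Sum>i\<in>UNIV. v $ i * fderiv f x (axis i 1))"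
proof -
  interpret linear "fderiv f x"
    using holomorphic_fun_has_derivative[OF assms] has_derivative_linear by blast
  have "fderiv f x v = fderiv f x (\<Sum>i\<in>UNIV. v $ i *s axis i 1)" by (simp only: basis_expansion)
  also have "\<dots> = (\<Sum>i\<in>UNIV. v $ i * fderiv f x (axis i 1))"
    by (simp add: sum fderiv_smult[OF assms])
  finally show ?thesis .
qed

text \<open>When the direction varies with the point, the derivative is expanded in the partial
  derivatives, with the components of \<open>G\<close> as holomorphic coefficients.\<close>

lemma holomorphic_fun_on_lie_derivative:
  assumes "open S" "holomorphic_map_on G S" "holomorphic_fun_on f S"
  shows "holomorphic_fun_on (\<lambda>x. fderiv f x (G x)) S"
proof (rule holomorphic_fun_on_cong)
  show "holomorphic_fun_on (\<lambda>x. \<Sum>i\<in>UNIV. G x $ i * fderiv f x (axis i 1)) S"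
    using assms by (intro holomorphic_fun_intros holomorphic_fun_on_directional_derivative)
      (auto simp: holomorphic_map_on_def)
qed (simp_all add: assms fderiv_expand[OF assms(3), symmetric])

subsection \<open>Taylor polynomials\<close>


text \<open>Polynomials in the coordinates and their conjugates.\<close>

inductive rpoly :: "(complex^'n \<Rightarrow> complex) \<Rightarrow> bool" where
  rpoly_monomial: "rpoly (\<lambda>w. c * monomial w k m)"
| rpoly_add: "rpoly P \<Longrightarrow> rpoly Q \<Longrightarrow> rpoly (\<lambda>w. P w + Q w)"

lemma monomial_mult:
  "monomial w k m * monomial w k' m' = monomial w (\<lambda>i. k i + k' i) (\<lambda>i. m i + m' i)"
  by (simp add: monomial_def power_add prod.distrib)

lemma monomial_smult:
  "monomial (of_real t *s w) k m = of_real t ^ (sum k UNIV + sum m UNIV) * monomial w k m"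
  by (simp add: monomial_def power_mult_distrib prod.distrib power_add power_sum)

lemma rpoly_const: "rpoly (\<lambda>w. c)"
  using rpoly_monomial[of c "\<lambda>_. 0" "\<lambda>_. 0"] by (simp add: monomial_def)

lemma rpoly_nth:
  fixes i :: "'n::finite"
  shows "rpoly (\<lambda>w. w $ i)"
proof -
  have "monomial w (\<lambda>j. if j = i then 1 else 0) (\<lambda>_. 0) = w $ i" for w :: "complex^'n"
    unfolding monomial_def by (simp add: if_distrib prod.delta cong: if_cong)
  then show ?thesis using rpoly_monomial[of 1 "\<lambda>j. if j = i then 1 else 0" "\<lambda>_. 0"] by simp
qed

lemma rpoly_mult_monomial: "rpoly Q \<Longrightarrow> rpoly (\<lambda>w. c * monomial w k m * Q w)"
proof (induction Q rule: rpoly.induct)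
  case (rpoly_monomial c' k' m')
  have "(\<lambda>w. c * monomial w k m * (c' * monomial w k' m'))
      = (\<lambda>w. (c * c') * monomial w (\<lambda>i. k i + k' i) (\<lambda>i. m i + m' i))"
    unfolding monomial_mult[symmetric] by (simp add: fun_eq_iff)
  then show ?case using rpoly.rpoly_monomial by metis
qed (simp add: distrib_left rpoly_add)

lemma rpoly_mult: "rpoly P \<Longrightarrow> rpoly Q \<Longrightarrow> rpoly (\<lambda>w. P w * Q w)"
  by (induction P rule: rpoly.induct) (simp_all add: rpoly_mult_monomial distrib_right rpoly_add)

lemma rpoly_sum: "(\<And>i. i \<in> I \<Longrightarrow> rpoly (P i)) \<Longrightarrow> rpoly (\<lambda>w. \<Sum>i\<in>I. P i w)"
  by (induction I rule: infinite_finite_induct) (simp_all add: rpoly_const rpoly_add)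

lemma rpoly_cnj: "rpoly P \<Longrightarrow> rpoly (\<lambda>w. cnj (P w))"
proof (induction P rule: rpoly.induct)
  case (rpoly_monomial c k m)
  have "cnj (monomial w k m) = monomial w m k" for w :: "complex^'a"
    by (simp add: monomial_def mult.commute)
  then show ?case using rpoly.rpoly_monomial[of "cnj c" m k] by simp
qed (simp add: rpoly_add)

lemma rpoly_continuous: "rpoly P \<Longrightarrow> continuous_on S P"
  by (induction P rule: rpoly.induct) (auto simp: monomial_def intro!: continuous_intros)

lemma rpoly_list: "rpoly P \<Longrightarrow> \<exists>xs. \<forall>w. P w = (\<Sum>(c, k, m)\<leftarrow>xs. c * monomial w k m)"
proof (induction P rule: rpoly.induct)
  case (rpoly_monomial c k m)
  show ?case by (rule exI[of _ "[(c, k, m)]"]) simp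
next
  case (rpoly_add P Q)
  then obtain xs ys where "\<forall>w. P w = (\<Sum>(c, k, m)\<leftarrow>xs. c * monomial w k m)"
    "\<forall>w. Q w = (\<Sum>(c, k, m)\<leftarrow>ys. c * monomial w k m)" by blast
  then show ?case by (intro exI[of _ "xs @ ys"]) simp
qed

text \<open>Along a ray a monomial of total degree \<open>d\<close> is \<open>t ^ d\<close> times
  its value at \<open>w\<close>, so a primitive in \<open>t\<close> is explicit and again a monomial
  in \<open>w\<close>. Thus \<open>R 1 w\<close> is the integral of \<open>Q\<close> over the
  segment from 0 to \<open>w\<close>.\<close>

lemma rpoly_radial_primitive:
  "rpoly Q \<Longrightarrow> \<exists>R. rpoly (R 1) \<and> (\<forall>w. R 0 w = 0) \<and>
     (\<forall>w t. ((\<lambda>t. R t w) has_vector_derivative Q (of_real t *s w)) (at t))"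
proof (induction Q rule: rpoly.induct)
  case (rpoly_monomial c k m)
  define d where "d = sum k UNIV + sum m UNIV"
  let ?R = "\<lambda>t w. c / of_nat (Suc d) * of_real t ^ Suc d * monomial w k m"
  have "((\<lambda>t. ?R t w) has_vector_derivative c * monomial (of_real t *s w) k m) (at t)" for w t
  proof (rule has_vector_derivative_real_field)
    have "((\<lambda>z. c / of_nat (Suc d) * z ^ Suc d * monomial w k m) has_field_derivative
        c / of_nat (Suc d) * (of_nat (Suc d) * of_real t ^ d) * monomial w k m) (at (of_real t))"
      by (rule derivative_eq_intros refl | simp)+
    then show "((\<lambda>z. c / of_nat (Suc d) * z ^ Suc d * monomial w k m) has_field_derivative
        c * monomial (of_real t *s w) k m) (at (of_real t))"
      by (simp add: monomial_smult d_def[symmetric] mult.assoc del: of_nat_Suc)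
  qed
  moreover have "rpoly (?R 1)" using rpoly.rpoly_monomial[of "c / of_nat (Suc d)" k m] by (simp del: of_nat_Suc)
  ultimately show ?case by (intro exI[of _ ?R]) simp
next
  case (rpoly_add P Q)
  then obtain R S where "rpoly (R 1)" "\<forall>w. R 0 w = 0"
     "\<forall>w t. ((\<lambda>t. R t w) has_vector_derivative P (of_real t *s w)) (at t)"
     "rpoly (S 1)" "\<forall>w. S 0 w = 0"
     "\<forall>w t. ((\<lambda>t. S t w) has_vector_derivative Q (of_real t *s w)) (at t)" by blast
  then show ?case
    by (intro exI[of _ "\<lambda>t w. R t w + S t w"]) (simp add: rpoly.rpoly_add has_vector_derivative_add)
qed

text \<open>A big-O form of the Taylor expansion. Polynomial, constant and radius may depend on
  \<open>n\<close>, and nothing relates the polynomials of different orders. This weak form is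
  stable under sums, products and holomorphic substitutions.\<close>

definition taylor_approx :: "nat \<Rightarrow> (complex^'n \<Rightarrow> complex) \<Rightarrow> bool" where
  "taylor_approx n u \<longleftrightarrow> (\<exists>Q C d. rpoly Q \<and> d > 0 \<and> (\<forall>w. norm w < d \<longrightarrow> norm (u w - Q w) \<le> C * norm w ^ n))"

lemma taylor_approxE:
  assumes "taylor_approx n u"
  obtains Q d C where "rpoly Q" "d > 0" "d \<le> 1" "C \<ge> 0" "\<And>w. norm w < d \<Longrightarrow> norm (u w - Q w) \<le> C * norm w ^ n"
proof -
  obtain Q d C where Q: "rpoly Q" "d > 0" "\<And>w. norm w < d \<Longrightarrow> norm (u w - Q w) \<le> C * norm w ^ n"
    using assms unfolding taylor_approx_def by blast
  have "norm (u w - Q w) \<le> \<bar>C\<bar> * norm w ^ n" if "norm w < min d 1" for w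
  proof -
    have "C * norm w ^ n \<le> \<bar>C\<bar> * norm w ^ n" by (intro mult_right_mono) auto
    with Q(3)[of w] that show ?thesis by linarith
  qed
  with Q(1,2) that[of Q "min d 1" "\<bar>C\<bar>"] show thesis by simp
qed

lemma taylor_approx_rpoly: "rpoly Q \<Longrightarrow> taylor_approx n Q"
  unfolding taylor_approx_def by (intro exI[of _ Q] exI[of _ 0] exI[of _ 1]) simp

lemma taylor_approx_add:
  assumes "taylor_approx n u" "taylor_approx n v"
  shows "taylor_approx n (\<lambda>w. u w + v w)"
proof -
  from assms(1) obtain Q d C where Q: "rpoly Q" "d > 0" "\<And>w. norm w < d \<Longrightarrow> norm (u w - Q w) \<le> C * norm w ^ n"
    by (elim taylor_approxE) (rule that)
  from assms(2) obtain Q' d' C' where Q': "rpoly Q'" "d' > 0" "\<And>w. norm w < d' \<Longrightarrow> norm (v w - Q' w) \<le> C' * norm w ^ n"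
    by (elim taylor_approxE) (rule that)
  have "norm (u w + v w - (Q w + Q' w)) \<le> (C + C') * norm w ^ n" if "norm w < min d d'" for w
  proof -
    have "norm ((u w - Q w) + (v w - Q' w)) \<le> C * norm w ^ n + C' * norm w ^ n"
      using that by (intro norm_triangle_mono Q Q') auto
    then show ?thesis by (simp add: algebra_simps)
  qed
  with Q(1,2) Q'(1,2) show ?thesis unfolding taylor_approx_def
    by (intro exI[of _ "\<lambda>w. Q w + Q' w"] exI[of _ "C + C'"] exI[of _ "min d d'"]) (simp add: rpoly_add)
qed

lemma rpoly_bounded: "rpoly Q \<Longrightarrow> \<exists>B\<ge>0. \<forall>w. norm w \<le> 1 \<longrightarrow> norm (Q w) \<le> B"
proof -
  assume Q: "rpoly Q"
  have "compact (Q ` cball 0 1)" by (intro compact_continuous_image rpoly_continuous Q) auto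
  then have "bounded (Q ` cball 0 1)" by (rule compact_imp_bounded)
  then obtain B where B: "B > 0" "\<forall>x\<in>Q ` cball 0 1. norm x \<le> B" unfolding bounded_pos by blast
  then have "\<forall>w. norm w \<le> 1 \<longrightarrow> norm (Q w) \<le> B" by simp
  with B(1) show ?thesis by (intro exI[of _ B]) simp
qed

lemma taylor_approx_mult:
  assumes "taylor_approx n u" "taylor_approx n v"
  shows "taylor_approx n (\<lambda>w. u w * v w)"
proof -
  from assms(1) obtain Q d C where Q: "rpoly Q" "d > 0" "d \<le> 1" "C \<ge> 0" "\<And>w. norm w < d \<Longrightarrow> norm (u w - Q w) \<le> C * norm w ^ n"
    by (elim taylor_approxE) (rule that)
  from assms(2) obtain Q' d' C' where Q': "rpoly Q'" "d' > 0" "d' \<le> 1" "C' \<ge> 0" "\<And>w. norm w < d' \<Longrightarrow> norm (v w - Q' w) \<le> C' * norm w ^ n"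
    by (elim taylor_approxE) (rule that)
  obtain B where B: "B \<ge> 0" "\<And>w. norm w \<le> 1 \<Longrightarrow> norm (Q w) \<le> B" using rpoly_bounded[OF Q(1)] by blast
  obtain B' where B': "B' \<ge> 0" "\<And>w. norm w \<le> 1 \<Longrightarrow> norm (Q' w) \<le> B'" using rpoly_bounded[OF Q'(1)] by blast
  have "norm (u w * v w - Q w * Q' w) \<le> ((B + C) * C' + B' * C) * norm w ^ n" if "norm w < min d d'" for w
  proof -
    have w: "norm w < d" "norm w < d'" "norm w \<le> 1" using that Q(3) by auto
    have "norm w ^ n \<le> 1" using w by (simp add: power_le_one)
    then have "C * norm w ^ n \<le> C * 1" using Q(4) by (intro mult_left_mono)
    then have "norm (u w - Q w) \<le> C" using Q(5)[OF w(1)] by simp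
    then have uB: "norm (u w) \<le> B + C" using B(2)[OF w(3)] norm_triangle_sub[of "u w" "Q w"] by linarith
    have "u w * v w - Q w * Q' w = u w * (v w - Q' w) + Q' w * (u w - Q w)" by (simp add: algebra_simps)
    also have "norm \<dots> \<le> (B + C) * (C' * norm w ^ n) + B' * (C * norm w ^ n)"
      using uB B B' Q Q' w by (intro norm_triangle_mono norm_mult_ineq[THEN order.trans] mult_mono) auto
    finally show ?thesis by (simp add: algebra_simps)
  qed
  with Q(1,2) Q'(1,2) show ?thesis unfolding taylor_approx_def
    by (intro exI[of _ "\<lambda>w. Q w * Q' w"] exI[of _ "(B + C) * C' + B' * C"] exI[of _ "min d d'"])
      (simp add: rpoly_mult)
qed

lemma taylor_approx_cnj:
  assumes "taylor_approx n u" shows "taylor_approx n (\<lambda>w. cnj (u w))"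
proof -
  from assms obtain Q d C where Q: "rpoly Q" "d > 0" "\<And>w. norm w < d \<Longrightarrow> norm (u w - Q w) \<le> C * norm w ^ n"
    by (elim taylor_approxE) (rule that)
  have "norm (cnj (u w) - cnj (Q w)) = norm (u w - Q w)" for w
    by (simp flip: complex_cnj_diff)
  with Q show ?thesis unfolding taylor_approx_def
    by (intro exI[of _ "\<lambda>w. cnj (Q w)"] exI[of _ C] exI[of _ d]) (simp add: rpoly_cnj)
qed

lemma taylor_approx_const: "taylor_approx n (\<lambda>_. c)"
  by (intro taylor_approx_rpoly rpoly_const)

lemma taylor_approx_power: "taylor_approx n u \<Longrightarrow> taylor_approx n (\<lambda>w. u w ^ k)"
  by (induction k) (simp_all add: taylor_approx_const taylor_approx_mult)

lemma taylor_approx_prod: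
  "(\<And>i. i \<in> I \<Longrightarrow> taylor_approx n (u i)) \<Longrightarrow> taylor_approx n (\<lambda>w. \<Prod>i\<in>I. u i w)"
  by (induction I rule: infinite_finite_induct) (simp_all add: taylor_approx_const taylor_approx_mult)


text \<open>Induction on the order: the partial derivatives have approximations \<open>Q i\<close>
  of order \<open>n\<close>, and integrating the sum of \<open>w $ i * Q i\<close> along the ray to
  \<open>w\<close> raises the order by one.\<close>

lemma holomorphic_taylor_approx:
  fixes f :: "complex^'n \<Rightarrow> complex"
  assumes "open S" "0 \<in> S" "holomorphic_fun_on f S"
  shows "taylor_approx n f"
  using assms(3)
proof (induction n arbitrary: f)
  case (0 f)
  have "isCont f 0"
    using holomorphic_fun_on_continuous[OF 0] assms(1,2) continuous_on_eq_continuous_at by blast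
  then obtain d where d: "d > 0" "\<And>w. dist w 0 < d \<Longrightarrow> dist (f w) (f 0) < 1"
    unfolding continuous_at_eps_delta using zero_less_one by blast
  have "norm (f w - 0) \<le> (norm (f 0) + 1) * norm w ^ 0" if "norm w < d" for w
    using d(2)[of w] that norm_triangle_sub[of "f w" "f 0"] by (simp add: dist_norm)
  with d(1) show ?case unfolding taylor_approx_def
    by (intro exI[of _ "\<lambda>_. 0"] exI[of _ "norm (f 0) + 1"] exI[of _ d] conjI rpoly_const) simp_all
next
  case (Suc n f)
  have "taylor_approx n (\<lambda>x. fderiv f x (axis i 1))" for i
    by (rule Suc.IH[OF holomorphic_fun_on_directional_derivative[OF assms(1) Suc.prems]])
  then have "\<forall>i. \<exists>Q C d. rpoly Q \<and> d > 0 \<and> (\<forall>w. norm w < d \<longrightarrow> norm (fderiv f w (axis i 1) - Q w) \<le> C * norm w ^ n)"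
    unfolding taylor_approx_def by simp
  then obtain Q d C where Q: "\<And>i. rpoly (Q i)" "\<And>i. d i > (0::real)"
    "\<And>i w. norm w < d i \<Longrightarrow> norm (fderiv f w (axis i 1) - Q i w) \<le> C i * norm w ^ n" by metis
  have "\<forall>i. \<exists>R. rpoly (R 1) \<and> (\<forall>w. R 0 w = 0) \<and>
     (\<forall>w t. ((\<lambda>t. R t w) has_vector_derivative Q i (of_real t *s w)) (at t))"
    using rpoly_radial_primitive[OF Q(1)] by blast
  then obtain R where R: "\<And>i. rpoly (R i 1)" "\<And>i w. R i 0 w = 0"
     "\<And>i w t. ((\<lambda>t. R i t w) has_vector_derivative Q i (of_real t *s w)) (at (t :: real))" by metis
  obtain r where r: "r > 0" "ball 0 r \<subseteq> S" using assms(1,2) open_contains_ball by blast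
  define e where "e = min r (Min (range d))"
  have e: "e > 0" "e \<le> r" "\<And>i. e \<le> d i"
    using r Q(2) by (auto simp: e_def Min_gr_iff intro: min.coboundedI2 Min_le)
  define P where "P w = f 0 + (\<Sum>i\<in>UNIV. w $ i * R i 1 w)" for w
  have "rpoly P" unfolding P_def
    by (intro rpoly_add rpoly_const rpoly_sum rpoly_mult rpoly_nth R)
  moreover have "norm (f w - P w) \<le> (\<Sum>i\<in>UNIV. \<bar>C i\<bar>) * norm w ^ Suc n" if w: "norm w < e" for w
  proof -
    \<comment> \<open>The error along the ray. Its derivative \<open>u'\<close> is the sum of the
      errors of the partial derivatives weighted by \<open>w $ i\<close>; this weight supplies the
      additional power of \<open>norm w\<close> in the mean value inequality.\<close>
    define u where "u t = f (of_real t *s w) - (\<Sum>i\<in>UNIV. w $ i * R i t w)" for t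
    define u' where "u' t = (\<Sum>i\<in>UNIV. w $ i * (fderiv f (of_real t *s w) (axis i 1) - Q i (of_real t *s w)))" for t
    have tw: "norm (of_real t *s w) \<le> norm w" if "t \<in> {0..1}" for t
      using that by (simp add: norm_vector_smult mult_left_le_one_le)
    have tS: "of_real t *s w \<in> S" if "t \<in> {0..1}" for t
      using tw[OF that] w e r by auto
    have der: "(u has_vector_derivative u' t) (at t)" if t: "t \<in> {0..1}" for t
    proof -
      have "((\<lambda>z. f (0 + z *s w)) has_field_derivative fderiv f (0 + of_real t *s w) w) (at (of_real t))"
        using tS[OF t] by (intro holomorphic_fun_slice[OF Suc.prems]) simp
      then have "((\<lambda>t. f (of_real t *s w)) has_vector_derivative fderiv f (of_real t *s w) w) (at t)"
        by (intro has_vector_derivative_real_field) simp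
      then have "(u has_vector_derivative fderiv f (of_real t *s w) w - (\<Sum>i\<in>UNIV. w $ i * Q i (of_real t *s w))) (at t)"
        unfolding u_def
        by (intro has_vector_derivative_diff has_vector_derivative_sum has_vector_derivative_mult_right R(3))
      then show ?thesis unfolding u'_def fderiv_expand[OF Suc.prems tS[OF t], of w]
        by (simp add: right_diff_distrib sum_subtractf)
    qed
    have bound: "norm (u' t) \<le> (\<Sum>i\<in>UNIV. \<bar>C i\<bar>) * norm w ^ Suc n" if t: "t \<in> {0..1}" for t
      unfolding u'_def sum_distrib_right
    proof (intro sum_norm_le)
      fix i
      have "norm (fderiv f (of_real t *s w) (axis i 1) - Q i (of_real t *s w)) \<le> C i * norm (of_real t *s w) ^ n"
        using tw[OF t] w e(3)[of i] by (intro Q(3)) simp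
      also have "\<dots> \<le> \<bar>C i\<bar> * norm w ^ n"
        using tw[OF t] by (intro mult_mono power_mono) auto
      finally have "norm (w $ i) * norm (fderiv f (of_real t *s w) (axis i 1) - Q i (of_real t *s w)) \<le> norm w * (\<bar>C i\<bar> * norm w ^ n)"
        by (intro mult_mono Finite_Cartesian_Product.norm_nth_le) auto
      then show "norm (w $ i * (fderiv f (of_real t *s w) (axis i 1) - Q i (of_real t *s w))) \<le> \<bar>C i\<bar> * norm w ^ Suc n"
        by (simp add: norm_mult mult.left_commute)
    qed
    have "\<exists>x\<in>{0<..<1}. norm (u 1 - u 0) \<le> norm ((1 - 0) *\<^sub>R u' x)"
    proof (rule mvt_general)
      show "continuous_on {0..1} u"
        by (intro continuous_at_imp_continuous_on ballI has_vector_derivative_continuous[OF der])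
      show "(u has_derivative (\<lambda>h. h *\<^sub>R u' x)) (at x)" if "0 < x" "x < 1" for x
        using der[of x] that by (simp add: has_vector_derivative_def)
    qed simp
    then obtain x where x: "x \<in> {0<..<1}" "norm (u 1 - u 0) \<le> norm (u' x)" by auto
    have "u 1 - u 0 = f w - P w" by (simp add: u_def P_def R(2))
    with x bound[of x] show ?thesis by simp
  qed
  ultimately show ?case unfolding taylor_approx_def using e(1) by blast
qed

text \<open>Polynomials in \<open>g\<close> and its conjugate are covered by closure under sums and
  products. Differentiability at 0 together with \<open>g 0 = 0\<close> bounds
  \<open>norm (g w)\<close> by a multiple of \<open>norm w\<close>, which carries over the
  remainder.\<close>

lemma holomorphic_taylor_substitution:
  fixes \<psi> :: "complex^'k \<Rightarrow> complex" and g :: "complex^'n \<Rightarrow> complex^'k"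
  assumes g: "open S" "0 \<in> S" "holomorphic_map_on g S" "g 0 = 0"
    and \<psi>: "taylor_approx n \<psi>"
  shows "taylor_approx n (\<lambda>w. \<psi> (g w))"
proof -
  have tg: "taylor_approx n (\<lambda>w. g w $ i)" for i
    using g by (intro holomorphic_taylor_approx[OF g(1,2)]) (simp add: holomorphic_map_on_def)
  from \<psi> obtain Q d C where Q: "rpoly Q" "d > 0" "C \<ge> 0" "\<And>w. norm w < d \<Longrightarrow> norm (\<psi> w - Q w) \<le> C * norm w ^ n"
    by (elim taylor_approxE) (rule that)
  have "taylor_approx n (\<lambda>w. Q (g w))" using Q(1)
  proof (induction Q rule: rpoly.induct)
    case (rpoly_monomial c k m)
    show ?case unfolding monomial_def complex_cnj_power
      by (intro taylor_approx_mult taylor_approx_const taylor_approx_prod taylor_approx_power taylor_approx_cnj tg)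
  qed (simp add: taylor_approx_add)
  moreover have "taylor_approx n (\<lambda>w. \<psi> (g w) - Q (g w))"
  proof -
    from holomorphic_map_has_frechet_derivative[OF g(3,2)]
    have der: "(g has_derivative frechet_derivative g (at 0)) (at 0)" .
    then obtain K where K: "K > 0" "\<And>h. norm (frechet_derivative g (at 0) h) \<le> norm h * K"
      using bounded_linear.pos_bounded[OF has_derivative_bounded_linear] by blast
    from der obtain e where e: "e > 0"
      "\<And>w. norm (w - 0) < e \<Longrightarrow> norm (g w - g 0 - frechet_derivative g (at 0) (w - 0)) \<le> 1 * norm (w - 0)"
      unfolding has_derivative_at_alt using zero_less_one by blast
    have gw: "norm (g w) \<le> (K + 1) * norm w" if "norm w < e" for w
      using e(2)[of w] K(2)[of w] that norm_triangle_sub[of "g w" "frechet_derivative g (at 0) w"]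
      by (simp add: g(4) algebra_simps)
    have "norm (\<psi> (g w) - Q (g w) - 0) \<le> C * (K + 1) ^ n * norm w ^ n" if "norm w < min e (d / (K + 1))" for w
    proof -
      have "(K + 1) * norm w < d" using that K by (simp add: pos_less_divide_eq mult.commute)
      then have "norm (\<psi> (g w) - Q (g w)) \<le> C * norm (g w) ^ n"
        using gw[of w] that by (intro Q(4)) simp
      also have "\<dots> \<le> C * ((K + 1) * norm w) ^ n"
        using gw[of w] that Q(3) by (intro mult_left_mono power_mono) auto
      finally show ?thesis by (simp add: power_mult_distrib)
    qed
    with e(1) Q(2) K(1) show ?thesis unfolding taylor_approx_def
      by (intro exI[of _ "\<lambda>_. 0"] exI[of _ "C * (K + 1) ^ n"] exI[of _ "min e (d / (K + 1))"] conjI rpoly_const) auto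
  qed
  ultimately have "taylor_approx n (\<lambda>w. Q (g w) + (\<psi> (g w) - Q (g w)))" by (rule taylor_approx_add)
  then show ?thesis by simp
qed

subsection \<open>Bounded holomorphic functions on a half-plane\<close>

text \<open>Maximum principle for f(z) exp (- L z) / (1 - e z): in the half-plane the denominator
  has modulus at least 1 and grows at infinity, which disposes of the far part of the boundary.
  Letting \<open>e\<close> tend to 0 leaves only the bound \<open>B\<close>; the values of
  \<open>C\<close> and \<open>S\<close> enter the proof but not the conclusion.\<close>

lemma phragmen_lindelof_half_plane:
  fixes f :: "complex \<Rightarrow> complex"
  assumes hol: "f holomorphic_on {z. Re z < 0}"
    and B: "\<And>z. Re z < 0 \<Longrightarrow> norm (f z) \<le> B"
    and decay: "\<And>z. Re z \<le> S \<Longrightarrow> Re z < 0 \<Longrightarrow> norm (f z) \<le> C * exp (L * Re z)"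
    and z0: "Re z0 < 0"
  shows "norm (f z0) \<le> B * exp (L * Re z0)"
proof -
  define g where "g = (\<lambda>z. f z * exp (- of_real L * z))"
  have ng: "norm (g z) = norm (f z) * exp (- L * Re z)" for z
    by (simp add: g_def norm_mult)
  have B0: "B \<ge> 0" by (rule order_trans[OF norm_ge_zero B[of "-1"]]) simp
  \<comment> \<open>A crude global bound for \<open>g\<close>: the decay hypothesis to the left of
    \<open>S\<close>, and \<open>B\<close> in the strip between \<open>S\<close> and 0. It serves
    only to choose \<open>R\<close>.\<close>
  define D where "D = max C (B * exp (\<bar>L\<bar> * \<bar>S\<bar>))"
  have D: "norm (g z) \<le> D" if "Re z < 0" for z
  proof (cases "Re z \<le> S")
    case True
    have "norm (g z) \<le> C * exp (L * Re z) * exp (- L * Re z)"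
      unfolding ng by (intro mult_right_mono decay True that) auto
    also have "\<dots> = C" by (simp flip: exp_add)
    finally show ?thesis by (simp add: D_def)
  next
    case False
    have "- L * Re z \<le> \<bar>L\<bar> * \<bar>S\<bar>"
    proof -
      have "- L * Re z \<le> \<bar>L * Re z\<bar>" by simp
      also have "\<dots> \<le> \<bar>L\<bar> * \<bar>S\<bar>" unfolding abs_mult using False that by (intro mult_left_mono) auto
      finally show ?thesis .
    qed
    then have "norm (g z) \<le> B * exp (\<bar>L\<bar> * \<bar>S\<bar>)"
      unfolding ng by (intro mult_mono B that) (auto simp: B0)
    then show ?thesis by (simp add: D_def)
  qed
  have D0: "D \<ge> 0" using B0 by (simp add: D_def le_max_iff_disj)
  have holg: "g holomorphic_on {z. Re z < 0}"
    unfolding g_def by (intro holomorphic_intros hol)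
  have key: "norm (g z0) \<le> (B * exp (\<bar>L\<bar> * e) + e) * (1 + e * norm z0)"
    if e: "e > 0" "e < - Re z0" for e
  proof -
    \<comment> \<open>Large enough that \<open>z0\<close> lies inside and that
      \<open>D / (e * R) \<le> e\<close>, the bound on the circular part of the frontier.\<close>
    define R where "R = norm z0 + D / (e * e) + 1"
    define U where "U = {z. Re z < - e \<and> norm z < R}"
    have R: "R > 0" "R > norm z0" "D / (e * e) \<le> R"
      using D0 e by (auto simp: R_def intro: add_nonneg_nonneg add_nonneg_pos)
    have "open U" unfolding U_def
      by (intro open_Collect_conj open_Collect_less continuous_intros)
    then have iU: "interior U = U" by (simp add: interior_open)
    have cl: "closure U \<subseteq> {z. Re z \<le> - e \<and> norm z \<le> R}"
      unfolding U_def
      by (rule closure_minimal)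
        (auto intro!: closed_Collect_conj closed_Collect_le continuous_intros)
    have ge1: "norm (1 - of_real e * z) \<ge> 1" if "Re z < 0" for z :: complex
    proof -
      have "1 \<le> Re (1 - of_real e * z)" using that e by (simp add: mult_le_0_iff)
      then show ?thesis using complex_Re_le_cmod order_trans by blast
    qed
    have ge2: "norm (1 - of_real e * z) \<ge> e * norm z" if "Re z < 0" for z :: complex
    proof (rule power2_le_imp_le)
      have "e * Re z \<le> 0" using that e by (simp add: mult_le_0_iff)
      then show "(e * norm z)\<^sup>2 \<le> (norm (1 - of_real e * z))\<^sup>2"
        unfolding power_mult_distrib cmod_power2 by (simp add: power2_eq_square algebra_simps)
    qed simp
    let ?h = "\<lambda>z. g z / (1 - of_real e * z)"
    have holh: "?h holomorphic_on {z. Re z < 0}"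
      by (intro holomorphic_intros holg) (use ge1 in fastforce)
    have sub: "closure U \<subseteq> {z. Re z < 0}" using cl e by force
    have "norm (?h z0) \<le> B * exp (\<bar>L\<bar> * e) + e"
    proof (rule maximum_modulus_frontier[where S = U and f = ?h])
      show "?h holomorphic_on interior U"
        using holh iU sub closure_subset by (metis holomorphic_on_subset order_trans)
      show "continuous_on (closure U) ?h"
        using holh sub holomorphic_on_imp_continuous_on holomorphic_on_subset by blast
      show "bounded U" by (rule bounded_subset[of "ball 0 R"]) (auto simp: U_def)
      show "z0 \<in> U" using e R by (simp add: U_def)
      fix z assume "z \<in> frontier U"
      then have zz: "z \<in> closure U" "z \<notin> U"
        using iU by (auto simp: frontier_def)
      have neg: "Re z < 0" using zz sub by auto
      from zz cl have "Re z = - e \<or> norm z = R" by (auto simp: U_def)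
      then show "norm (?h z) \<le> B * exp (\<bar>L\<bar> * e) + e"
      proof
        assume r: "Re z = - e"
        have "norm (?h z) \<le> norm (g z)"
          unfolding norm_divide using ge1[OF neg] by (simp add: divide_le_eq mult_left_le mult_le_cancel_left1)
        also have "\<dots> \<le> B * exp (\<bar>L\<bar> * e)"
          unfolding ng by (intro mult_mono B neg) (use r e B0 in \<open>auto simp: mult_right_mono\<close>)
        finally show ?thesis using e by simp
      next
        assume r: "norm z = R"
        have "norm (?h z) \<le> D / (e * R)"
          unfolding norm_divide using D[OF neg] ge2[OF neg] r e R D0
          by (intro frac_le) auto
        also have "\<dots> \<le> e" using R e by (simp add: field_simps)
        also have "\<dots> \<le> B * exp (\<bar>L\<bar> * e) + e" using B0 by simp
        finally show ?thesis .
      qed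
    qed
    then have "norm (g z0) \<le> (B * exp (\<bar>L\<bar> * e) + e) * norm (1 - of_real e * z0)"
      unfolding norm_divide by (simp only: pos_divide_le_eq[OF less_le_trans[OF zero_less_one ge1[OF z0]]])
    also have "\<dots> \<le> (B * exp (\<bar>L\<bar> * e) + e) * (1 + e * norm z0)"
    proof (intro mult_left_mono)
      show "norm (1 - of_real e * z0) \<le> 1 + e * norm z0"
        using norm_triangle_ineq4[of 1 "of_real e * z0"] e by (simp add: norm_mult)
    qed (use B0 e in auto)
    finally show ?thesis .
  qed
  have "((\<lambda>e. (B * exp (\<bar>L\<bar> * e) + e) * (1 + e * norm z0)) \<longlongrightarrow> (B * exp (\<bar>L\<bar> * 0) + 0) * (1 + 0 * norm z0)) (at_right 0)"
    by (intro tendsto_intros)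
  moreover have "\<forall>\<^sub>F e in at_right 0. norm (g z0) \<le> (B * exp (\<bar>L\<bar> * e) + e) * (1 + e * norm z0)"
    unfolding eventually_at_right_field using key z0 by (intro exI[of _ "- Re z0"]) auto
  ultimately have "norm (g z0) \<le> (B * exp (\<bar>L\<bar> * 0) + 0) * (1 + 0 * norm z0)"
    by (intro tendsto_lowerbound) auto
  then have "norm (f z0) * exp (- L * Re z0) * exp (L * Re z0) \<le> B * exp (L * Re z0)"
    unfolding ng by (intro mult_right_mono) auto
  then show ?thesis by (simp add: mult.assoc flip: exp_add)
qed

text \<open>Far to the left, large discs fit into the half-plane, so Cauchy's estimate
  kills the derivative of a bounded function.\<close>

lemma vertical_limit_constant:
  fixes k :: "complex \<Rightarrow> complex" and K :: "real \<Rightarrow> complex"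
  assumes hol: "k holomorphic_on {z. Re z < 0}"
    and K: "\<And>t. norm (K t) \<le> B"
    and lim: "\<And>e. e > 0 \<Longrightarrow> \<exists>S. \<forall>z. Re z \<le> S \<and> Re z < 0 \<longrightarrow> norm (k z - K (Im z)) \<le> e"
  shows "K t = K 0"
proof -
  have "norm (K t - K 0) \<le> 0 + e" if "e > 0" for e
  proof -
    obtain S1 where S1: "\<And>z. Re z \<le> S1 \<Longrightarrow> Re z < 0 \<Longrightarrow> norm (k z - K (Im z)) \<le> e / 3"
      using lim[of "e/3"] \<open>e > 0\<close> by auto
    obtain S2 where S2: "\<And>z. Re z \<le> S2 \<Longrightarrow> Re z < 0 \<Longrightarrow> norm (k z - K (Im z)) \<le> 1"
      using lim[of 1] by auto
    \<comment> \<open>Cauchy's estimate on discs of radius \<open>R\<close> bounds the derivative by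
      \<open>(B + 1) / R\<close>, so a vertical displacement by \<open>t\<close> changes
      \<open>k\<close> by at most \<open>e / 3\<close>.\<close>
    define R where "R = 3 * \<bar>t\<bar> * (B + 1) / e + 1"
    have "B \<ge> 0" using K[of 0] norm_ge_zero order_trans by blast
    then have R: "R > 0" using \<open>e > 0\<close> by (auto simp: R_def intro: add_nonneg_pos)
    \<comment> \<open>Discs of radius \<open>R\<close> centred on the line \<open>Re z = s\<close>
      stay in the region where \<open>k\<close> is within 1 of \<open>K\<close>, hence bounded by
      \<open>B + 1\<close>.\<close>
    define s where "s = min (min S1 S2) 0 - R - 1"
    have bd: "norm (k z) \<le> B + 1" if "Re z \<le> s + R" for z
    proof -
      have "norm (k z) \<le> norm (K (Im z)) + norm (k z - K (Im z))"
        by (rule norm_triangle_sub)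
      also have "\<dots> \<le> B + 1" using that by (intro add_mono K S2) (auto simp: s_def)
      finally show ?thesis .
    qed
    have der: "norm (deriv k z) \<le> (B + 1) / R" if "Re z = s" for z
    proof -
      have Reb: "Re x \<le> s + R" if "dist z x \<le> R" for x
        using that \<open>Re z = s\<close> abs_Re_le_cmod[of "x - z"] by (auto simp: dist_norm norm_minus_commute)
      have sub: "cball z R \<subseteq> {z. Re z < 0}"
        using Reb by (force simp: s_def)
      have "norm ((deriv ^^ 1) k z) \<le> fact 1 * (B + 1) / R ^ 1"
        by (rule higher_deriv_bound_cball[OF hol sub R(1)]) (simp add: bd Reb)
      then show ?thesis by simp
    qed
    have "norm (k (Complex s t) - k (Complex s 0)) \<le> (B + 1) / R * norm (Complex s t - Complex s 0)"
    proof (rule field_differentiable_bound[where S = "{z. Re z = s}" and f' = "deriv k"])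
      show "convex {z. Re z = s}"
        using convex_hyperplane[of "1::complex" s] by (simp add: inner_complex_def)
      fix z assume "z \<in> {z. Re z = s}"
      moreover have "open {z. Re z < 0}" by (rule open_halfspace_Re_lt)
      ultimately show "(k has_field_derivative deriv k z) (at z within {z. Re z = s})"
        using holomorphic_derivI[OF hol, of z] R by (auto simp: s_def intro: has_field_derivative_at_within)
    qed (use der in auto)
    also have "norm (Complex s t - Complex s 0) = \<bar>t\<bar>"
      by (simp add: cmod_def)
    also have "(B + 1) / R * \<bar>t\<bar> \<le> e / 3"
    proof -
      have "3 * \<bar>t\<bar> * (B + 1) \<le> R * e" using \<open>e > 0\<close> by (simp add: R_def field_simps)
      then show ?thesis using R by (simp add: field_simps)
    qed
    finally have 1: "norm (k (Complex s t) - k (Complex s 0)) \<le> e / 3" .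
    have 2: "norm (k (Complex s u) - K u) \<le> e / 3" for u
      using S1[of "Complex s u"] R by (simp add: s_def)
    have "K t - K 0 = (k (Complex s t) - k (Complex s 0)) - (k (Complex s t) - K t) + (k (Complex s 0) - K 0)"
      by simp
    also have "norm \<dots> \<le> e / 3 + e / 3 + e / 3"
      by (intro norm_triangle_mono order.trans[OF norm_triangle_ineq4] add_mono 1 2)
    finally show ?thesis by simp
  qed
  then have "norm (K t - K 0) \<le> 0" by (rule field_le_epsilon)
  then show ?thesis by simp
qed

section \<open>Averages of oscillations and expansions in exponentials\<close>

lemma power_average_bound:
  fixes x :: complex
  assumes "norm x = 1" "x \<noteq> 1" "n > 0"
  shows "norm ((\<Sum>m<n. x ^ m) / of_nat n) \<le> 2 / norm (1 - x) / real n"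
proof -
  have "(\<Sum>m<n. x ^ m) = (1 - x ^ n) / (1 - x)"
    using assms by (simp add: sum_gp_strict)
  moreover have "norm (1 - x ^ n) \<le> 2"
    using norm_triangle_ineq4[of 1 "x ^ n"] assms by (simp add: norm_power)
  ultimately show ?thesis
    using assms by (simp add: norm_divide norm_mult divide_right_mono)
qed

lemma power_average_tendsto_0:
  fixes x :: complex
  assumes "norm x = 1" "x \<noteq> 1"
  shows "(\<lambda>n. (\<Sum>m<n. x ^ m) / of_nat n) \<longlonglongrightarrow> 0"
proof (rule Lim_null_comparison)
  show "\<forall>\<^sub>F n in sequentially. norm ((\<Sum>m<n. x ^ m) / of_nat n) \<le> 2 / norm (1 - x) / real n"
    using eventually_gt_at_top[of 0] by eventually_elim (rule power_average_bound[OF assms])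
  show "(\<lambda>n. 2 / norm (1 - x) / real n) \<longlonglongrightarrow> 0"
    by (rule lim_const_over_n)
qed

text \<open>For a sufficiently small step every \<open>q * \<tau>\<close> is nonzero and of modulus
  less than 1, so its sine does not vanish. A common step for all frequencies lets one average
  suppress all of them at once.\<close>

lemma exists_nonresonant_step:
  fixes Q :: "real set"
  assumes "finite Q" "0 \<notin> Q"
  shows "\<exists>\<tau>::real. \<forall>q\<in>Q. exp (\<i> * of_real (q * \<tau>)) \<noteq> 1"
proof (intro exI ballI)
  fix q assume q: "q \<in> Q"
  let ?t = "1 / (1 + (\<Sum>q\<in>Q. \<bar>q\<bar>))"
  have s: "\<bar>q\<bar> \<le> (\<Sum>q\<in>Q. \<bar>q\<bar>)"
    using member_le_sum[of q Q abs] q assms by simp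
  then have lt: "\<bar>q * ?t\<bar> < 1" by (simp add: abs_mult field_simps)
  have ne: "q * ?t \<noteq> 0" using q assms s by auto
  have "sin (q * ?t) \<noteq> 0"
  proof (cases "q * ?t > 0")
    case True
    then show ?thesis using sin_gt_zero[of "q * ?t"] lt pi_gt3 by linarith
  next
    case False
    then show ?thesis using sin_gt_zero[of "- (q * ?t)"] lt ne pi_gt3 by fastforce
  qed
  then have "Im (exp (\<i> * of_real (q * ?t))) \<noteq> 0" by (simp add: Im_exp)
  then show "exp (\<i> * of_real (q * ?t)) \<noteq> 1" by fastforce
qed

text \<open>Averaging over the times \<open>m * \<tau>\<close> with \<open>m < n\<close> leaves the
  constant unchanged and sends every term of nonzero frequency to 0.\<close>

lemma constant_exponential_sum_eq_0:
  fixes q :: "'a \<Rightarrow> real" and b :: "'a \<Rightarrow> complex"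
  assumes J: "finite J" "\<And>j. j \<in> J \<Longrightarrow> q j \<noteq> 0"
    and c: "\<And>t. (\<Sum>j\<in>J. b j * exp (\<i> * of_real (q j * t))) = c"
  shows "c = 0"
proof -
  obtain \<tau> where \<tau>: "\<And>j. j \<in> J \<Longrightarrow> exp (\<i> * of_real (q j * \<tau>)) \<noteq> 1"
    using exists_nonresonant_step[of "q ` J"] J by fastforce
  define x where "x j = exp (\<i> * of_real (q j * \<tau>))" for j
  have xm: "exp (\<i> * of_real (q j * (real m * \<tau>))) = x j ^ m" for j m
    unfolding x_def by (simp flip: exp_of_nat_mult add: algebra_simps)
  have eq: "(\<Sum>j\<in>J. b j * ((\<Sum>m<n. x j ^ m) / of_nat n)) = c" if "n > 0" for n
  proof -
    have "(\<Sum>j\<in>J. b j * ((\<Sum>m<n. x j ^ m) / of_nat n)) = (\<Sum>j\<in>J. \<Sum>m<n. b j * x j ^ m) / of_nat n"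
      by (simp add: sum_distrib_left sum_divide_distrib)
    also have "(\<Sum>j\<in>J. \<Sum>m<n. b j * x j ^ m) = (\<Sum>m<n. \<Sum>j\<in>J. b j * x j ^ m)"
      by (rule sum.swap)
    also have "\<dots> = (\<Sum>m<n. c)"
      by (intro sum.cong refl) (simp only: c flip: xm)
    finally show ?thesis using that by simp
  qed
  have "(\<lambda>n. \<Sum>j\<in>J. b j * ((\<Sum>m<n. x j ^ m) / of_nat n)) \<longlonglongrightarrow> (\<Sum>j\<in>J. b j * 0)"
    by (intro tendsto_sum tendsto_mult tendsto_const power_average_tendsto_0)
      (auto simp: x_def \<tau>[unfolded of_real_mult])
  moreover have "(\<lambda>n. \<Sum>j\<in>J. b j * ((\<Sum>m<n. x j ^ m) / of_nat n)) \<longlonglongrightarrow> c"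
    by (rule tendsto_eventually[OF eventually_mono[OF eventually_gt_at_top[of 0] eq]])
  ultimately show ?thesis using LIMSEQ_unique by fastforce
qed

lemma exp_sum_small_at_bot:
  fixes d w :: "'a \<Rightarrow> real"
  assumes "\<And>j. j \<in> J \<Longrightarrow> d j > 0" "e > 0"
  shows "\<exists>S. \<forall>s\<le>S. (\<Sum>j\<in>J. w j * exp (d j * s)) \<le> e"
proof -
  have lim: "((\<lambda>s. \<Sum>j\<in>J. w j * exp (d j * s)) \<longlongrightarrow> (\<Sum>j\<in>J. w j * 0)) at_bot"
  proof (intro tendsto_sum tendsto_mult tendsto_const)
    fix j assume "j \<in> J"
    then have "filterlim (\<lambda>s. d j * s) at_bot at_bot"
      by (intro filterlim_tendsto_pos_mult_at_bot[OF tendsto_const] assms filterlim_ident)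
    then show "((\<lambda>s. exp (d j * s)) \<longlongrightarrow> 0) at_bot"
      by (rule filterlim_compose[OF exp_at_bot])
  qed
  have "\<forall>\<^sub>F s in at_bot. (\<Sum>j\<in>J. w j * exp (d j * s)) < e"
    using order_tendstoD(2)[OF lim, of e] \<open>e > 0\<close> by simp
  then show ?thesis unfolding eventually_at_bot_linorder by (meson less_imp_le)
qed

text \<open>Averaging over the translates by \<open>\<i> m \<tau>\<close>, \<open>m < n\<close>, suppresses every frequency but \<open>l0\<close>.\<close>

lemma exponential_coefficient_bound:
  fixes h :: "complex \<Rightarrow> complex" and c :: "real \<Rightarrow> complex"
  assumes hol: "h holomorphic_on {z. Re z < 0}"
    and B: "\<And>z. Re z < 0 \<Longrightarrow> norm (h z) \<le> B"
    and Lv: "finite Lv" "\<And>l. l \<in> Lv \<Longrightarrow> 0 \<le> l \<and> l \<le> L"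
    and rem: "\<And>e. e > 0 \<Longrightarrow> \<exists>S. \<forall>z. Re z \<le> S \<and> Re z < 0 \<longrightarrow>
      norm (h z - (\<Sum>l\<in>Lv. c l * exp (of_real l * z))) \<le> e * exp (L * Re z)"
    and l0: "l0 \<in> Lv"
  shows "norm (c l0) \<le> B"
proof -
  obtain \<tau> where \<tau>: "\<And>l. l \<in> Lv \<Longrightarrow> l \<noteq> l0 \<Longrightarrow> exp (\<i> * of_real ((l - l0) * \<tau>)) \<noteq> 1"
    using exists_nonresonant_step[of "(\<lambda>l. l - l0) ` (Lv - {l0})"] Lv by fastforce
  define x where "x l = exp (\<i> * of_real ((l - l0) * \<tau>))" for l
  have x1: "norm (x l) = 1" for l unfolding x_def by (rule norm_exp_i_times)
  define A where "A n l = (\<Sum>m<n. x l ^ m) / of_nat n" for n :: nat and l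
  have A1: "norm (A n l) \<le> 1" for n l
  proof -
    have "norm (\<Sum>m<n. x l ^ m) \<le> (\<Sum>m<n. 1)"
      by (rule order.trans[OF norm_sum]) (simp add: norm_power x1)
    then show ?thesis by (cases "n = 0") (simp_all add: A_def norm_divide)
  qed
  define tr where "tr m = \<i> * of_real (real m * \<tau>)" for m
  \<comment> \<open>The weight \<open>exp (- l0 * tr m)\<close> makes exp (l0 z) invariant under the
    average, whereas exp (l z) is multiplied by the averaged geometric sum
    \<open>A n l\<close>.\<close>
  define av where "av n u z = (\<Sum>m<n. u (z + tr m) * exp (- of_real l0 * tr m)) / of_nat n"
    for n :: nat and u :: "complex \<Rightarrow> complex" and z
  have Retr: "Re (z + tr m) = Re z" for z m by (simp add: tr_def)
  have tr1: "norm (exp (- of_real l0 * tr m)) = 1" for m by (simp add: tr_def)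
  have av_bound: "norm (av n u z) \<le> b" if "\<And>m. norm (u (z + tr m)) \<le> b" "b \<ge> 0" for n u z b
  proof -
    have "norm (\<Sum>m<n. u (z + tr m) * exp (- of_real l0 * tr m)) \<le> (\<Sum>m<n. b)"
      by (rule order.trans[OF norm_sum]) (intro sum_mono, simp only: norm_mult tr1 mult_1_right that)
    then show ?thesis using that(2) by (cases "n = 0") (simp_all add: av_def norm_divide divide_le_eq mult.commute)
  qed
  define r where "r z = h z - (\<Sum>l\<in>Lv. c l * exp (of_real l * z))" for z
  have ex: "exp (of_real l * (z + tr m)) * exp (- of_real l0 * tr m) = exp (of_real l * z) * x l ^ m" for l z m
    unfolding x_def tr_def by (simp add: algebra_simps flip: exp_add exp_of_nat_mult)
  have av_h: "av n h z = av n r z + (\<Sum>l\<in>Lv. c l * exp (of_real l * z) * A n l)" for n z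
  proof -
    have "h w * a - r w * a = (\<Sum>l\<in>Lv. c l * (exp (of_real l * w) * a))" for w a
      unfolding r_def left_diff_distrib sum_distrib_right by (simp add: mult.assoc)
    then have "av n h z - av n r z = (\<Sum>m<n. \<Sum>l\<in>Lv. c l * (exp (of_real l * (z + tr m)) * exp (- of_real l0 * tr m))) / of_nat n"
      unfolding av_def by (simp only: flip: diff_divide_distrib sum_subtractf)
    also have "\<dots> = (\<Sum>l\<in>Lv. c l * exp (of_real l * z) * A n l)"
      unfolding ex by (subst sum.swap) (simp add: A_def sum_distrib_left sum_divide_distrib mult.assoc)
    finally show ?thesis by (simp add: algebra_simps)
  qed
  define lo where "lo = {l \<in> Lv. l < l0}"
  define hi where "hi = {l \<in> Lv. l > l0}"
  have fin: "finite lo" "finite hi" using Lv by (auto simp: lo_def hi_def)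
  have split: "sum f Lv = sum f lo + f l0 + sum f hi" for f :: "real \<Rightarrow> complex"
  proof -
    have "Lv = insert l0 (lo \<union> hi)" using l0 by (auto simp: lo_def hi_def)
    moreover have "sum f (insert l0 (lo \<union> hi)) = f l0 + sum f (lo \<union> hi)"
      using fin by (subst sum.insert) (auto simp: lo_def hi_def)
    moreover have "sum f (lo \<union> hi) = sum f lo + sum f hi"
      using fin by (subst sum.union_disjoint) (auto simp: lo_def hi_def)
    ultimately show ?thesis by (simp add: algebra_simps)
  qed
  \<comment> \<open>Exponents below \<open>l0\<close> would dominate exp (l0 z) far to the left, so
    they are subtracted; since their factors \<open>A n l\<close> tend to 0, this costs only
    \<open>\<delta> n\<close>. Exponents above \<open>l0\<close> may stay, being negligible
    there.\<close>
  define N where "N n z = av n h z - (\<Sum>l\<in>lo. c l * exp (of_real l * z) * A n l)" for n z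
  define \<delta> where "\<delta> n = (\<Sum>l\<in>lo. norm (c l) * norm (A n l))" for n
  have Al0: "A n l0 = 1" if "n > 0" for n using that by (simp add: A_def x_def)
  have N_eq: "N n z = av n r z + c l0 * exp (of_real l0 * z) + (\<Sum>l\<in>hi. c l * exp (of_real l * z) * A n l)"
    if "n > 0" for n z
    unfolding N_def av_h split using that by (simp add: Al0)
  have hi_bound: "norm (\<Sum>l\<in>hi. c l * exp (of_real l * z) * A n l)
      \<le> (\<Sum>l\<in>hi. norm (c l) * exp ((l - l0) * Re z)) * exp (l0 * Re z)" for n z
    unfolding sum_distrib_right
  proof (intro sum_norm_le)
    fix l assume "l \<in> hi"
    have "norm (c l * exp (of_real l * z) * A n l) \<le> norm (c l) * exp (l * Re z) * 1"
      unfolding norm_mult by (intro mult_mono A1) auto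
    then show "norm (c l * exp (of_real l * z) * A n l)
        \<le> norm (c l) * exp ((l - l0) * Re z) * exp (l0 * Re z)"
      by (simp add: algebra_simps flip: exp_add)
  qed
  have expmono: "exp (L * Re z) \<le> exp (l0 * Re z)" if "Re z < 0" for z
    using that Lv l0 by (auto intro: mult_right_mono_neg)
  have B0: "B \<ge> 0" by (rule order_trans[OF norm_ge_zero B[of "-1"]]) simp
  have Nbound: "norm (N n z) \<le> B + \<delta> n" if z: "Re z < 0" for n z
  proof -
    have "norm (\<Sum>l\<in>lo. c l * exp (of_real l * z) * A n l) \<le> \<delta> n"
      unfolding \<delta>_def
    proof (intro sum_norm_le)
      fix l assume "l \<in> lo"
      then have "norm (exp (of_real l * z)) \<le> 1"
        using Lv z by (auto simp: lo_def mult_le_0_iff)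
      then have "norm (c l) * norm (exp (of_real l * z)) * norm (A n l) \<le> norm (c l) * 1 * norm (A n l)"
        by (intro mult_mono) auto
      then show "norm (c l * exp (of_real l * z) * A n l) \<le> norm (c l) * norm (A n l)"
        by (simp add: norm_mult)
    qed
    moreover have "norm (av n h z) \<le> B"
      using z by (intro av_bound B B0) (simp only: Retr)
    ultimately show ?thesis unfolding N_def
      by (intro order.trans[OF norm_triangle_ineq4] add_mono)
  qed
  have holN: "N n holomorphic_on {z. Re z < 0}" for n
  proof -
    have "(\<lambda>z. h (z + tr m)) holomorphic_on {z. Re z < 0}" for m
      by (rule holomorphic_on_compose_gen[OF _ hol, unfolded o_def])
        (auto intro!: holomorphic_intros simp: tr_def)
    then show ?thesis unfolding N_def av_def by (intro holomorphic_intros)  auto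
  qed
  have key: "norm (c l0) \<le> (B + \<delta> n) + e" if n: "n > 0" and e: "e > 0" for n e
  proof -
    obtain S1 where S1: "\<And>z. Re z \<le> S1 \<Longrightarrow> Re z < 0 \<Longrightarrow> norm (r z) \<le> e / 2 * exp (L * Re z)"
      using rem[of "e/2"] e by (auto simp: r_def)
    obtain S2 where S2: "\<And>s. s \<le> S2 \<Longrightarrow> (\<Sum>l\<in>hi. norm (c l) * exp ((l - l0) * s)) \<le> e / 2"
      using exp_sum_small_at_bot[of hi "\<lambda>l. l - l0" "e/2" "\<lambda>l. norm (c l)"] e by (auto simp: hi_def)
    have diff: "norm (N n z - c l0 * exp (of_real l0 * z)) \<le> e * exp (l0 * Re z)"
      if z: "Re z \<le> min S1 S2" "Re z < 0" for z
    proof -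
      have "N n z - c l0 * exp (of_real l0 * z) = av n r z + (\<Sum>l\<in>hi. c l * exp (of_real l * z) * A n l)"
        unfolding N_eq[OF n] by simp
      also have "norm \<dots> \<le> e / 2 * exp (l0 * Re z) + e / 2 * exp (l0 * Re z)"
      proof (intro norm_triangle_mono)
        show "norm (av n r z) \<le> e / 2 * exp (l0 * Re z)"
        proof (rule av_bound)
          fix m
          have "norm (r (z + tr m)) \<le> e / 2 * exp (L * Re z)"
            using S1[of "z + tr m"] z unfolding Retr by simp
          also have "\<dots> \<le> e / 2 * exp (l0 * Re z)"
            using e expmono[OF z(2)] by (intro mult_left_mono) auto
          finally show "norm (r (z + tr m)) \<le> e / 2 * exp (l0 * Re z)" .
        qed (use e in auto)
        show "norm (\<Sum>l\<in>hi. c l * exp (of_real l * z) * A n l) \<le> e / 2 * exp (l0 * Re z)"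
          using S2[of "Re z"] z by (intro order.trans[OF hi_bound] mult_right_mono) auto
      qed
      finally show ?thesis by simp
    qed
    have nc: "norm (c l0 * exp (of_real l0 * z)) = norm (c l0) * exp (l0 * Re z)" for z
      by (simp add: norm_mult)
    have Nd: "norm (N n z) \<le> (norm (c l0) + e) * exp (l0 * Re z)"
      if "Re z \<le> min S1 S2" "Re z < 0" for z
      using norm_triangle_sub[of "N n z" "c l0 * exp (of_real l0 * z)"] diff[OF that]
      unfolding nc by (simp add: algebra_simps)
    \<comment> \<open>One point far to the left suffices: there \<open>N n z\<close> is close to
      c(l0) exp (l0 z), and the factor \<open>exp (l0 * Re z)\<close> cancels from both
      sides.\<close>
    define z where "z = complex_of_real (min (min S1 S2) (-1))"
    have z: "Re z \<le> min S1 S2" "Re z < 0" by (auto simp: z_def)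
    have "norm (N n z) \<le> (B + \<delta> n) * exp (l0 * Re z)"
      by (rule phragmen_lindelof_half_plane[OF holN Nbound Nd z(2)])
    then have "norm (c l0) * exp (l0 * Re z) \<le> (B + \<delta> n + e) * exp (l0 * Re z)"
      using norm_triangle_sub[of "c l0 * exp (of_real l0 * z)" "N n z"] diff[OF z]
      unfolding nc by (simp add: algebra_simps norm_minus_commute)
    then show ?thesis by simp
  qed
  have key': "norm (c l0) \<le> B + \<delta> n" if "n > 0" for n
    by (rule field_le_epsilon) (rule key[OF that])
  have "\<delta> \<longlonglongrightarrow> (\<Sum>l\<in>lo. norm (c l) * norm (0::complex))"
    unfolding \<delta>_def A_def
    by (intro tendsto_intros power_average_tendsto_0 x1) (use \<tau> in \<open>auto simp: lo_def x_def\<close>)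
  then have "(\<lambda>n. B + \<delta> n) \<longlonglongrightarrow> B + 0"
    by (intro tendsto_intros) simp
  then have "norm (c l0) \<le> B + 0"
    by (rule tendsto_lowerbound) (rule eventually_mono[OF eventually_gt_at_top[of 0] key'], auto)
  then show ?thesis by simp
qed

text \<open>Terms of equal weight \<open>p j + q j = l\<close> have the same size along the
  half-plane. Once the weights below \<open>l\<close> are settled, division by exp (l z) leaves a
  vertical limit, constant by \<open>vertical_limit_constant\<close>; its oscillating part, which
  consists of the terms with \<open>q j \<noteq> 0\<close>, must vanish. The surviving sum of
  holomorphic exponentials has coefficients bounded by \<open>B\<close>, and
  \<open>phragmen_lindelof_half_plane\<close> applies to the difference.\<close>

lemma half_plane_expansion:
  fixes h :: "complex \<Rightarrow> complex" and b :: "'j \<Rightarrow> complex" and p q :: "'j \<Rightarrow> real"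
  assumes hol: "h holomorphic_on {z. Re z < 0}"
    and B: "\<And>z. Re z < 0 \<Longrightarrow> norm (h z) \<le> B"
    and J: "finite J" "\<And>j. j \<in> J \<Longrightarrow> 0 \<le> p j" "\<And>j. j \<in> J \<Longrightarrow> 0 \<le> q j"
      "\<And>j. j \<in> J \<Longrightarrow> p j + q j \<le> L"
    and rem: "\<And>e. e > 0 \<Longrightarrow> \<exists>S. \<forall>z. Re z \<le> S \<and> Re z < 0 \<longrightarrow>
      norm (h z - (\<Sum>j\<in>J. b j * exp (of_real (p j) * z + of_real (q j) * cnj z))) \<le> e * exp (L * Re z)"
    and z: "Re z < 0"
  shows "norm (h z - (\<Sum>j\<in>{j\<in>J. q j = 0}. b j * exp (of_real (p j) * z)))
    \<le> B * (1 + card (p ` {j\<in>J. q j = 0})) * exp (L * Re z)"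
proof -
  let ?Z = "\<lambda>l. {j\<in>J. p j + q j = l \<and> q j \<noteq> 0}" and ?eq = "\<lambda>l. {j\<in>J. p j + q j = l}"
  let ?lt = "\<lambda>l. {j\<in>J. p j + q j < l}" and ?gt = "\<lambda>l. {j\<in>J. p j + q j > l}"
  let ?e = "\<lambda>j t. exp (\<i> * of_real (- 2 * q j * t))"
  define E where "E j z = exp (of_real (p j) * z + of_real (q j) * cnj z)" for j z
  \<comment> \<open>Since cnj z = z - 2 i Im z, conjugation becomes a pure oscillation in
    \<open>Im z\<close> of frequency \<open>- 2 * q j\<close>.\<close>
  have E: "E j z = exp (of_real (p j + q j) * z) * ?e j (Im z)" for j z
    unfolding E_def exp_add[symmetric]
    by (rule arg_cong[where f = exp]) (simp add: complex_eq_iff algebra_simps)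
  have Enorm: "norm (E j z) = exp ((p j + q j) * Re z)" for j z
    unfolding E norm_mult norm_exp_i_times by simp
  \<comment> \<open>Weights are real numbers, so the induction runs on the number of terms of
    smaller weight. Only the sum over each weight vanishes: distinct indices may share the same
    exponents, and their terms cannot be separated.\<close>
  have zero: "(\<Sum>j\<in>?Z l. b j * ?e j t) = 0" for l t
  proof (induction "card (?lt l)" arbitrary: l t rule: less_induct)
    case less
    show ?case
    proof (cases "?eq l = {}")
      case True
      then have "?Z l = {}" by auto
      then show ?thesis by (simp only: sum.empty)
    next
      case False
      then have lL: "l \<le> L" using J by auto
      have low: "(\<Sum>j\<in>{j\<in>J. p j + q j < l \<and> q j \<noteq> 0}. b j * E j z) = 0" (is "sum ?f ?S = 0") for z
      proof -
        have "(\<Sum>y\<in>(\<lambda>j. p j + q j) ` ?S. \<Sum>j\<in>{j\<in>?S. p j + q j = y}. ?f j) = sum ?f ?S"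
          using J by (intro sum.group) auto
        moreover have "(\<Sum>j\<in>{j\<in>?S. p j + q j = y}. ?f j) = 0" if "y \<in> (\<lambda>j. p j + q j) ` ?S" for y
        proof -
          from that obtain j where j: "j \<in> J" "p j + q j = y" "y < l" by auto
          then have "?lt y \<subset> ?lt l" by auto
          then have "card (?lt y) < card (?lt l)"
            using J by (intro psubset_card_mono) auto
          note IH = less[OF this, of "Im z"]
          have "{j\<in>?S. p j + q j = y} = ?Z y" using j by auto
          then have "(\<Sum>j\<in>{j\<in>?S. p j + q j = y}. ?f j)
             = exp (of_real y * z) * (\<Sum>j\<in>?Z y. b j * ?e j (Im z))"
            unfolding sum_distrib_left by (intro sum.cong) (auto simp: E)
          then show ?thesis using IH by simp
        qed
        ultimately show ?thesis by simp
      qed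
      define T where "T z = (\<Sum>j\<in>{j\<in>J. p j + q j < l \<and> q j = 0}. b j * exp (of_real (p j) * z))" for z
      define k where "k z = (h z - T z) * exp (- of_real l * z)" for z
      define K where "K t = (\<Sum>j\<in>?eq l. b j * ?e j t)" for t
      have T_low: "T z = (\<Sum>j\<in>?lt l. b j * E j z)" for z
      proof -
        have "(\<Sum>j\<in>?lt l. b j * E j z) =
           (\<Sum>j\<in>{j\<in>J. p j + q j < l \<and> q j = 0} \<union> {j\<in>J. p j + q j < l \<and> q j \<noteq> 0}. b j * E j z)"
          by (rule sum.cong) auto
        also have "\<dots> = (\<Sum>j\<in>{j\<in>J. p j + q j < l \<and> q j = 0}. b j * E j z)"
          using J by (subst sum.union_disjoint) (auto simp: low)
        also have "\<dots> = T z" unfolding T_def by (intro sum.cong) (auto simp: E)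
        finally show ?thesis by simp
      qed
      have Jsplit: "(\<Sum>j\<in>J. b j * E j z) = T z + exp (of_real l * z) * K (Im z) + (\<Sum>j\<in>?gt l. b j * E j z)" for z
      proof -
        have "(\<Sum>j\<in>J. b j * E j z) = (\<Sum>j\<in>?lt l \<union> (?eq l \<union> ?gt l). b j * E j z)"
          by (rule sum.cong) auto
        also have "\<dots> = T z + ((\<Sum>j\<in>?eq l. b j * E j z) + (\<Sum>j\<in>?gt l. b j * E j z))"
          unfolding T_low using J by (subst sum.union_disjoint, auto)+
        also have "(\<Sum>j\<in>?eq l. b j * E j z) = exp (of_real l * z) * K (Im z)"
          unfolding K_def sum_distrib_left by (intro sum.cong) (auto simp: E)
        finally show ?thesis by simp
      qed
      have Kc: "K t = K 0" for t
      proof (rule vertical_limit_constant)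
        show "k holomorphic_on {z. Re z < 0}"
          unfolding k_def T_def by (intro holomorphic_intros hol)
        show "norm (K t) \<le> (\<Sum>j\<in>?eq l. norm (b j))" for t
          unfolding K_def by (intro sum_norm_le) (simp only: norm_mult norm_exp_i_times mult_1_right order_refl)
        fix e :: real assume e: "e > 0"
        obtain S1 where S1: "\<And>z. Re z \<le> S1 \<Longrightarrow> Re z < 0 \<Longrightarrow> norm (h z - (\<Sum>j\<in>J. b j * E j z)) \<le> e / 2 * exp (L * Re z)"
          using rem[of "e/2"] e by (auto simp: E_def)
        obtain S2 where S2: "\<And>s. s \<le> S2 \<Longrightarrow> (\<Sum>j\<in>?gt l. norm (b j) * exp ((p j + q j - l) * s)) \<le> e / 2"
          using exp_sum_small_at_bot[of "?gt l" "\<lambda>j. p j + q j - l" "e/2" "\<lambda>j. norm (b j)"] e by auto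
        have "norm (k z - K (Im z)) \<le> e" if z: "Re z \<le> min S1 S2" "Re z < 0" for z
        proof -
          have one: "exp (- (of_real l * z)) * exp (of_real l * z) = 1" by (simp flip: exp_add)
          have "k z - K (Im z) = exp (- of_real l * z) * (h z - T z - exp (of_real l * z) * K (Im z))"
            unfolding k_def using one by (simp add: algebra_simps)
          also have "h z - T z - exp (of_real l * z) * K (Im z) = (h z - (\<Sum>j\<in>J. b j * E j z)) + (\<Sum>j\<in>?gt l. b j * E j z)"
            unfolding Jsplit by simp
          finally have "norm (k z - K (Im z)) = exp (- l * Re z) * norm ((h z - (\<Sum>j\<in>J. b j * E j z)) + (\<Sum>j\<in>?gt l. b j * E j z))"
            by (simp add: norm_mult)
          also have "\<dots> \<le> exp (- l * Re z) * (e / 2 * exp (l * Re z) + e / 2 * exp (l * Re z))"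
          proof (intro mult_left_mono norm_triangle_mono)
            have "norm (h z - (\<Sum>j\<in>J. b j * E j z)) \<le> e / 2 * exp (L * Re z)" using S1 z by simp
            also have "\<dots> \<le> e / 2 * exp (l * Re z)"
              using e z lL by (intro mult_left_mono) (auto intro: mult_right_mono_neg)
            finally show "norm (h z - (\<Sum>j\<in>J. b j * E j z)) \<le> e / 2 * exp (l * Re z)" .
            have "norm (\<Sum>j\<in>?gt l. b j * E j z) \<le> (\<Sum>j\<in>?gt l. norm (b j) * exp ((p j + q j - l) * Re z)) * exp (l * Re z)"
              unfolding sum_distrib_right
              by (intro sum_norm_le) (simp add: norm_mult Enorm algebra_simps flip: exp_add)
            also have "\<dots> \<le> e / 2 * exp (l * Re z)" using S2[of "Re z"] z by (intro mult_right_mono) auto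
            finally show "norm (\<Sum>j\<in>?gt l. b j * E j z) \<le> e / 2 * exp (l * Re z)" .
          qed auto
          also have "\<dots> = e" by (simp flip: exp_add distrib_right add: mult.assoc mult.left_commute)
          finally show ?thesis .
        qed
        then show "\<exists>S. \<forall>z. Re z \<le> S \<and> Re z < 0 \<longrightarrow> norm (k z - K (Im z)) \<le> e" by blast
      qed
      have Ksplit: "K t = (\<Sum>j\<in>{j\<in>J. p j + q j = l \<and> q j = 0}. b j) +
          (\<Sum>j\<in>?Z l. b j * ?e j t)" for t
      proof -
        have "K t = (\<Sum>j\<in>{j\<in>J. p j + q j = l \<and> q j = 0} \<union> ?Z l. b j * ?e j t)"
          unfolding K_def by (rule sum.cong) auto
        also have "\<dots> = (\<Sum>j\<in>{j\<in>J. p j + q j = l \<and> q j = 0}. b j * ?e j t) +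
          (\<Sum>j\<in>?Z l. b j * ?e j t)"
          using J by (subst sum.union_disjoint) auto
        finally show ?thesis by simp
      qed
      have const: "(\<Sum>j\<in>?Z l. b j * ?e j t)
          = K 0 - (\<Sum>j\<in>{j\<in>J. p j + q j = l \<and> q j = 0}. b j)" for t
        unfolding Kc[symmetric, of t] Ksplit[of t] by (simp only: add_diff_cancel_left')
      then have "K 0 - (\<Sum>j\<in>{j\<in>J. p j + q j = l \<and> q j = 0}. b j) = 0"
        using J by (intro constant_exponential_sum_eq_0[of "?Z l" "\<lambda>j. - 2 * q j" b]) auto
      then show ?thesis by (rule trans[OF const])
    qed
  qed
  define J0 where "J0 = {j\<in>J. q j = 0}"
  have finJ0: "finite J0" using J by (simp add: J0_def)
  \<comment> \<open>Terms with the same exponent are merged, because the averaging argument bounds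
    only the total coefficient of an exponent.\<close>
  define c where "c l = (\<Sum>j\<in>{j\<in>J0. p j = l}. b j)" for l
  have J0_sum: "(\<Sum>j\<in>J0. b j * exp (of_real (p j) * z)) = (\<Sum>l\<in>p ` J0. c l * exp (of_real l * z))" for z
  proof -
    have "(\<Sum>l\<in>p ` J0. \<Sum>j\<in>{j\<in>J0. p j = l}. b j * exp (of_real (p j) * z)) = (\<Sum>j\<in>J0. b j * exp (of_real (p j) * z))"
      using finJ0 by (intro sum.group) auto
    moreover have "(\<Sum>j\<in>{j\<in>J0. p j = l}. b j * exp (of_real (p j) * z)) = c l * exp (of_real l * z)" for l
      unfolding c_def sum_distrib_right by (intro sum.cong) auto
    ultimately show ?thesis by simp
  qed
  have all: "(\<Sum>j\<in>J. b j * E j z) = (\<Sum>j\<in>J0. b j * exp (of_real (p j) * z))" for z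
  proof -
    let ?S = "{j\<in>J. q j \<noteq> 0}" and ?f = "\<lambda>j. b j * E j z"
    have "(\<Sum>y\<in>(\<lambda>j. p j + q j) ` ?S. \<Sum>j\<in>{j\<in>?S. p j + q j = y}. ?f j) = sum ?f ?S"
      using J by (intro sum.group) auto
    moreover have "(\<Sum>j\<in>{j\<in>?S. p j + q j = y}. ?f j) = 0" for y
    proof -
      have "{j\<in>?S. p j + q j = y} = ?Z y" by auto
      then have "(\<Sum>j\<in>{j\<in>?S. p j + q j = y}. ?f j)
          = exp (of_real y * z) * (\<Sum>j\<in>?Z y. b j * ?e j (Im z))"
        unfolding sum_distrib_left by (intro sum.cong) (auto simp: E)
      then show ?thesis by (simp only: zero mult_zero_right)
    qed
    ultimately have "sum ?f ?S = 0" by simp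
    moreover have "sum ?f J = sum ?f (J0 \<union> ?S)" by (rule sum.cong) (auto simp: J0_def)
    moreover have "sum ?f (J0 \<union> ?S) = sum ?f J0 + sum ?f ?S"
      using J by (subst sum.union_disjoint) (auto simp: J0_def)
    moreover have "sum ?f J0 = (\<Sum>j\<in>J0. b j * exp (of_real (p j) * z))"
      by (intro sum.cong) (auto simp: E J0_def)
    ultimately show ?thesis by simp
  qed
  have rem': "\<exists>S. \<forall>z. Re z \<le> S \<and> Re z < 0 \<longrightarrow>
      norm (h z - (\<Sum>l\<in>p ` J0. c l * exp (of_real l * z))) \<le> e * exp (L * Re z)" if "e > 0" for e
    using rem[OF that] unfolding E_def[symmetric] all J0_sum .
  have lv: "0 \<le> l \<and> l \<le> L" if "l \<in> p ` J0" for l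
    using that J by (fastforce simp: J0_def)
  have cB: "norm (c l) \<le> B" if "l \<in> p ` J0" for l
    using exponential_coefficient_bound[OF hol B _ lv rem' that] finJ0 by simp
  obtain S where S: "\<And>z. Re z \<le> S \<Longrightarrow> Re z < 0 \<Longrightarrow> norm (h z - (\<Sum>l\<in>p ` J0. c l * exp (of_real l * z))) \<le> 1 * exp (L * Re z)"
    using rem'[of 1] by auto
  \<comment> \<open>The remainder is at most \<open>B\<close> plus one further \<open>B\<close> for
    each distinct exponent. Its decay of order \<open>L\<close> is known far to the left, here with
    the constant 1, and Phragmen-Lindelof replaces that constant by the global bound.\<close>
  have "norm (h z - (\<Sum>l\<in>p ` J0. c l * exp (of_real l * z))) \<le> (B * (1 + card (p ` J0))) * exp (L * Re z)"
  proof (rule phragmen_lindelof_half_plane[OF _ _ S z])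
    show "(\<lambda>z. h z - (\<Sum>l\<in>p ` J0. c l * exp (of_real l * z))) holomorphic_on {z. Re z < 0}"
      by (intro holomorphic_intros hol)
    fix z assume z: "Re z < 0"
    have "norm (\<Sum>l\<in>p ` J0. c l * exp (of_real l * z)) \<le> (\<Sum>l\<in>p ` J0. B)"
    proof (intro sum_norm_le)
      fix l assume l: "l \<in> p ` J0"
      have "norm (c l) * exp (l * Re z) \<le> B * 1"
        using lv[OF l] z by (intro mult_mono cB[OF l] order.trans[OF norm_ge_zero cB[OF l]]) (auto simp: mult_le_0_iff)
      then show "norm (c l * exp (of_real l * z)) \<le> B" by (simp add: norm_mult)
    qed
    then have "norm (h z - (\<Sum>l\<in>p ` J0. c l * exp (of_real l * z))) \<le> B + (\<Sum>l\<in>p ` J0. B)"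
      by (intro order.trans[OF norm_triangle_ineq4] add_mono B z)
    then show "norm (h z - (\<Sum>l\<in>p ` J0. c l * exp (of_real l * z))) \<le> B * (1 + card (p ` J0))"
      by (simp add: algebra_simps)
  qed
  then show ?thesis unfolding J0_sum[symmetric] unfolding J0_def .
qed

subsection \<open>Functions that are holomorphic along a linear node\<close>

text \<open>The flow of the linear system w_i' = r_i w_i in complex time.\<close>

definition node_flow :: "('n \<Rightarrow> real) \<Rightarrow> complex \<Rightarrow> complex^'n \<Rightarrow> complex^'n" where
  "node_flow r \<zeta> w = (\<chi> i. exp (of_real (r i) * \<zeta>) * w $ i)"

text \<open>The exponent that the monomial with multi-index \<open>k\<close> acquires along this
  flow: its degree when the i-th coordinate counts \<open>r i\<close>. It need not be an
  integer.\<close>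

definition weight :: "('n::finite \<Rightarrow> real) \<Rightarrow> ('n \<Rightarrow> nat) \<Rightarrow> real" where
  "weight r k = (\<Sum>i\<in>UNIV. r i * real (k i))"

lemma norm_node_flow_le:
  assumes "Re \<zeta> < 0" "\<And>i. c \<le> r i"
  shows "norm (node_flow r \<zeta> w) \<le> exp (c * Re \<zeta>) * norm w"
proof -
  have "norm (node_flow r \<zeta> w) \<le> norm (of_real (exp (c * Re \<zeta>)) *s w)"
  proof (rule norm_le_componentwise_cart)
    fix i
    have "exp (r i * Re \<zeta>) \<le> exp (c * Re \<zeta>)" using assms by (simp add: mult_right_mono_neg)
    then show "norm (node_flow r \<zeta> w $ i) \<le> norm ((of_real (exp (c * Re \<zeta>)) *s w) $ i)"
      by (simp add: node_flow_def norm_mult mult_right_mono del: exp_le_cancel_iff of_real_exp)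
  qed
  then show ?thesis by (simp add: norm_vector_smult del: of_real_exp)
qed

lemma monomial_node_flow:
  "monomial (node_flow r \<zeta> w) k m = monomial w k m * exp (of_real (weight r k) * \<zeta> + of_real (weight r m) * cnj \<zeta>)"
proof -
  have 1: "(\<Prod>i\<in>UNIV. exp (of_real (r i) * z) ^ l i) = exp (of_real (weight r l) * z)" for l and z :: complex
  proof -
    have "of_real (weight r l) * z = (\<Sum>i\<in>UNIV. of_nat (l i) * (of_real (r i) * z))"
      by (simp add: weight_def sum_distrib_right sum_distrib_left mult_ac)
    then show ?thesis by (simp add: exp_sum exp_of_nat_mult)
  qed
  have 2: "cnj (exp (of_real (r i) * \<zeta>)) = exp (of_real (r i) * cnj \<zeta>)" for i by (simp add: exp_cnj)
  show ?thesis
    unfolding monomial_def node_flow_def vec_lambda_beta power_mult_distrib complex_cnj_mult 2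
      prod.distrib 1 exp_add by (simp add: mult_ac)
qed

lemma weight_nonneg: "(\<And>i. r i > 0) \<Longrightarrow> weight r k \<ge> 0"
  unfolding weight_def by (intro sum_nonneg mult_nonneg_nonneg) (auto intro: less_imp_le)

lemma weight_ge:
  assumes "\<And>i. r i > 0"
  shows "r i * real (k i) \<le> weight r k"
  unfolding weight_def
  by (rule member_le_sum) (auto intro!: mult_nonneg_nonneg less_imp_le[OF assms])

lemma weight_eq_0:
  assumes "\<And>i. r i > 0" "weight r k = 0"
  shows "k i = 0"
proof -
  have "r i * real (k i) \<le> 0" using weight_ge[of r i k] assms by simp
  then show ?thesis using assms(1)[of i] by (simp add: mult_le_0_iff)
qed

text \<open>Each \<open>k i\<close> is at most \<open>n / c\<close>, so the multi-indices lie in a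
  box. This count is the polynomial factor of the remainder estimate.\<close>

lemma card_weight_le:
  fixes r :: "'n::finite \<Rightarrow> real"
  assumes c: "c > 0" "\<And>i. c \<le> r i"
  shows "finite {k. weight r k \<le> real n}" "real (card {k. weight r k \<le> real n}) \<le> (real n / c + 1) ^ CARD('n)"
proof -
  let ?M = "nat \<lfloor>real n / c\<rfloor>"
  have sub: "{k. weight r k \<le> real n} \<subseteq> PiE UNIV (\<lambda>_. {..?M})"
  proof (clarsimp simp: PiE_UNIV_domain)
    fix k and i :: 'n assume "weight r k \<le> real n"
    have "c * real (k i) \<le> r i * real (k i)" using c by (intro mult_right_mono) auto
    also have "\<dots> \<le> weight r k"
      by (rule weight_ge) (rule less_le_trans[OF c])
    also have "\<dots> \<le> real n" by fact
    finally have "real (k i) \<le> real n / c" using c by (simp add: pos_le_divide_eq mult.commute)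
    then show "k i \<le> ?M" by (simp add: le_nat_floor)
  qed
  have fin: "finite (PiE (UNIV :: 'n set) (\<lambda>_. {..?M}))" by (intro finite_PiE) auto
  then show "finite {k. weight r k \<le> real n}" using sub finite_subset by blast
  have "card {k. weight r k \<le> real n} \<le> card (PiE (UNIV :: 'n set) (\<lambda>_. {..?M}))"
    by (rule card_mono[OF fin sub])
  also have "\<dots> = (?M + 1) ^ CARD('n)" by (simp add: card_PiE)
  finally have "real (card {k. weight r k \<le> real n}) \<le> (real ?M + 1) ^ CARD('n)"
    by (metis of_nat_1 of_nat_add of_nat_mono of_nat_power)
  also have "\<dots> \<le> (real n / c + 1) ^ CARD('n)"
    using c by (intro power_mono add_right_mono) auto
  finally show "real (card {k. weight r k \<le> real n}) \<le> (real n / c + 1) ^ CARD('n)" .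
qed

text \<open>Along each curve the Taylor polynomial turns into a finite sum of exponentials, to which
  \<open>half_plane_expansion\<close> applies. The witness \<open>P\<close> collects the
  conjugate-free terms of weight at most \<open>n\<close>; it is the same for all \<open>w\<close>,
  and the constants of the Taylor approximation do not appear in the bound.\<close>

lemma taylor_node_polynomial:
  fixes \<psi> :: "complex^'n \<Rightarrow> complex"
  assumes r: "c > 0" "\<And>i. c \<le> r i" and T: "\<And>n. taylor_approx n \<psi>"
    and H: "\<And>w. norm w < \<rho> \<Longrightarrow> (\<lambda>\<zeta>. \<psi> (node_flow r \<zeta> w)) holomorphic_on {\<zeta>. Re \<zeta> < 0}"
    and B: "\<And>w \<zeta>. norm w < \<rho> \<Longrightarrow> Re \<zeta> < 0 \<Longrightarrow> norm (\<psi> (node_flow r \<zeta> w)) \<le> B" and \<rho>: "0 < \<rho>" "\<rho> \<le> 1"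
  shows "\<exists>Q. holomorphic_fun_on Q UNIV \<and> (\<forall>w \<zeta>. norm w < \<rho> \<and> Re \<zeta> < 0 \<longrightarrow>
    norm (\<psi> (node_flow r \<zeta> w) - Q (node_flow r \<zeta> w)) \<le> B * (1 + (real n / c + 1) ^ CARD('n)) * exp (real n * Re \<zeta>))"
proof -
  have rpos: "r i > 0" for i using r less_le_trans by blast
  have B0: "B \<ge> 0"
    by (rule order.trans[OF norm_ge_zero B[of 0 "-1"]]) (use \<rho> in auto)
  \<comment> \<open>The order of the Taylor approximation. All rates are at least \<open>c\<close>,
    so \<open>N * c > n\<close> makes the error decay faster than
    \<open>exp (n * Re \<zeta>)\<close>.\<close>
  define N where "N = nat \<lceil>real n / c\<rceil> + 1"
  have N: "real N * c > real n"
  proof -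
    have "real n / c < real N" unfolding N_def by linarith
    then show ?thesis using r by (simp add: pos_divide_less_eq)
  qed
  obtain Q d C where Q: "rpoly Q" "d > 0" "d \<le> 1" "C \<ge> 0" "\<And>w. norm w < d \<Longrightarrow> norm (\<psi> w - Q w) \<le> C * norm w ^ N"
    by (rule taylor_approxE[OF T[of N]]) (rule that)
  obtain xs where xs: "\<And>w. Q w = (\<Sum>(a, k, m)\<leftarrow>xs. a * monomial w k m)" using rpoly_list[OF Q(1)] by blast
  define a where "a j = fst (xs ! j)" for j
  define k where "k j = fst (snd (xs ! j))" for j
  define m where "m j = snd (snd (xs ! j))" for j
  have Qsum: "Q w = (\<Sum>j<length xs. a j * monomial w (k j) (m j))" for w
    unfolding xs by (simp add: sum_list_sum_nth case_prod_unfold a_def k_def m_def atLeast0LessThan)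
  define p where "p j = weight r (k j)" for j
  define q where "q j = weight r (m j)" for j
  have pq0: "p j \<ge> 0" "q j \<ge> 0" for j unfolding p_def q_def by (intro weight_nonneg rpos)+
  define J where "J = {j\<in>{..<length xs}. p j + q j \<le> real n}"
  \<comment> \<open>Terms of weight above \<open>n\<close> are counted as part of the
    remainder.\<close>
  define J' where "J' = {j\<in>{..<length xs}. p j + q j > real n}"
  have finJ: "finite J" by (simp add: J_def)
  note nf = norm_node_flow_le[where r = r, OF _ r(2)]
  define P where "P w = (\<Sum>j\<in>{j\<in>J. q j = 0}. a j * (\<Prod>i\<in>UNIV. w $ i ^ k j i))" for w :: "complex^'n"
  have "holomorphic_fun_on P UNIV"
    unfolding P_def by (intro holomorphic_fun_on_sum holomorphic_fun_on_cmult holomorphic_fun_on_prod holomorphic_fun_on_power holomorphic_fun_on_nth)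
  moreover have "norm (\<psi> (node_flow r \<zeta> w) - P (node_flow r \<zeta> w)) \<le> B * (1 + (real n / c + 1) ^ CARD('n)) * exp (real n * Re \<zeta>)"
    if w: "norm w < \<rho>" and \<zeta>: "Re \<zeta> < 0" for w \<zeta>
  proof -
    define b where "b j = a j * monomial w (k j) (m j)" for j
    let ?E = "\<lambda>j z. exp (of_real (p j) * z + of_real (q j) * cnj z)"
    have bexp: "a j * monomial (node_flow r \<zeta> w) (k j) (m j) = b j * ?E j \<zeta>" for j \<zeta>
      by (simp add: monomial_node_flow b_def p_def q_def)
    have rem: "\<exists>S. \<forall>z. Re z \<le> S \<and> Re z < 0 \<longrightarrow>
        norm (\<psi> (node_flow r z w) - (\<Sum>j\<in>J. b j * ?E j z)) \<le> e * exp (real n * Re z)"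
      if e: "e > 0" for e
    proof -
      obtain S1 where S1: "\<And>s. s \<le> S1 \<Longrightarrow> (\<Sum>j\<in>J'. norm (b j) * exp ((p j + q j - real n) * s)) \<le> e / 2"
        using exp_sum_small_at_bot[of J' "\<lambda>j. p j + q j - real n" "e / 2" "\<lambda>j. norm (b j)"] e by (auto simp: J'_def)
      obtain S2 where S2: "\<And>s. s \<le> S2 \<Longrightarrow> (\<Sum>j\<in>{0::nat}. C * exp ((real N * c - real n) * s)) \<le> e / 2"
        using exp_sum_small_at_bot[of "{0::nat}" "\<lambda>_. real N * c - real n" "e / 2" "\<lambda>_. C"] e N by auto
      obtain S3 where S3: "\<And>s. s \<le> S3 \<Longrightarrow> (\<Sum>j\<in>{0::nat}. 1 * exp (c * s)) \<le> d"
        using exp_sum_small_at_bot[of "{0::nat}" "\<lambda>_. c" d "\<lambda>_. 1"] r Q(2) by auto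
      have "norm (\<psi> (node_flow r z w) - (\<Sum>j\<in>J. b j * ?E j z)) \<le> e * exp (real n * Re z)"
        if z: "Re z \<le> min S1 (min S2 S3)" "Re z < 0" for z
      proof -
        let ?s = "Re z"
        have small: "norm (node_flow r z w) \<le> exp (c * ?s)"
        proof -
          have "exp (c * ?s) * norm w \<le> exp (c * ?s) * 1" using w \<rho> by (intro mult_left_mono) auto
          then show ?thesis using nf[OF z(2), where w = w] by linarith
        qed
        have "norm (node_flow r z w) < d"
        proof -
          have "norm (node_flow r z w) \<le> exp (c * ?s) * norm w" by (rule nf[OF z(2)])
          also have "\<dots> < exp (c * ?s) * 1" using w \<rho> by (intro mult_strict_left_mono) auto
          also have "\<dots> \<le> d" using S3[of ?s] z by simp
          finally show ?thesis .
        qed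
        then have "norm (\<psi> (node_flow r z w) - Q (node_flow r z w)) \<le> C * norm (node_flow r z w) ^ N" by (rule Q(5))
        also have "\<dots> \<le> C * exp (c * ?s) ^ N" using small Q(4) by (intro mult_left_mono power_mono) auto
        also have "\<dots> = C * exp ((real N * c - real n) * ?s) * exp (real n * ?s)"
          by (simp add: algebra_simps flip: exp_of_nat_mult exp_add)
        also have "\<dots> \<le> e / 2 * exp (real n * ?s)" using S2[of ?s] z by (intro mult_right_mono) auto
        finally have 1: "norm (\<psi> (node_flow r z w) - Q (node_flow r z w)) \<le> e / 2 * exp (real n * ?s)" .
        have "Q (node_flow r z w) = (\<Sum>j\<in>J \<union> J'. b j * ?E j z)"
          unfolding Qsum bexp by (intro sum.cong) (auto simp: J_def J'_def)
        also have "\<dots> = (\<Sum>j\<in>J. b j * ?E j z) + (\<Sum>j\<in>J'. b j * ?E j z)"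
          by (intro sum.union_disjoint) (auto simp: J_def J'_def)
        finally have 2: "Q (node_flow r z w) - (\<Sum>j\<in>J. b j * ?E j z) = (\<Sum>j\<in>J'. b j * ?E j z)"
          by simp
        have "norm (\<Sum>j\<in>J'. b j * ?E j z) \<le> (\<Sum>j\<in>J'. norm (b j) * exp ((p j + q j - real n) * ?s)) * exp (real n * ?s)"
          unfolding sum_distrib_right
          by (intro sum_norm_le) (simp add: norm_mult algebra_simps flip: exp_add)
        also have "\<dots> \<le> e / 2 * exp (real n * ?s)" using S1[of ?s] z by (intro mult_right_mono) auto
        finally have "norm (Q (node_flow r z w) - (\<Sum>j\<in>J. b j * ?E j z)) \<le> e / 2 * exp (real n * ?s)"
          unfolding 2 .
        from norm_triangle_mono[OF 1 this] show ?thesis by simp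
      qed
      then show ?thesis by blast
    qed
    have "norm (\<psi> (node_flow r \<zeta> w) - (\<Sum>j\<in>{j\<in>J. q j = 0}. b j * exp (of_real (p j) * \<zeta>)))
        \<le> B * (1 + card (p ` {j\<in>J. q j = 0})) * exp (real n * Re \<zeta>)"
      by (rule half_plane_expansion[OF H[OF w] B[OF w] finJ pq0 _ rem \<zeta>]) (auto simp: J_def)
    moreover have "(\<Sum>j\<in>{j\<in>J. q j = 0}. b j * exp (of_real (p j) * \<zeta>)) = P (node_flow r \<zeta> w)"
      unfolding P_def
    proof (intro sum.cong refl)
      \<comment> \<open>Weight 0 with all \<open>r i > 0\<close> forces the multi-index
        \<open>m j\<close> to be zero, so no conjugates are left in the surviving terms.\<close>
      fix j assume "j \<in> {j\<in>J. q j = 0}"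
      then have "q j = 0" by simp
      then have "m j i = 0" for i unfolding q_def by (rule weight_eq_0[OF rpos])
      then have "a j * (\<Prod>i\<in>UNIV. node_flow r \<zeta> w $ i ^ k j i) = a j * monomial (node_flow r \<zeta> w) (k j) (m j)"
        by (simp add: monomial_def)
      also have "\<dots> = b j * exp (of_real (p j) * \<zeta>)" unfolding bexp by (simp add: \<open>q j = 0\<close>)
      finally show "b j * exp (of_real (p j) * \<zeta>) = a j * (\<Prod>i\<in>UNIV. node_flow r \<zeta> w $ i ^ k j i)" ..
    qed
    moreover have "real (card (p ` {j\<in>J. q j = 0})) \<le> (real n / c + 1) ^ CARD('n)"
    proof -
      have "p ` {j\<in>J. q j = 0} \<subseteq> weight r ` {k. weight r k \<le> real n}"
        by (auto simp: J_def p_def)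
      then have "card (p ` {j\<in>J. q j = 0}) \<le> card (weight r ` {k. weight r k \<le> real n})"
        by (intro card_mono finite_imageI card_weight_le(1)[OF r])
      also have "\<dots> \<le> card {k. weight r k \<le> real n}" by (intro card_image_le card_weight_le(1)[OF r])
      finally have "real (card (p ` {j\<in>J. q j = 0})) \<le> real (card {k. weight r k \<le> real n})"
        by (rule of_nat_mono)
      then show ?thesis by (rule order.trans[OF _ card_weight_le(2)[OF r]])
    qed
    then have "B * (1 + card (p ` {j\<in>J. q j = 0})) * exp (real n * Re \<zeta>) \<le> B * (1 + (real n / c + 1) ^ CARD('n)) * exp (real n * Re \<zeta>)"
      using B0 by (intro mult_right_mono mult_left_mono) auto
    ultimately show ?thesis by simp
  qed
  ultimately show ?thesis by blast
qed

text \<open>Every point close to 0 is the image at time -1 of a point still inside the domain. At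
  \<open>\<zeta> = -1\<close> the remainder estimates thus become uniform bounds, polynomial in
  \<open>n\<close> times \<open>exp (- n)\<close>.\<close>

lemma holomorphic_near_node:
  fixes \<psi> :: "complex^'n \<Rightarrow> complex" and r :: "'n \<Rightarrow> real"
  assumes r: "\<And>i. r i > 0" and T: "\<And>n. taylor_approx n \<psi>" and "\<rho> > 0"
    and H: "\<And>w. norm w < \<rho> \<Longrightarrow> (\<lambda>\<zeta>. \<psi> (node_flow r \<zeta> w)) holomorphic_on {\<zeta>. Re \<zeta> < 0}"
  shows "\<exists>\<delta>>0. holomorphic_fun_on \<psi> (ball 0 \<delta>)"
proof -
  define c where "c = Min (range r)"
  have c: "c > 0" "\<And>i. c \<le> r i" using r by (auto simp: c_def Min_gr_iff)
  define R where "R = Max (range r)"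
  have R: "\<And>i. r i \<le> R" by (simp add: R_def)
  \<comment> \<open>Order 0 gives the boundedness of \<open>\<psi>\<close> near 0, and with it the
    constant \<open>B\<close> of all later estimates.\<close>
  obtain Q d C where Q: "rpoly Q" "d > 0" "d \<le> 1" "C \<ge> 0" "\<And>w. norm w < d \<Longrightarrow> norm (\<psi> w - Q w) \<le> C * norm w ^ 0"
    by (rule taylor_approxE[OF T[of 0]]) (rule that)
  obtain B' where B': "B' \<ge> 0" "\<And>w. norm w \<le> 1 \<Longrightarrow> norm (Q w) \<le> B'" using rpoly_bounded[OF Q(1)] by blast
  define B where "B = B' + C"
  have B0: "B \<ge> 0" using B' Q by (simp add: B_def)
  define \<rho>1 where "\<rho>1 = min \<rho> d"
  have \<rho>1: "\<rho>1 > 0" "\<rho>1 \<le> 1" "\<rho>1 \<le> \<rho>" "\<rho>1 \<le> d" using Q \<open>\<rho> > 0\<close> by (auto simp: \<rho>1_def)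
  have nf: "norm (node_flow r \<zeta> w) \<le> norm w" if "Re \<zeta> < 0" for \<zeta> w
    using norm_node_flow_le[OF that, where c = 0 and r = r and w = w] r by (simp add: less_imp_le)
  have B: "norm (\<psi> (node_flow r \<zeta> w)) \<le> B" if "norm w < \<rho>1" "Re \<zeta> < 0" for w \<zeta>
  proof -
    have "norm (node_flow r \<zeta> w) < d" using nf[OF that(2), of w] that(1) \<rho>1 by linarith
    then show ?thesis
      using Q(3) Q(5)[of "node_flow r \<zeta> w"] B'(2)[of "node_flow r \<zeta> w"]
        norm_triangle_sub[of "\<psi> (node_flow r \<zeta> w)" "Q (node_flow r \<zeta> w)"]
      unfolding B_def by simp
  qed
  have H1: "(\<lambda>\<zeta>. \<psi> (node_flow r \<zeta> w)) holomorphic_on {\<zeta>. Re \<zeta> < 0}" if "norm w < \<rho>1" for w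
    using H that \<rho>1 by simp
  define bd where "bd n = B * (1 + (real n / c + 1) ^ CARD('n)) * exp (- real n)" for n
  have "\<forall>n. \<exists>Q. holomorphic_fun_on Q UNIV \<and> (\<forall>w \<zeta>. norm w < \<rho>1 \<and> Re \<zeta> < 0 \<longrightarrow>
    norm (\<psi> (node_flow r \<zeta> w) - Q (node_flow r \<zeta> w)) \<le> B * (1 + (real n / c + 1) ^ CARD('n)) * exp (real n * Re \<zeta>))"
    by (rule allI) (rule taylor_node_polynomial[OF c T H1 B \<rho>1(1,2)])
  from choice[OF this] obtain P where P0: "\<forall>n. holomorphic_fun_on (P n) UNIV \<and> (\<forall>w \<zeta>. norm w < \<rho>1 \<and> Re \<zeta> < 0 \<longrightarrow>
    norm (\<psi> (node_flow r \<zeta> w) - P n (node_flow r \<zeta> w)) \<le> B * (1 + (real n / c + 1) ^ CARD('n)) * exp (real n * Re \<zeta>))" ..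
  then have P: "\<And>n. holomorphic_fun_on (P n) UNIV"
    "\<And>n w \<zeta>. norm w < \<rho>1 \<Longrightarrow> Re \<zeta> < 0 \<Longrightarrow> norm (\<psi> (node_flow r \<zeta> w) - P n (node_flow r \<zeta> w)) \<le> B * (1 + (real n / c + 1) ^ CARD('n)) * exp (real n * Re \<zeta>)"
    by simp_all
  \<comment> \<open>The flow at time 1 expands by at most \<open>exp R\<close>, with
    \<open>R\<close> the largest rate, so it carries \<open>ball 0 \<delta>\<close> into
    \<open>ball 0 \<rho>1\<close>.\<close>
  define \<delta> where "\<delta> = \<rho>1 * exp (- R)"
  have \<delta>: "\<delta> > 0" using \<rho>1 by (simp add: \<delta>_def)
  have bound: "norm (\<psi> y - P n y) \<le> bd n" if y: "norm y < \<delta>" for n y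
  proof -
    define w where "w = node_flow r 1 y"
    have "norm w \<le> norm (of_real (exp R) *s y)"
    proof (rule norm_le_componentwise_cart)
      fix i
      show "norm (w $ i) \<le> norm ((of_real (exp R) *s y) $ i)"
        using R[of i] by (simp add: w_def node_flow_def norm_mult mult_right_mono del: of_real_exp)
    qed
    also have "\<dots> = exp R * norm y" by (simp add: norm_vector_smult del: of_real_exp)
    also have "\<dots> < exp R * \<delta>" using y by simp
    also have "\<dots> = \<rho>1" by (simp add: \<delta>_def exp_minus)
    finally have w: "norm w < \<rho>1" .
    have "node_flow r (-1) w = y"
      by (simp add: w_def node_flow_def vec_eq_iff flip: exp_add mult.assoc)
    then show ?thesis using P(2)[OF w, of "-1" n] by (simp add: bd_def)
  qed
  have "bd \<longlonglongrightarrow> 0"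
  proof (rule Lim_null_comparison)
    define K where "K = 1 / c + 1"
    have K: "K \<ge> 1" using c by (simp add: K_def)
    show "\<forall>\<^sub>F n in sequentially. norm (bd n) \<le> 2 * B * K ^ CARD('n) * (real n ^ CARD('n) / exp (real n))"
      using eventually_ge_at_top[of 1]
    proof eventually_elim
      case (elim n)
      have "real n / c + 1 \<le> K * real n" using elim by (simp add: K_def algebra_simps)
      then have 1: "(real n / c + 1) ^ CARD('n) \<le> (K * real n) ^ CARD('n)" using c by (intro power_mono) auto
      have "1 * 1 \<le> K * real n" using K elim by (intro mult_mono) auto
      then have "1 \<le> (K * real n) ^ CARD('n)" by (intro one_le_power) simp
      with 1 have "1 + (real n / c + 1) ^ CARD('n) \<le> 2 * (K * real n) ^ CARD('n)" by simp
      then have "B * (1 + (real n / c + 1) ^ CARD('n)) * exp (- real n) \<le> B * (2 * (K * real n) ^ CARD('n)) * exp (- real n)"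
        using B0 by (intro mult_right_mono mult_left_mono) auto
      moreover have "bd n \<ge> 0" using B0 c by (simp add: bd_def)
      ultimately show ?case by (simp add: bd_def power_mult_distrib exp_minus field_simps)
    qed
    have "(\<lambda>n. real n ^ CARD('n) / exp (real n)) \<longlonglongrightarrow> 0"
      by (rule filterlim_compose[OF tendsto_power_div_exp_0 filterlim_real_sequentially])
    from tendsto_mult_right_zero[OF this]
    show "(\<lambda>n. 2 * B * K ^ CARD('n) * (real n ^ CARD('n) / exp (real n))) \<longlonglongrightarrow> 0" .
  qed
  have "uniform_limit (ball 0 \<delta>) P \<psi> sequentially"
  proof (rule uniform_limitI)
    fix e :: real assume "e > 0"
    with \<open>bd \<longlonglongrightarrow> 0\<close> have "\<forall>\<^sub>F n in sequentially. bd n < e" by (intro order_tendstoD(2))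
    then show "\<forall>\<^sub>F n in sequentially. \<forall>y\<in>ball 0 \<delta>. dist (P n y) (\<psi> y) < e"
    proof eventually_elim
      case (elim n)
      show ?case
      proof
        fix y assume "y \<in> ball (0 :: complex^'n) \<delta>"
        then have "norm (\<psi> y - P n y) \<le> bd n" by (intro bound) simp
        with elim show "dist (P n y) (\<psi> y) < e" by (simp add: dist_norm norm_minus_commute)
      qed
    qed
  qed
  then have "holomorphic_fun_on \<psi> (ball 0 \<delta>)"
    by (rule holomorphic_fun_on_uniform_limit[OF open_ball holomorphic_fun_on_subset[OF P(1) subset_UNIV]])
  with \<delta> show ?thesis by blast
qed

subsection \<open>Powers of moduli of holomorphic functions\<close>

lemma real_power_of_right_half_plane:
  fixes f :: "complex \<Rightarrow> complex"
  assumes "f holomorphic_on S" "\<And>z. z \<in> S \<Longrightarrow> Re (f z) > 0"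
  shows "\<exists>h. h holomorphic_on S \<and> (\<forall>z\<in>S. norm (h z) = norm (f z) powr p)"
proof (intro exI conjI ballI)
  show "(\<lambda>z. exp (of_real p * Ln (f z))) holomorphic_on S"
    using assms by (intro holomorphic_intros) (auto simp: complex_nonpos_Reals_iff dest: assms(2))
  fix z assume "z \<in> S"
  then have "f z \<noteq> 0" using assms(2) by force
  then show "norm (exp (of_real p * Ln (f z))) = norm (f z) powr p"
    by (simp add: powr_def)
qed

text \<open>For \<open>a\<close> in the open disc \<open>l\<close> is \<open>1 - cnj a * z\<close>,
  which has no zero there; otherwise z - a has none itself. Up to a constant factor \<open>l\<close>
  then has positive real part on the disc, so a holomorphic \<open>p\<close>-th power
  exists.\<close>

lemma linear_factor_power:
  fixes a :: complex
  shows "\<exists>l h. continuous_on UNIV l \<and> h holomorphic_on ball 0 1 \<and>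
    (\<forall>z\<in>ball 0 1. norm (h z) = norm (l z :: complex) powr p \<and> norm (z - a) \<le> norm (l z)) \<and>
    (\<forall>z. norm z = 1 \<longrightarrow> norm (l z) = norm (z - a))"
proof (cases "norm a < 1")
  case True
  \<comment> \<open>The last product is nonnegative in the disc and zero on the circle, which gives
    the inequality inside and the equality on the boundary.\<close>
  have id: "norm (1 - cnj a * z) ^ 2 = norm (z - a) ^ 2 + (1 - norm a ^ 2) * (1 - norm z ^ 2)" for z
    unfolding cmod_power2 by (simp add: power2_eq_square algebra_simps)
  have ge: "norm (z - a) \<le> norm (1 - cnj a * z)" if "norm z < 1" for z
  proof (rule power2_le_imp_le)
    have "(1 - norm a ^ 2) * (1 - norm z ^ 2) \<ge> 0"
      using that True by (intro mult_nonneg_nonneg) (auto simp: abs_square_le_1)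
    then show "norm (z - a) ^ 2 \<le> norm (1 - cnj a * z) ^ 2" unfolding id by simp
  qed simp
  have eq: "norm (1 - cnj a * z) = norm (z - a)" if "norm z = 1" for z
    using id[of z] that by (simp add: power2_eq_iff_nonneg)
  have "Re (1 - cnj a * z) > 0" if "z \<in> ball 0 1" for z
  proof -
    have "Re (cnj a * z) \<le> norm (cnj a * z)" by (rule complex_Re_le_cmod)
    also have "\<dots> < 1 * 1" unfolding norm_mult
      using that True by (intro mult_strict_mono') auto
    finally show ?thesis by simp
  qed
  moreover have "(\<lambda>z. 1 - cnj a * z) holomorphic_on ball 0 1" by (intro holomorphic_intros)
  ultimately obtain h where "h holomorphic_on ball 0 1" "\<forall>z\<in>ball 0 1. norm (h z) = norm (1 - cnj a * z) powr p"
    using real_power_of_right_half_plane[of "\<lambda>z. 1 - cnj a * z" "ball 0 1" p] by blast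
  with ge eq show ?thesis
    by (intro exI[of _ "\<lambda>z. 1 - cnj a * z"] exI[of _ h]) (auto intro!: continuous_intros)
next
  case False
  then have a0: "a \<noteq> 0" by auto
  have "Re (1 - z / a) > 0" if "z \<in> ball 0 1" for z
  proof -
    have "Re (z / a) \<le> norm (z / a)" by (rule complex_Re_le_cmod)
    also have "\<dots> < 1" unfolding norm_divide using that False a0 by (simp add: divide_less_eq)
    finally show ?thesis by simp
  qed
  moreover have "(\<lambda>z. 1 - z / a) holomorphic_on ball 0 1" by (intro holomorphic_intros) (use a0 in auto)
  ultimately obtain h where h: "h holomorphic_on ball 0 1" "\<And>z. z\<in>ball 0 1 \<Longrightarrow> norm (h z) = norm (1 - z / a) powr p"
    using real_power_of_right_half_plane[of "\<lambda>z. 1 - z / a" "ball 0 1" p] by blast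
  have "norm (z - a) = norm a * norm (1 - z / a)" for z
  proof -
    have "z - a = - a * (1 - z / a)" using a0 by (simp add: field_simps)
    then show ?thesis by (simp only: norm_mult norm_minus_cancel)
  qed
  then have "norm (of_real (norm a powr p) * h z) = norm (z - a) powr p" if "z \<in> ball 0 1" for z
    using h(2)[OF that] by (simp add: norm_mult powr_mult)
  moreover have "(\<lambda>z. of_real (norm a powr p) * h z) holomorphic_on ball 0 1"
    by (intro holomorphic_intros h)
  ultimately show ?thesis
    by (intro exI[of _ "\<lambda>z. z - a"] exI[of _ "\<lambda>z. of_real (norm a powr p) * h z"])
      (auto intro!: continuous_intros)
qed

text \<open>Reflecting the zeros in the disc at the unit circle makes a \<open>p\<close>-th power holomorphic
  without changing the modulus on the circle.\<close>

lemma poly_reflected_power: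
  fixes q :: "complex poly"
  assumes "q \<noteq> 0"
  shows "\<exists>l h. continuous_on UNIV l \<and> h holomorphic_on ball 0 1 \<and>
    (\<forall>z\<in>ball 0 1. norm (h z) = norm (l z :: complex) powr p \<and> norm (poly q z) \<le> norm (l z)) \<and>
    (\<forall>z. norm z = 1 \<longrightarrow> norm (l z) = norm (poly q z))"
proof -
  obtain A where A: "q = smult (lead_coeff q) (\<Prod>x\<in>#A. [:-x, 1:])"
    using alg_closed_imp_factorization[OF assms] by blast
  have "\<exists>l h. continuous_on UNIV l \<and> h holomorphic_on ball 0 1 \<and>
    (\<forall>z\<in>ball 0 1. norm (h z) = norm (l z :: complex) powr p \<and> norm (poly (smult c (\<Prod>x\<in>#A. [:-x, 1:])) z) \<le> norm (l z)) \<and>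
    (\<forall>z. norm z = 1 \<longrightarrow> norm (l z) = norm (poly (smult c (\<Prod>x\<in>#A. [:-x, 1:])) z))" for c
  proof (induction A)
    case empty
    show ?case
      by (intro exI[of _ "\<lambda>_. c"] exI[of _ "\<lambda>_. of_real (norm c powr p)"]) simp
  next
    case (add a A)
    then obtain l h where l: "continuous_on UNIV l" "h holomorphic_on ball 0 1"
      "\<And>z. z\<in>ball 0 1 \<Longrightarrow> norm (h z) = norm (l z :: complex) powr p \<and> norm (poly (smult c (\<Prod>x\<in>#A. [:-x, 1:])) z) \<le> norm (l z)"
      "\<And>z. norm z = 1 \<Longrightarrow> norm (l z) = norm (poly (smult c (\<Prod>x\<in>#A. [:-x, 1:])) z)" by blast
    obtain l' h' where l': "continuous_on UNIV l'" "h' holomorphic_on ball 0 1"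
      "\<And>z. z\<in>ball 0 1 \<Longrightarrow> norm (h' z) = norm (l' z :: complex) powr p \<and> norm (z - a) \<le> norm (l' z)"
      "\<And>z. norm z = 1 \<Longrightarrow> norm (l' z) = norm (z - a)"
      using linear_factor_power[of p a] by blast
    have pe: "poly (smult c (\<Prod>x\<in>#add_mset a A. [:-x, 1:])) z = (z - a) * poly (smult c (\<Prod>x\<in>#A. [:-x, 1:])) z" for z
      by (simp add: algebra_simps)
    show ?case
    proof (rule exI[of _ "\<lambda>z. l' z * l z"], rule exI[of _ "\<lambda>z. h' z * h z"], intro conjI ballI allI impI)
      show "continuous_on UNIV (\<lambda>z. l' z * l z)" by (intro continuous_intros l l')
      show "(\<lambda>z. h' z * h z) holomorphic_on ball 0 1" by (intro holomorphic_intros l l')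
    next
      fix z :: complex assume z: "z \<in> ball 0 1"
      show "norm (h' z * h z) = norm (l' z * l z) powr p"
        using l(3)[OF z] l'(3)[OF z] by (simp add: norm_mult powr_mult)
      show "norm (poly (smult c (\<Prod>x\<in>#add_mset a A. [:-x, 1:])) z) \<le> norm (l' z * l z)"
        unfolding pe norm_mult using l(3)[OF z] l'(3)[OF z] by (intro mult_mono) auto
    next
      fix z :: complex assume z: "norm z = 1"
      show "norm (l' z * l z) = norm (poly (smult c (\<Prod>x\<in>#add_mset a A. [:-x, 1:])) z)"
        unfolding pe norm_mult l(4)[OF z] l'(4)[OF z] ..
    qed
  qed
  from this[of "lead_coeff q"] show ?thesis unfolding A[symmetric] .
qed

abbreviation circ :: "real \<Rightarrow> complex" where "circ t \<equiv> exp (2 * of_real pi * \<i> * of_real t)"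

lemma norm_circ: "norm (circ t) = 1"
  by (simp add: norm_exp_eq_Re)

text \<open>Cauchy's formula for the power \<open>h\<close> on circles of radius
  \<open>r < 1\<close>, as \<open>h\<close> is holomorphic only in the open disc; then
  \<open>r\<close> tends to 1, where \<open>l\<close> and the polynomial have equal modulus. The
  factor stems from estimating the Cauchy kernel and tends to 1 as \<open>a\<close> tends to 0,
  which is what Hartogs' lemma exploits.\<close>

lemma poly_powr_mean:
  fixes q :: "complex poly"
  assumes p: "p > 0" and a: "norm a < 1"
  shows "norm (poly q a) powr p \<le> 1 / (1 - norm a) * integral {0..1} (\<lambda>t. norm (poly q (circ t)) powr p)"
proof (cases "q = 0")
  case True
  then show ?thesis by simp
next
  case False
  obtain l h where l: "continuous_on UNIV l" "h holomorphic_on ball 0 1"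
    "\<And>z. z\<in>ball 0 1 \<Longrightarrow> norm (h z) = norm (l z :: complex) powr p"
    "\<And>z. z\<in>ball 0 1 \<Longrightarrow> norm (poly q z) \<le> norm (l z)"
    "\<And>z. norm z = 1 \<Longrightarrow> norm (l z) = norm (poly q z)"
    using poly_reflected_power[OF False, of p] by blast
  define I where "I r = integral {0..1} (\<lambda>t. norm (l (of_real r * circ t)) powr p)" for r
  have contl: "continuous_on S (\<lambda>x. norm (l (g x)) powr p)" if "continuous_on S g" for S and g :: "'x::topological_space \<Rightarrow> complex"
    using p by (intro continuous_on_powr' continuous_intros continuous_on_compose2[OF l(1) that]) auto
  have key: "norm (poly q a) powr p \<le> r / (r - norm a) * I r" if r: "norm a < r" "r < 1" for r
  proof -
    have r0: "r > 0" using r norm_ge_zero[of a] by linarith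
    have sub: "cball 0 r \<subseteq> ball (0::complex) 1" using r by auto
    let ?k = "\<lambda>x. h (circlepath 0 r x) / (circlepath 0 r x - a) * vector_derivative (circlepath 0 r) (at x within {0..1})"
    have "((\<lambda>u. h u / (u - a)) has_contour_integral 2 * of_real pi * \<i> * h a) (circlepath 0 r)"
      by (rule Cauchy_integral_circlepath_simple)
        (use r sub l(2) holomorphic_on_subset in auto)
    then have int: "(?k
        has_integral 2 * of_real pi * \<i> * h a) {0..1}"
      by (simp add: has_contour_integral_def)
    have "norm (integral {0..1} ?k)
        \<le> integral {0..1} (\<lambda>t. 2 * pi * r / (r - norm a) * norm (l (of_real r * circ t)) powr p)"
    proof (rule integral_norm_bound_integral)
      show "?k integrable_on {0..1}"
        using int by blast
      show "(\<lambda>t. 2 * pi * r / (r - norm a) * norm (l (of_real r * circ t)) powr p) integrable_on {0..1}"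
        by (intro integrable_continuous_interval continuous_on_mult continuous_on_const contl continuous_intros)
      fix t :: real assume t: "t \<in> {0..1}"
      have c: "circlepath 0 r t = of_real r * circ t" by (simp add: circlepath)
      have nc: "norm (of_real r * circ t) = r" using r0 by (simp add: norm_mult norm_circ)
      have "r - norm a \<le> norm (of_real r * circ t - a)"
        using norm_triangle_ineq2[of "of_real r * circ t" a] nc by simp
      then have "norm (h (of_real r * circ t)) / norm (of_real r * circ t - a) * (2 * pi * r)
          \<le> norm (l (of_real r * circ t)) powr p / (r - norm a) * (2 * pi * r)"
        using nc r r0 l(3)[of "of_real r * circ t"] by (intro mult_right_mono frac_le) auto
      then show "norm (?k t)
          \<le> 2 * pi * r / (r - norm a) * norm (l (of_real r * circ t)) powr p"
        using t r0 unfolding c norm_mult norm_divide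
        by (simp add: vector_derivative_circlepath01 norm_mult norm_circ mult_ac)
    qed
    moreover have "norm (integral {0..1} ?k)
       = 2 * pi * norm (h a)"
      unfolding integral_unique[OF int] by (simp add: norm_mult)
    ultimately have "2 * pi * norm (h a) \<le> 2 * pi * (r / (r - norm a) * I r)"
      by (simp add: I_def mult_ac)
    then have "norm (h a) \<le> r / (r - norm a) * I r" by (rule mult_left_le_imp_le) simp
    moreover have "norm (poly q a) powr p \<le> norm (h a)"
      using l(3,4)[of a] a p by (auto intro: powr_mono2)
    ultimately show ?thesis by simp
  qed
  have "continuous_on {0..1} I"
  proof -
    have "continuous_on {0..1} (\<lambda>r. integral (cbox 0 1) (\<lambda>t. norm (l (of_real r * circ t)) powr p))"
      by (rule integral_continuous_on_param)
        (unfold case_prod_unfold, intro contl continuous_intros)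
    then show ?thesis by (simp add: I_def)
  qed
  then have "(I \<longlongrightarrow> I 1) (at 1 within {0..1})"
    by (simp add: continuous_on_def)
  then have "(I \<longlongrightarrow> I 1) (at_left 1)"
    by (simp add: at_within_Icc_at_left)
  then have "((\<lambda>r. r / (r - norm a) * I r) \<longlongrightarrow> 1 / (1 - norm a) * I 1) (at_left 1)"
    using a by (intro tendsto_intros) auto
  moreover have "\<forall>\<^sub>F r in at_left 1. norm (poly q a) powr p \<le> r / (r - norm a) * I r"
    unfolding eventually_at_left_field using key a by (intro exI[of _ "norm a"]) auto
  ultimately have "norm (poly q a) powr p \<le> 1 / (1 - norm a) * I 1"
    by (intro tendsto_lowerbound) auto
  then show ?thesis by (simp add: I_def l(5) norm_circ)
qed

text \<open>The power series converges at a point \<open>s > 1\<close>, hence absolutely on the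
  closed unit disc. The sum of the moduli of its coefficients bounds all partial sums there and
  dominates the passage to the limit under the integral.\<close>

lemma holomorphic_powr_mean:
  assumes g: "g holomorphic_on ball 0 \<rho>" "\<rho> > 1" and p: "p > 0" and a: "norm a < 1"
  shows "norm (g a) powr p \<le> 1 / (1 - norm a) * integral {0..1} (\<lambda>t. norm (g (circ t)) powr p)"
proof -
  define c where "c n = (deriv ^^ n) g 0 / fact n" for n
  obtain s where s: "1 < s" "s < \<rho>" using dense[OF g(2)] by blast
  have sums: "(\<lambda>n. c n * z ^ n) sums g z" if "norm z < \<rho>" for z
    using holomorphic_power_series[OF g(1), of z] that by (simp add: c_def)
  have "summable (\<lambda>n. c n * of_real s ^ n)"
    using sums[of "of_real s"] s by (intro sums_summable) auto
  then have abs: "summable (\<lambda>n. norm (c n * 1 ^ n))"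
    by (rule powser_insidea) (use s in auto)
  define P where "P n = (\<Sum>i<n. monom (c i) i)" for n
  have P: "poly (P n) z = (\<Sum>i<n. c i * z ^ i)" for n z
    by (simp add: P_def poly_sum poly_monom)
  have lim: "(\<lambda>n. poly (P n) z) \<longlonglongrightarrow> g z" if "norm z < \<rho>" for z
    using sums[OF that] by (simp add: sums_def P)
  have Pb: "norm (poly (P n) z) \<le> (\<Sum>n. norm (c n))" if "norm z \<le> 1" for n z
  proof -
    have "norm (poly (P n) z) \<le> (\<Sum>i<n. norm (c i))"
      unfolding P by (intro sum_norm_le) (simp add: norm_mult norm_power mult_left_le power_le_one that)
    also have "\<dots> \<le> (\<Sum>n. norm (c n))" using abs by (intro sum_le_suminf) auto
    finally show ?thesis .
  qed
  have limp: "(\<lambda>n. norm (poly (P n) z) powr p) \<longlonglongrightarrow> norm (g z) powr p" if "norm z < \<rho>" for z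
    using p by (intro tendsto_powr' tendsto_norm lim that tendsto_const) auto
  have "(\<lambda>n. integral {0..1} (\<lambda>t. norm (poly (P n) (circ t)) powr p)) \<longlonglongrightarrow> integral {0..1} (\<lambda>t. norm (g (circ t)) powr p)"
  proof (rule dominated_convergence(2))
    show "(\<lambda>t. norm (poly (P n) (circ t)) powr p) integrable_on {0..1}" for n
      using p by (intro integrable_continuous_interval continuous_on_powr' continuous_intros) auto
    show "(\<lambda>t::real. (\<Sum>n. norm (c n)) powr p) integrable_on {0..1}"
      by (intro integrable_continuous_interval continuous_intros)
    show "norm (norm (poly (P n) (circ t)) powr p) \<le> (\<Sum>n. norm (c n)) powr p" for n t
      using Pb[of "circ t" n] p by (simp add: norm_circ powr_mono2)
    show "(\<lambda>n. norm (poly (P n) (circ t)) powr p) \<longlonglongrightarrow> norm (g (circ t)) powr p" for t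
      using g(2) by (intro limp) (simp only: norm_circ)
  qed
  then have "(\<lambda>n. 1 / (1 - norm a) * integral {0..1} (\<lambda>t. norm (poly (P n) (circ t)) powr p))
      \<longlonglongrightarrow> 1 / (1 - norm a) * integral {0..1} (\<lambda>t. norm (g (circ t)) powr p)"
    by (intro tendsto_intros)
  moreover have "(\<lambda>n. norm (poly (P n) a) powr p) \<longlonglongrightarrow> norm (g a) powr p"
    using a g(2) by (intro limp) simp
  ultimately show ?thesis
    using poly_powr_mean[OF p a] by (intro LIMSEQ_le) blast+
qed

subsection \<open>Hartogs' lemma\<close>

text \<open>Total mass 1, so finite products are the uniform probability on a torus and integrals
  over them are averages.\<close>

definition circle_measure :: "real measure" where
  "circle_measure = restrict_space lborel {0..1}"


lemma emeasure_circle_measure_space: "emeasure circle_measure (space circle_measure) = 1"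
  unfolding circle_measure_def by (simp add: emeasure_restrict_space space_restrict_space)

lemma finite_circle_measure: "finite_measure circle_measure"
  by (rule finite_measureI) (simp add: emeasure_circle_measure_space)

interpretation circle_product: product_sigma_finite "\<lambda>_::'n. circle_measure"
  unfolding product_sigma_finite_def
  using finite_circle_measure finite_measure.axioms(1) by blast

lemma emeasure_circle_product_space:
  assumes "finite I"
  shows "emeasure (Pi\<^sub>M I (\<lambda>_::'n. circle_measure)) (space (Pi\<^sub>M I (\<lambda>_. circle_measure))) = 1"
  using circle_product.emeasure_PiM[OF assms, of "\<lambda>_. space circle_measure"]
  by (simp add: space_PiM emeasure_circle_measure_space)

text \<open>The coordinates in \<open>I\<close> run over circles about those of \<open>z\<close>,
  the others are frozen at \<open>a\<close>. This interpolates between the point \<open>a\<close>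
  (\<open>I\<close> empty) and the distinguished boundary of a polydisc (\<open>I\<close>
  everything).\<close>

definition torus_point :: "complex^'n \<Rightarrow> real \<Rightarrow> complex^'n \<Rightarrow> 'n set \<Rightarrow> ('n \<Rightarrow> real) \<Rightarrow> complex^'n" where
  "torus_point z \<delta> a I \<theta> = (\<chi> i. if i \<in> I then z $ i + of_real \<delta> * circ (\<theta> i) else a $ i)"

lemma torus_point_measurable:
  fixes z a :: "complex^'n"
  shows "torus_point z \<delta> a I \<in> borel_measurable (Pi\<^sub>M I (\<lambda>_. circle_measure))"
proof -
  have comp: "(\<lambda>\<theta>. torus_point z \<delta> a I \<theta> $ i) \<in> borel_measurable (Pi\<^sub>M I (\<lambda>_. circle_measure))" for i
  proof (cases "i \<in> I")
    case True
    have "(\<lambda>\<theta>. \<theta> i) \<in> measurable (Pi\<^sub>M I (\<lambda>_. circle_measure)) circle_measure"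
      using True by (rule measurable_component_singleton)
    moreover have "(\<lambda>t. z $ i + of_real \<delta> * circ t) \<in> borel_measurable circle_measure"
      unfolding circle_measure_def
      by (intro measurable_restrict_space1) (simp add: borel_measurable_continuous_onI continuous_intros)
    ultimately show ?thesis using True by (simp add: torus_point_def measurable_compose)
  next
    case False
    then show ?thesis by (simp add: torus_point_def)
  qed
  show ?thesis
  proof (subst borel_measurable_euclidean_space, rule ballI)
    fix b :: "complex^'n" assume "b \<in> Basis"
    then obtain i u where b: "b = axis i u" unfolding Basis_vec_def by blast
    show "(\<lambda>\<theta>. torus_point z \<delta> a I \<theta> \<bullet> b) \<in> borel_measurable (Pi\<^sub>M I (\<lambda>_. circle_measure))"
      unfolding b inner_axis by (intro borel_measurable_inner comp borel_measurable_const)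
  qed
qed

text \<open>The inequality for the disc is applied in one coordinate after another; since
  \<open>a\<close> is within \<open>\<eta> * \<delta>\<close> of the centre in each of them, every
  application costs a factor \<open>1 / (1 - \<eta>)\<close>. \<open>U\<close> extends the power of
  the modulus to a Borel function on the whole space, so that its torus averages are measurable at
  every stage.\<close>

lemma polydisc_powr_mean:
  fixes c :: "complex^'n \<Rightarrow> complex"
  assumes c: "holomorphic_fun_on c W"
    and W: "\<And>y. (\<And>i. norm (y $ i - z $ i) < \<delta>') \<Longrightarrow> y \<in> W"
    and U: "(\<lambda>y. ennreal (U y)) \<in> borel_measurable borel" "\<And>y. y \<in> W \<Longrightarrow> U y = norm (c y) powr p"
    and \<delta>: "0 < \<delta>" "\<delta> < \<delta>'" and p: "p > 0"
    and \<eta>: "0 \<le> \<eta>" "\<eta> < 1" and a: "\<And>i. norm (a $ i - z $ i) \<le> \<eta> * \<delta>"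
    and "finite I"
  shows "ennreal (U a) \<le> ennreal ((1 / (1 - \<eta>)) ^ card I) *
    (\<integral>\<^sup>+ \<theta>. U (torus_point z \<delta> a I \<theta>) \<partial>Pi\<^sub>M I (\<lambda>_. circle_measure))"
  using \<open>finite I\<close>
proof (induction I rule: finite_induct)
  case empty
  have "torus_point z \<delta> a {} \<theta> = a" for \<theta>
    by (simp add: torus_point_def vec_eq_iff)
  then show ?case by (simp add: emeasure_circle_product_space)
next
  case (insert i I)
  define K where "K = 1 / (1 - \<eta>)"
  have K: "K \<ge> 0" using \<eta> by (simp add: K_def)
  have \<eta>\<delta>: "\<eta> * \<delta> < \<delta>'"
  proof -
    have "\<eta> * \<delta> \<le> 1 * \<delta>" using \<eta> \<delta> by (intro mult_right_mono) auto
    with \<delta> show ?thesis by linarith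
  qed
  have one: "ennreal (U (torus_point z \<delta> a I \<theta>)) \<le> ennreal K *
      (\<integral>\<^sup>+ t. U (torus_point z \<delta> a (insert i I) (\<theta>(i := t))) \<partial>circle_measure)" for \<theta>
  proof -
    define y where "y = torus_point z \<delta> a I \<theta>"
    \<comment> \<open>The complex line through \<open>y\<close> in the i-th coordinate, centred at
      \<open>z $ i\<close> and scaled so that the unit circle in \<open>s\<close> is the circle of
      radius \<open>\<delta>\<close>.\<close>
    define y0 where "y0 = (\<chi> j. if j = i then z $ i else y $ j)"
    define g where "g s = c (y0 + s *s axis i (of_real \<delta>))" for s
    have comp: "(y0 + s *s axis i (of_real \<delta>)) $ j = (if j = i then z $ i + s * of_real \<delta> else y $ j)" for s j
      by (simp add: y0_def axis_def)
    have yj: "norm (y $ j - z $ j) < \<delta>'" for j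
      using \<delta> \<eta>\<delta> a[of j] by (simp add: y_def torus_point_def norm_mult norm_circ)
    have inW: "y0 + s *s axis i (of_real \<delta>) \<in> W" if "norm s < \<delta>' / \<delta>" for s
    proof (rule W)
      fix j
      show "norm ((y0 + s *s axis i (of_real \<delta>)) $ j - z $ j) < \<delta>'"
        unfolding comp using yj[of j] that \<delta> by (simp add: norm_mult pos_less_divide_eq)
    qed
    \<comment> \<open>The parameter of \<open>y\<close> on this line: as \<open>i\<close> is not in
      \<open>I\<close>, its i-th coordinate is still \<open>a $ i\<close>.\<close>
    define s where "s = (a $ i - z $ i) / of_real \<delta>"
    have s: "norm s \<le> \<eta>" using a[of i] \<delta> by (simp add: s_def norm_divide divide_le_eq)
    have s1: "norm s < 1" using s \<eta> by simp
    have hol: "g holomorphic_on ball 0 (\<delta>' / \<delta>)"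
      unfolding g_def
      by (rule holomorphic_on_has_field_derivativeI, rule holomorphic_fun_slice[OF c inW]) simp
    have rho: "\<delta>' / \<delta> > 1" using \<delta> by simp
    let ?I = "integral {0..1} (\<lambda>t. norm (g (circ t)) powr p)"
    have contg: "continuous_on {0..1} (\<lambda>t. g (circ t))"
      by (rule continuous_on_compose2[OF holomorphic_on_imp_continuous_on[OF hol]])
        (use rho in \<open>auto intro!: continuous_intros simp: norm_circ\<close>)
    have intg: "(\<lambda>t. norm (g (circ t)) powr p) integrable_on {0..1}"
      using p by (intro integrable_continuous_interval continuous_on_powr' continuous_on_norm contg continuous_on_const) auto
    have "norm (g s) powr p \<le> 1 / (1 - norm s) * ?I"
      by (rule holomorphic_powr_mean[OF hol rho p s1])
    also have "\<dots> \<le> K * ?I"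
      unfolding K_def using s \<eta> by (intro mult_right_mono divide_left_mono Henstock_Kurzweil_Integration.integral_nonneg intg) auto
    finally have "norm (g s) powr p \<le> K * ?I" .
    moreover have gs: "g s = c y"
    proof -
      have "y $ i = a $ i" using insert by (simp add: y_def torus_point_def)
      then have "y0 + s *s axis i (of_real \<delta>) = y"
        unfolding vec_eq_iff comp using \<delta> by (simp add: s_def)
      then show ?thesis by (simp add: g_def)
    qed
    moreover have "y \<in> W" by (rule W[OF yj])
    ultimately have 1: "U y \<le> K * ?I" by (simp add: U(2))
    have gU: "norm (g (circ t)) powr p = U (torus_point z \<delta> a (insert i I) (\<theta>(i := t)))" for t
    proof -
      have "y0 + circ t *s axis i (of_real \<delta>) = torus_point z \<delta> a (insert i I) (\<theta>(i := t))"
        unfolding vec_eq_iff comp using insert by (auto simp: torus_point_def y_def)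
      moreover have "y0 + circ t *s axis i (of_real \<delta>) \<in> W"
        by (rule inW) (use rho in \<open>simp only: norm_circ\<close>)
      ultimately show ?thesis by (simp add: U(2) g_def)
    qed
    from intg
    have "((\<lambda>t. norm (g (circ t)) powr p) has_integral ?I) {0..1}"
      by (rule integrable_integral)
    from nn_integral_has_integral_lebesgue'[OF _ this]
    have 2: "(\<integral>\<^sup>+ t. ennreal (norm (g (circ t)) powr p) * indicator {0..1} t \<partial>lborel)
        = ennreal (?I)" by simp
    have "ennreal (U y) \<le> ennreal (K * ?I)"
      using 1 by (rule ennreal_leI)
    also have "\<dots> = ennreal K * ennreal (?I)"
      using K by (rule ennreal_mult')
    also have "ennreal (?I) = (\<integral>\<^sup>+ t. ennreal (norm (g (circ t)) powr p) \<partial>circle_measure)"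
      unfolding 2[symmetric] circle_measure_def by (rule nn_integral_restrict_space[symmetric]) simp
    finally show ?thesis unfolding y_def gU .
  qed
  have meas: "(\<lambda>\<theta>. ennreal (U (torus_point z \<delta> a (insert i I) \<theta>))) \<in> borel_measurable (Pi\<^sub>M (insert i I) (\<lambda>_. circle_measure))"
    by (rule measurable_compose[OF torus_point_measurable U(1)])
  have "ennreal (U a) \<le> ennreal (K ^ card I) * (\<integral>\<^sup>+ \<theta>. U (torus_point z \<delta> a I \<theta>) \<partial>Pi\<^sub>M I (\<lambda>_. circle_measure))"
    using insert.IH by (simp only: K_def)
  also have "\<dots> \<le> ennreal (K ^ card I) * (\<integral>\<^sup>+ \<theta>. ennreal K *
      (\<integral>\<^sup>+ t. U (torus_point z \<delta> a (insert i I) (\<theta>(i := t))) \<partial>circle_measure) \<partial>Pi\<^sub>M I (\<lambda>_. circle_measure))"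
    by (intro mult_left_mono nn_integral_mono one) auto
  also have "\<dots> = ennreal (K ^ card I) * (ennreal K * (\<integral>\<^sup>+ \<theta>.
      (\<integral>\<^sup>+ t. U (torus_point z \<delta> a (insert i I) (\<theta>(i := t))) \<partial>circle_measure) \<partial>Pi\<^sub>M I (\<lambda>_. circle_measure)))"
  proof (subst nn_integral_cmult)
    have "(\<lambda>(\<theta>, t). ennreal (U (torus_point z \<delta> a (insert i I) (\<theta>(i := t))))) \<in> borel_measurable (Pi\<^sub>M I (\<lambda>_. circle_measure) \<Otimes>\<^sub>M circle_measure)"
    proof -
      have "(\<lambda>p. (fst p)(i := snd p)) \<in> measurable (Pi\<^sub>M I (\<lambda>_. circle_measure) \<Otimes>\<^sub>M circle_measure) (Pi\<^sub>M (insert i I) (\<lambda>_. circle_measure))"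
        by (rule measurable_fun_upd[where J = I]) auto
      from measurable_compose[OF this meas] show ?thesis by (simp add: case_prod_unfold)
    qed
    then show "(\<lambda>\<theta>. \<integral>\<^sup>+ t. U (torus_point z \<delta> a (insert i I) (\<theta>(i := t))) \<partial>circle_measure) \<in> borel_measurable (Pi\<^sub>M I (\<lambda>_. circle_measure))"
      by (rule sigma_finite_measure.borel_measurable_nn_integral[OF circle_product.sigma_finite_measures])
  qed simp
  also have "\<dots> = ennreal (K ^ card (insert i I)) * (\<integral>\<^sup>+ \<theta>. U (torus_point z \<delta> a (insert i I) \<theta>) \<partial>Pi\<^sub>M (insert i I) (\<lambda>_. circle_measure))"
    using insert K unfolding circle_product.product_nn_integral_insert[OF insert(1,2) meas]
    by (simp add: ennreal_mult mult_ac)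
  finally show ?case unfolding K_def .
qed

text \<open>The functions \<open>norm (c j) powr (1 / j)\<close> are log-subharmonic and uniformly bounded, and their upper
  limit is pointwise at most \<open>1 / R\<close>; Fatou's lemma on the torus turns this into a locally uniform bound.\<close>

lemma hartogs_lemma:
  fixes c :: "nat \<Rightarrow> complex^'n \<Rightarrow> complex"
  assumes W: "open W" "z \<in> W" and c: "\<And>j. holomorphic_fun_on (c j) W"
    and r: "r > 0" and bound: "\<And>j y. y \<in> W \<Longrightarrow> norm (c j y) \<le> C / r ^ j"
    and pw: "\<And>y s. y \<in> W \<Longrightarrow> 0 < s \<Longrightarrow> s < R \<Longrightarrow> \<exists>M. \<forall>j. norm (c j y) * s ^ j \<le> M"
    and R': "0 < R'" "R' < R"
  shows "\<exists>\<epsilon>>0. ball z \<epsilon> \<subseteq> W \<and> (\<exists>j0. \<forall>j\<ge>j0. \<forall>y\<in>ball z \<epsilon>. norm (c j y) \<le> (1 / R') ^ j)"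
proof -
  obtain e where e: "e > 0" "ball z e \<subseteq> W" using W open_contains_ball by blast
  define N where "N = CARD('n)"
  have N: "N > 0" by (simp add: N_def)
  \<comment> \<open>The norm is at most the sum of the \<open>N\<close> coordinate moduli; division
    by \<open>N + 1\<close> keeps the polydisc of radius \<open>\<delta>'\<close> strictly inside
    \<open>ball z e\<close>.\<close>
  define \<delta>' where "\<delta>' = e / (N + 1)"
  define \<delta> where "\<delta> = \<delta>' / 2"
  have "\<delta>' > 0" using e by (simp add: \<delta>'_def)
  then have \<delta>: "0 < \<delta>" "\<delta> < \<delta>'" by (simp_all add: \<delta>_def)
  have inW: "y \<in> W" if "\<And>i. norm (y $ i - z $ i) < \<delta>'" for y
  proof -
    have "norm (y - z) \<le> (\<Sum>i\<in>UNIV. norm ((y - z) $ i))"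
      unfolding norm_vec_def by (rule L2_set_le_sum) simp
    also have "\<dots> \<le> (\<Sum>i\<in>(UNIV::'n set). \<delta>')"
      using that by (intro sum_mono) (simp add: less_imp_le)
    also have "\<dots> = N * \<delta>'" by (simp add: N_def)
    also have "\<dots> < e" using e by (simp add: \<delta>'_def field_simps)
    finally show ?thesis using e by (auto simp: dist_norm norm_minus_commute)
  qed
  \<comment> \<open>Nothing is known about \<open>c j\<close> outside \<open>W\<close>; cutting off
    by the indicator makes \<open>U j\<close> Borel measurable on the whole space.\<close>
  define U where "U j y = norm (indicator W y *\<^sub>R c j y) powr (1 / real j)" for j y
  have Umeas: "(\<lambda>y. ennreal (U j y)) \<in> borel_measurable borel" for j
  proof -
    have "(\<lambda>y. indicator W y *\<^sub>R c j y) \<in> borel_measurable borel"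
      using W by (intro borel_measurable_continuous_on_indicator holomorphic_fun_on_continuous c) auto
    then show ?thesis unfolding U_def by measurable
  qed
  have UW: "U j y = norm (c j y) powr (1 / real j)" if "y \<in> W" for j y
    using that by (simp add: U_def)
  have UnW: "U j y = 0" if "y \<notin> W" for j y
    using that by (simp add: U_def)
  \<comment> \<open>Two gaps between \<open>R'\<close> and \<open>R\<close>: from
    \<open>R2 < R1\<close> the inequality between limits becomes strict, and \<open>R' < R2\<close>
    absorbs the factor \<open>(1 / (1 - \<eta>)) ^ N\<close>.\<close>
  obtain R1 where R1: "R' < R1" "R1 < R" using dense[OF R'(2)] by blast
  obtain R2 where R2: "R' < R2" "R2 < R1" using dense[OF R1(1)] by blast
  have pos: "R1 > 0" "R2 > 0" using R' R1 R2 by auto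
  have root_lim: "(\<lambda>j. M powr (1 / real j)) \<longlonglongrightarrow> 1" if "M > 0" for M :: real
  proof -
    have "(\<lambda>j. M powr (1 / real j)) \<longlonglongrightarrow> M powr 0"
      using that by (intro tendsto_powr tendsto_const lim_const_over_n) auto
    then show ?thesis using that by simp
  qed
  have power_root: "(x ^ j) powr (1 / real j) = x" if "j > 0" "x > 0" for x :: real and j
    using that by (simp add: powr_powr flip: powr_realpow)
  have limsupU: "limsup (\<lambda>j. ennreal (U j y)) \<le> ennreal (1 / R1)" for y
  proof (cases "y \<in> W")
    case False
    then show ?thesis using pos by (simp add: UnW Limsup_const)
  next
    case True
    obtain M0 where M0: "\<And>j. norm (c j y) * R1 ^ j \<le> M0" using pw[OF True pos(1) R1(2)] by blast
    define M where "M = max M0 1"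
    have M: "M > 0" "\<And>j. norm (c j y) \<le> M / R1 ^ j"
      using M0 pos by (auto simp: M_def pos_le_divide_eq le_max_iff_disj)
    have "limsup (\<lambda>j. ennreal (U j y)) \<le> limsup (\<lambda>j. ennreal (M powr (1 / real j) / R1))"
    proof (rule Limsup_mono)
      show "\<forall>\<^sub>F j in sequentially. ennreal (U j y) \<le> ennreal (M powr (1 / real j) / R1)"
        using eventually_gt_at_top[of 0]
      proof eventually_elim
        case (elim j)
        have "U j y \<le> (M / R1 ^ j) powr (1 / real j)"
          unfolding UW[OF True] by (intro powr_mono2 M(2)) auto
        also have "\<dots> = M powr (1 / real j) / R1"
          using M pos elim by (simp add: powr_divide power_root)
        finally show ?case by (rule ennreal_leI)
      qed
    qed
    also have "\<dots> = ennreal (1 / R1)"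
    proof (rule lim_imp_Limsup)
      have "(\<lambda>j. M powr (1 / real j) / R1) \<longlonglongrightarrow> 1 / R1"
        using pos by (intro tendsto_divide root_lim M tendsto_const) auto
      then show "(\<lambda>j. ennreal (M powr (1 / real j) / R1)) \<longlonglongrightarrow> ennreal (1 / R1)"
        by (rule tendsto_ennrealI)
    qed simp
    finally show ?thesis .
  qed
  define P where "P = Pi\<^sub>M (UNIV::'n set) (\<lambda>_. circle_measure)"
  have Pspace: "emeasure P (space P) = 1"
    unfolding P_def by (rule emeasure_circle_product_space) simp
  define X where "X = torus_point z \<delta> z UNIV"
  have Xmeas: "X \<in> borel_measurable P" unfolding X_def P_def by (rule torus_point_measurable)
  have torus_eq: "torus_point z \<delta> a UNIV = X" for a by (simp add: X_def torus_point_def fun_eq_iff)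
  define B where "B = max C 1"
  have Ubound: "U j y \<le> B / r" if "j > 0" for j y
  proof (cases "y \<in> W")
    case False
    then show ?thesis using r by (simp add: UnW B_def)
  next
    case True
    have "U j y \<le> (B / r ^ j) powr (1 / real j)"
      unfolding UW[OF True]
    proof (intro powr_mono2 order.trans[OF bound[OF True]])
      show "C / r ^ j \<le> B / r ^ j" using r by (intro divide_right_mono) (auto simp: B_def)
    qed auto
    also have "\<dots> = B powr (1 / real j) / r"
      using r that by (simp add: powr_divide power_root B_def)
    also have "B powr (1 / real j) \<le> B powr 1"
      using that by (intro powr_mono) (auto simp: B_def)
    finally show ?thesis using r by (simp add: B_def divide_right_mono)
  qed
  \<comment> \<open>The reverse Fatou lemma with the constant majorant \<open>B / r\<close>. The
    shift to \<open>Suc j\<close> excludes \<open>j = 0\<close>, where \<open>1 / real j\<close> is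
    0 by convention and the majorant may fail.\<close>
  have "limsup (\<lambda>j. \<integral>\<^sup>+ \<theta>. U (Suc j) (X \<theta>) \<partial>P) \<le> (\<integral>\<^sup>+ \<theta>. limsup (\<lambda>j. ennreal (U (Suc j) (X \<theta>))) \<partial>P)"
  proof (rule nn_integral_limsup[where w = "\<lambda>_. ennreal (B / r)"])
    show "(\<lambda>\<theta>. ennreal (U (Suc j) (X \<theta>))) \<in> borel_measurable P" for j
      by (rule measurable_compose[OF Xmeas Umeas])
    show "AE \<theta> in P. ennreal (U (Suc j) (X \<theta>)) \<le> ennreal (B / r)" for j
      by (intro AE_I2 ennreal_leI Ubound) simp
    show "(\<integral>\<^sup>+ \<theta>. ennreal (B / r) \<partial>P) < \<infinity>" by (simp add: Pspace ennreal_mult_less_top)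
  qed simp
  also have "\<dots> \<le> (\<integral>\<^sup>+ \<theta>. ennreal (1 / R1) \<partial>P)"
  proof (intro nn_integral_mono)
    fix \<theta>
    have "limsup (\<lambda>j. ennreal (U (Suc j) (X \<theta>))) \<le> limsup (\<lambda>j. ennreal (U j (X \<theta>)))"
      using limsup_subseq_mono[of Suc "\<lambda>j. ennreal (U j (X \<theta>))"] by (simp add: strict_mono_Suc_iff comp_def)
    also have "\<dots> \<le> ennreal (1 / R1)" by (rule limsupU)
    finally show "limsup (\<lambda>j. ennreal (U (Suc j) (X \<theta>))) \<le> ennreal (1 / R1)" .
  qed
  also have "\<dots> = ennreal (1 / R1)" by (simp add: Pspace)
  also have "\<dots> < ennreal (1 / R2)" using pos R2 by (intro ennreal_lessI) (auto simp: frac_less2)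
  finally have "\<forall>\<^sub>F j in sequentially. (\<integral>\<^sup>+ \<theta>. U (Suc j) (X \<theta>) \<partial>P) < ennreal (1 / R2)"
    by (rule Limsup_lessD)
  then obtain j0 where j0: "\<And>j. j \<ge> j0 \<Longrightarrow> (\<integral>\<^sup>+ \<theta>. U (Suc j) (X \<theta>) \<partial>P) < ennreal (1 / R2)"
    unfolding eventually_sequentially by blast
  \<comment> \<open>By Bernoulli's inequality (1 - \<eta>)^N is at least 1 - N \<eta> = R'/R2, so
    the factor of the mean value inequality is at most R2/R'.\<close>
  define \<eta> where "\<eta> = (1 - R' / R2) / N"
  have q: "0 < R' / R2" "R' / R2 < 1" using R' R2 pos by auto
  have \<eta>: "0 < \<eta>" "\<eta> < 1"
    using q N by (auto simp: \<eta>_def divide_less_eq)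
  have "1 + real N * (- \<eta>) \<le> (1 + (- \<eta>)) ^ N" using \<eta> by (intro Bernoulli_inequality) simp
  moreover have "1 + real N * (- \<eta>) = R' / R2" using N by (simp add: \<eta>_def)
  ultimately have "R' / R2 \<le> (1 - \<eta>) ^ N" by simp
  then have K: "(1 / (1 - \<eta>)) ^ N * (1 / R2) \<le> 1 / R'"
    using \<eta> R' pos by (simp add: power_one_over field_simps)
  show ?thesis
  proof (intro exI[of _ "\<eta> * \<delta>"] conjI exI[of _ "Suc j0"] allI impI ballI)
    show "\<eta> * \<delta> > 0" using \<eta> \<delta> by simp
    have ed: "\<eta> * \<delta> < \<delta>'"
      using mult_strict_right_mono[OF \<eta>(2) \<delta>(1)] \<delta> by linarith
    have comp: "norm (y $ i - z $ i) < \<eta> * \<delta>" if "y \<in> ball z (\<eta> * \<delta>)" for y i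
      using that Finite_Cartesian_Product.norm_nth_le[of "y - z" i] by (simp add: dist_norm norm_minus_commute)
    show sub: "ball z (\<eta> * \<delta>) \<subseteq> W"
    proof
      fix y assume "y \<in> ball z (\<eta> * \<delta>)"
      from comp[OF this] ed show "y \<in> W" by (intro inW) (metis less_trans)
    qed
    fix j y assume j: "Suc j0 \<le> j" and y: "y \<in> ball z (\<eta> * \<delta>)"
    obtain k where k: "j = Suc k" "k \<ge> j0" using j by (cases j) auto
    have yW: "y \<in> W" using sub y by blast
    have "ennreal (U j y) \<le> ennreal ((1 / (1 - \<eta>)) ^ card (UNIV :: 'n set)) *
        (\<integral>\<^sup>+ \<theta>. U j (torus_point z \<delta> y UNIV \<theta>) \<partial>Pi\<^sub>M UNIV (\<lambda>_. circle_measure))"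
      by (rule polydisc_powr_mean[OF c[of j] inW Umeas UW \<delta>])
        (use \<eta> k comp[OF y] in \<open>auto intro: less_imp_le\<close>)
    also have "\<dots> = ennreal ((1 / (1 - \<eta>)) ^ N) * (\<integral>\<^sup>+ \<theta>. U j (X \<theta>) \<partial>P)"
      unfolding torus_eq P_def[symmetric] N_def ..
    also have "\<dots> \<le> ennreal ((1 / (1 - \<eta>)) ^ N) * ennreal (1 / R2)"
      using j0[OF k(2)] unfolding k(1) by (intro mult_left_mono) auto
    also have "\<dots> = ennreal ((1 / (1 - \<eta>)) ^ N * (1 / R2))"
      using pos by (intro ennreal_mult''[symmetric]) simp
    also have "\<dots> \<le> ennreal (1 / R')" by (intro ennreal_leI K)
    finally have "U j y \<le> 1 / R'" using R' by (simp add: ennreal_le_iff)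
    then have "norm (c j y) powr (1 / real j) \<le> 1 / R'" by (simp add: UW[OF yW])
    then have "(norm (c j y) powr (1 / real j)) powr real j \<le> (1 / R') powr real j"
      by (intro powr_mono2) auto
    moreover have "(norm (c j y) powr (1 / real j)) powr real j = norm (c j y)"
      using k by (simp add: powr_powr)
    moreover have "(1 / R') powr real j = (1 / R') ^ j" using R' by (intro powr_realpow) simp
    ultimately show "norm (c j y) \<le> (1 / R') ^ j" by (simp only:)
  qed
qed

text \<open>For each \<open>y\<close> the function of time is a power series with coefficients
  \<open>c j y\<close>. Convergence on the full disc gives the pointwise bounds, the small radius
  \<open>r\<close> the uniform ones, and \<open>hartogs_lemma\<close> then makes the series at the
  given time converge uniformly near \<open>z\<close>.\<close>

lemma hartogs_extension:
  fixes f :: "complex \<Rightarrow> complex^'n \<Rightarrow> complex"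
  assumes W: "open W" "z \<in> W"
    and f: "\<And>y. y \<in> W \<Longrightarrow> (\<lambda>\<tau>. f \<tau> y) holomorphic_on ball \<tau>0 R"
    and c: "\<And>j. holomorphic_fun_on (c j) W"
      "\<And>j y. y \<in> W \<Longrightarrow> (deriv ^^ j) (\<lambda>\<tau>. f \<tau> y) \<tau>0 / fact j = c j y"
    and r: "r > 0" and bound: "\<And>j y. y \<in> W \<Longrightarrow> norm (c j y) \<le> C / r ^ j"
    and \<tau>: "\<tau> \<in> ball \<tau>0 R"
  shows "\<exists>\<epsilon>>0. holomorphic_fun_on (f \<tau>) (ball z \<epsilon>)"
proof -
  have sums: "(\<lambda>j. c j y * (t - \<tau>0) ^ j) sums f t y" if "y \<in> W" "t \<in> ball \<tau>0 R" for y t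
    using holomorphic_power_series[OF f[OF that(1)] that(2)] by (simp add: c(2)[OF that(1)])
  \<comment> \<open>A radius strictly between leaves a geometric majorant of ratio
    \<open>norm (\<tau> - \<tau>0) / R'\<close>.\<close>
  obtain R' where R': "norm (\<tau> - \<tau>0) < R'" "R' < R"
    using \<tau> dense[of "norm (\<tau> - \<tau>0)" R] by (auto simp: dist_norm norm_minus_commute)
  have R'0: "R' > 0" using R'(1) norm_ge_zero[of "\<tau> - \<tau>0"] by linarith
  have pw: "\<exists>M. \<forall>j. norm (c j y) * s ^ j \<le> M" if "y \<in> W" "0 < s" "s < R" for y s
  proof -
    have "summable (\<lambda>j. c j y * (of_real s) ^ j)"
      using sums[OF that(1), of "\<tau>0 + of_real s"] that by (intro sums_summable) (simp add: dist_norm)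
    then have "Bseq (\<lambda>j. c j y * (of_real s) ^ j)"
      using summable_LIMSEQ_zero convergentI convergent_imp_Bseq by blast
    then obtain M where "\<And>j. norm (c j y * (of_real s) ^ j) \<le> M" unfolding Bseq_def by blast
    then show ?thesis using that by (intro exI[of _ M]) (simp add: norm_mult norm_power)
  qed
  obtain \<epsilon> j0 where \<epsilon>: "\<epsilon> > 0" "ball z \<epsilon> \<subseteq> W" "\<And>j y. j \<ge> j0 \<Longrightarrow> y \<in> ball z \<epsilon> \<Longrightarrow> norm (c j y) \<le> (1 / R') ^ j"
    using hartogs_lemma[OF W c(1) r bound pw R'0 R'(2)] by blast
  define q where "q = norm (\<tau> - \<tau>0) / R'"
  have q: "0 \<le> q" "q < 1" using R' R'0 by (auto simp: q_def)
  have unif: "uniform_limit (ball z \<epsilon>) (\<lambda>n y. \<Sum>j<n. c j y * (\<tau> - \<tau>0) ^ j) (\<lambda>y. \<Sum>j. c j y * (\<tau> - \<tau>0) ^ j) sequentially"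
  proof (rule Weierstrass_m_test_ev)
    show "\<forall>\<^sub>F j in sequentially. \<forall>y\<in>ball z \<epsilon>. norm (c j y * (\<tau> - \<tau>0) ^ j) \<le> q ^ j"
      unfolding eventually_sequentially
    proof (intro exI allI impI ballI)
      fix j y assume "j0 \<le> j" "y \<in> ball z \<epsilon>"
      then have "norm (c j y) * norm (\<tau> - \<tau>0) ^ j \<le> (1 / R') ^ j * norm (\<tau> - \<tau>0) ^ j"
        by (intro mult_right_mono \<epsilon>) auto
      then show "norm (c j y * (\<tau> - \<tau>0) ^ j) \<le> q ^ j"
        by (simp add: norm_mult norm_power q_def power_divide)
    qed
    show "summable (\<lambda>j. q ^ j)" using q by (intro summable_geometric) simp
  qed
  have "holomorphic_fun_on (\<lambda>y. \<Sum>j. c j y * (\<tau> - \<tau>0) ^ j) (ball z \<epsilon>)"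
    by (rule holomorphic_fun_on_uniform_limit[OF open_ball _ unif])
      (intro holomorphic_fun_on_sum holomorphic_fun_on_mult holomorphic_fun_on_const holomorphic_fun_on_subset[OF c(1) \<epsilon>(2)])
  then have "holomorphic_fun_on (f \<tau>) (ball z \<epsilon>)"
  proof (rule holomorphic_fun_on_cong)
    fix y assume "y \<in> ball z \<epsilon>"
    then have "y \<in> W" using \<epsilon>(2) by blast
    from sums_unique[OF sums[OF this \<tau>]] show "(\<Sum>j. c j y * (\<tau> - \<tau>0) ^ j) = f \<tau> y" ..
  qed simp
  with \<epsilon>(1) show ?thesis by blast
qed

subsection \<open>Local flows of holomorphic vector fields\<close>

definition lie_derivative :: "(complex^'n \<Rightarrow> complex^'n) \<Rightarrow> (complex^'n \<Rightarrow> complex) \<Rightarrow> complex^'n \<Rightarrow> complex" where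
  "lie_derivative G u = (\<lambda>x. fderiv u x (G x))"

definition integral_path_on :: "(complex^'n \<Rightarrow> complex^'n) \<Rightarrow> (complex^'n) set \<Rightarrow> complex set \<Rightarrow> (complex \<Rightarrow> complex^'n) \<Rightarrow> bool" where
  "integral_path_on G S D g \<longleftrightarrow> (\<forall>\<tau>\<in>D. g \<tau> \<in> S \<and> (g has_derivative (\<lambda>h. h *s G (g \<tau>))) (at \<tau>))"

lemma integral_path_onD:
  assumes "integral_path_on G S D g" "\<tau> \<in> D"
  shows "g \<tau> \<in> S" "(g has_derivative (\<lambda>h. h *s G (g \<tau>))) (at \<tau>)"
  using assms unfolding integral_path_on_def by auto

lemma holomorphic_fun_on_iterated_lie_derivative:
  assumes "open S" "holomorphic_map_on G S" "holomorphic_fun_on u S"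
  shows "holomorphic_fun_on ((lie_derivative G ^^ k) u) S"
  by (induction k) (simp_all add: assms lie_derivative_def holomorphic_fun_on_lie_derivative)

text \<open>Iterated chain rule. The Taylor coefficients in time are thereby functions of the
  current point alone, and holomorphic ones.\<close>

lemma higher_deriv_along_integral_path:
  assumes S: "open S" "holomorphic_map_on G S" "holomorphic_fun_on u S"
    and g: "integral_path_on G S D g" "open D" "\<tau> \<in> D"
  shows "(deriv ^^ k) (\<lambda>\<tau>. u (g \<tau>)) \<tau> = (lie_derivative G ^^ k) u (g \<tau>)"
  using g(3)
proof (induction k arbitrary: \<tau>)
  case (Suc k)
  have "((\<lambda>\<tau>. (lie_derivative G ^^ k) u (g \<tau>)) has_field_derivative
      fderiv ((lie_derivative G ^^ k) u) (g \<tau>) (G (g \<tau>))) (at \<tau>)"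
    by (rule has_field_derivative_compose_holomorphic_fun[OF holomorphic_fun_on_iterated_lie_derivative[OF S]])
      (rule integral_path_onD[OF g(1) Suc.prems])+
  then have "((deriv ^^ k) (\<lambda>\<tau>. u (g \<tau>)) has_field_derivative
      fderiv ((lie_derivative G ^^ k) u) (g \<tau>) (G (g \<tau>))) (at \<tau>)"
    by (rule has_field_derivative_transform_within_open[OF _ g(2) Suc.prems]) (simp add: Suc.IH)
  then have "deriv ((deriv ^^ k) (\<lambda>\<tau>. u (g \<tau>))) \<tau> = fderiv ((lie_derivative G ^^ k) u) (g \<tau>) (G (g \<tau>))"
    by (rule DERIV_imp_deriv)
  then show ?case by (simp add: lie_derivative_def[of G "(lie_derivative G ^^ k) u"])
qed simp

lemma holomorphic_on_compose_integral_path: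
  assumes "holomorphic_fun_on u S" "integral_path_on G S D g"
  shows "(\<lambda>\<tau>. u (g \<tau>)) holomorphic_on D"
  by (rule holomorphic_on_has_field_derivativeI,
      rule has_field_derivative_compose_holomorphic_fun[OF assms(1)])
    (rule integral_path_onD[OF assms(2)], assumption)+

lemma integral_path_series:
  assumes S: "open S" "holomorphic_map_on G S" "holomorphic_fun_on u S"
    and g: "integral_path_on G S (ball \<tau>0 \<rho>) g" "\<tau> \<in> ball \<tau>0 \<rho>"
  shows "(\<lambda>k. (lie_derivative G ^^ k) u (g \<tau>0) / fact k * (\<tau> - \<tau>0) ^ k) sums u (g \<tau>)"
proof -
  have "\<rho> > 0" using g(2) by (metis dist_not_less_zero linorder_not_less mem_ball order.strict_trans2)
  then have "\<tau>0 \<in> ball \<tau>0 \<rho>" by simp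
  then show ?thesis
    using holomorphic_power_series[OF holomorphic_on_compose_integral_path[OF S(3) g(1)] g(2)]
    by (simp add: higher_deriv_along_integral_path[OF S g(1)])
qed

text \<open>The coordinates of both paths have the same Lie series, because its coefficients depend
  only on the common starting point.\<close>

lemma integral_path_unique:
  assumes S: "open S" "holomorphic_map_on G S"
    and g: "integral_path_on G S (ball \<tau>0 \<rho>) g" and h: "integral_path_on G S (ball \<tau>0 \<rho>) h"
    and "g \<tau>0 = h \<tau>0" "\<tau> \<in> ball \<tau>0 \<rho>"
  shows "g \<tau> = h \<tau>"
proof -
  have "g \<tau> $ i = h \<tau> $ i" for i
    by (rule sums_unique2[OF integral_path_series[OF S holomorphic_fun_on_nth g assms(6), unfolded assms(5)]
      integral_path_series[OF S holomorphic_fun_on_nth h assms(6)]])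
  then show ?thesis by (simp add: vec_eq_iff)
qed

lemma complex_path_bound:
  fixes g :: "complex \<Rightarrow> complex^'n"
  assumes "convex D" "\<And>\<tau>. \<tau> \<in> D \<Longrightarrow> (g has_derivative (\<lambda>h. h *s g' \<tau>)) (at \<tau>)"
    and "\<And>\<tau>. \<tau> \<in> D \<Longrightarrow> norm (g' \<tau>) \<le> B" "s \<in> D" "t \<in> D"
  shows "norm (g s - g t) \<le> B * norm (s - t)"
proof (rule differentiable_bound[OF assms(1) _ _ assms(4,5)])
  fix \<tau> assume \<tau>: "\<tau> \<in> D"
  show "(g has_derivative (\<lambda>h. h *s g' \<tau>)) (at \<tau> within D)"
    by (rule has_derivative_at_withinI[OF assms(2)[OF \<tau>]])
  show "onorm (\<lambda>h. h *s g' \<tau>) \<le> B"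
  proof (rule onorm_le)
    show "norm (x *s g' \<tau>) \<le> B * norm x" for x
      unfolding norm_vector_smult using mult_right_mono[OF assms(3)[OF \<tau>] norm_ge_zero[of x]]
      by (simp add: mult.commute)
  qed
qed

section \<open>Picard iteration and holomorphic dependence on the initial point\<close>

lemma holomorphic_map_locally_lipschitz:
  fixes G :: "complex^'n \<Rightarrow> complex^'k"
  assumes "open S" "holomorphic_map_on G S" "x0 \<in> S"
  obtains d M L where "d > 0" "M > 0" "L > 0" "cball x0 d \<subseteq> S"
    "\<And>x. x \<in> cball x0 d \<Longrightarrow> norm (G x) \<le> M"
    "\<And>x y. x \<in> cball x0 d \<Longrightarrow> y \<in> cball x0 d \<Longrightarrow> norm (G x - G y) \<le> L * norm (x - y)"
proof -
  obtain e where e: "e > 0" "cball x0 e \<subseteq> S" using assms open_contains_cball by blast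
  define d where "d = e / 2"
  have d: "d > 0" using e by (simp add: d_def)
  have "bounded (G ` cball x0 e)"
    by (intro compact_imp_bounded compact_continuous_image continuous_on_subset[OF holomorphic_map_on_continuous[OF assms(2)] e(2)])
      simp
  then obtain M where M: "M > 0" "\<And>x. x \<in> cball x0 e \<Longrightarrow> norm (G x) \<le> M"
    unfolding bounded_pos by blast
  define L where "L = real CARD('k) * (M / d)"
  have Gi: "holomorphic_fun_on (\<lambda>x. G x $ i) S" for i
    using assms(2) by (simp add: holomorphic_map_on_def)
  have lip: "norm (G x - G y) \<le> L * norm (x - y)" if "x \<in> cball x0 d" "y \<in> cball x0 d" for x y
  proof (rule differentiable_bound[where S = "cball x0 d"])
    fix x assume x: "x \<in> cball x0 d"
    have sub: "cball x d \<subseteq> cball x0 e"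
      using x by (intro cball_subset_cball_iff[THEN iffD2]) (simp add: d_def dist_commute)
    have xS: "x \<in> S" using sub e d by (meson centre_in_cball less_imp_le subsetD)
    show "(G has_derivative (\<lambda>h. \<chi> i. fderiv (\<lambda>x. G x $ i) x h)) (at x within cball x0 d)"
      by (rule has_derivative_at_withinI[OF holomorphic_map_has_derivative[OF assms(2) xS]])
    show "onorm (\<lambda>h. \<chi> i. fderiv (\<lambda>x. G x $ i) x h) \<le> L"
    proof (rule onorm_le)
      fix v
      have "norm (\<chi> i. fderiv (\<lambda>x. G x $ i) x v) \<le> (\<Sum>i\<in>UNIV. norm ((\<chi> i. fderiv (\<lambda>x. G x $ i) x v) $ i))"
        unfolding norm_vec_def by (rule L2_set_le_sum) simp
      also have "\<dots> \<le> (\<Sum>i\<in>(UNIV::'k set). M / d * norm v)"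
        unfolding vec_lambda_beta
      proof (intro sum_mono fderiv_cauchy_bound[OF Gi _ d])
        show "cball x d \<subseteq> S" using sub e by blast
        show "norm (G y $ i) \<le> M" if "y \<in> cball x d" for y i
          using M(2)[of y] sub that Finite_Cartesian_Product.norm_nth_le order_trans by blast
      qed
      finally show "norm (\<chi> i. fderiv (\<lambda>x. G x $ i) x v) \<le> L * norm v"
        by (simp add: L_def)
    qed
  qed (use that in auto)
  have de: "cball x0 d \<subseteq> cball x0 e" using e by (intro subset_cball) (simp add: d_def)
  show thesis
  proof (rule that[OF d M(1)])
    show "L > 0" using M d by (simp add: L_def)
    show "cball x0 d \<subseteq> S" using de e by blast
    show "norm (G x) \<le> M" if "x \<in> cball x0 d" for x using M(2) de that by blast
  qed (rule lip)
qed

text \<open>The Picard operator, \<open>z\<close> plus the integral of \<open>G\<close> along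
  \<open>g\<close>. In complex time the integral is a holomorphic primitive on the disc, taken
  componentwise and normalized at 0.\<close>

lemma picard_step:
  assumes G: "holomorphic_map_on G S" and g: "\<And>\<tau>. \<tau> \<in> ball 0 \<epsilon> \<Longrightarrow> g \<tau> \<in> S"
    "\<And>\<tau>. \<tau> \<in> ball 0 \<epsilon> \<Longrightarrow> (g has_derivative (\<lambda>h. h *s g' \<tau>)) (at \<tau>)"
  shows "\<exists>k. k 0 = z \<and> (\<forall>\<tau>\<in>ball 0 \<epsilon>. (k has_derivative (\<lambda>h. h *s G (g \<tau>))) (at \<tau>))"
proof -
  have "\<exists>P. \<forall>\<tau>\<in>ball 0 \<epsilon>. (P has_field_derivative G (g \<tau>) $ i) (at \<tau>)" for i
  proof -
    have Gi: "holomorphic_fun_on (\<lambda>x. G x $ i) S" using G by (simp add: holomorphic_map_on_def)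
    have "(\<lambda>\<tau>. G (g \<tau>) $ i) holomorphic_on ball 0 \<epsilon>"
      by (rule holomorphic_on_has_field_derivativeI,
          rule has_field_derivative_compose_holomorphic_fun[OF Gi g(2) g(1)])
    then obtain P where "\<And>\<tau>. \<tau> \<in> ball 0 \<epsilon> \<Longrightarrow> (P has_field_derivative G (g \<tau>) $ i) (at \<tau> within ball 0 \<epsilon>)"
      using holomorphic_convex_primitive'[OF convex_ball open_ball] by blast
    then show ?thesis by (metis at_within_open open_ball)
  qed
  then obtain P where P: "\<And>i \<tau>. \<tau> \<in> ball 0 \<epsilon> \<Longrightarrow> (P i has_field_derivative G (g \<tau>) $ i) (at \<tau>)" by metis
  let ?k = "\<lambda>\<tau>. \<chi> i. P i \<tau> - P i 0 + z $ i"
  have "(?k has_derivative (\<lambda>h. h *s G (g \<tau>))) (at \<tau>)" if \<tau>: "\<tau> \<in> ball 0 \<epsilon>" for \<tau>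
  proof (rule has_derivative_vecI, unfold vec_lambda_beta)
    fix i
    have "((\<lambda>\<tau>. P i \<tau> - P i 0 + z $ i) has_field_derivative G (g \<tau>) $ i - 0 + 0) (at \<tau>)"
      by (intro DERIV_add DERIV_diff P \<tau> DERIV_const)
    then show "((\<lambda>\<tau>. P i \<tau> - P i 0 + z $ i) has_derivative (\<lambda>h. (h *s G (g \<tau>)) $ i)) (at \<tau>)"
      by (simp add: has_field_derivative_def mult.commute[of _ "G (g \<tau>) $ i"])
  qed
  then show ?thesis by (intro exI[of _ ?k]) (simp add: vec_eq_iff)
qed

text \<open>\<open>M * \<epsilon> \<le> d\<close> keeps the iterates in the ball, and
  \<open>L * \<epsilon> \<le> 1 / 2\<close> halves the bound on the distance of successive iterates.
  Their derivatives then converge uniformly as well, so the differential equation survives in the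
  limit.\<close>

lemma picard_solution:
  fixes G :: "complex^'n \<Rightarrow> complex^'n"
  assumes G: "holomorphic_map_on G S" and sub: "cball z d \<subseteq> S"
    and M: "\<And>x. x \<in> cball z d \<Longrightarrow> norm (G x) \<le> M"
    and L: "\<And>x y. x \<in> cball z d \<Longrightarrow> y \<in> cball z d \<Longrightarrow> norm (G x - G y) \<le> L * norm (x - y)"
    and \<epsilon>: "\<epsilon> > 0" "M * \<epsilon> \<le> d" "L * \<epsilon> \<le> 1 / 2" and pos: "M \<ge> 0" "L \<ge> 0" "d > 0"
  shows "\<exists>g. g 0 = z \<and> integral_path_on G (cball z d) (ball 0 \<epsilon>) g"
proof -
  let ?D = "ball (0::complex) \<epsilon>"
  \<comment> \<open>Differentiability belongs to the invariant, since it provides the primitive for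
    the next iterate.\<close>
  define A where "A g \<longleftrightarrow> g 0 = z \<and> (\<forall>\<tau>\<in>?D. g \<tau> \<in> cball z d) \<and>
    (\<exists>g'. \<forall>\<tau>\<in>?D. (g has_derivative (\<lambda>h. h *s g' \<tau>)) (at \<tau>))" for g
  have "\<exists>f. \<forall>n. A (f n) \<and> (\<forall>\<tau>\<in>?D. (f (Suc n) has_derivative (\<lambda>h. h *s G (f n \<tau>))) (at \<tau>))"
  proof (rule dependent_nat_choice)
    have "A (\<lambda>_. z)" unfolding A_def using pos by (auto intro!: exI[of _ "\<lambda>_. 0"])
    then show "\<exists>g. A g" by blast
    fix g :: "complex \<Rightarrow> complex^'n" and n :: nat
    assume "A g"
    then obtain g' where g: "g 0 = z" "\<And>\<tau>. \<tau> \<in> ?D \<Longrightarrow> g \<tau> \<in> cball z d"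
      "\<And>\<tau>. \<tau> \<in> ?D \<Longrightarrow> (g has_derivative (\<lambda>h. h *s g' \<tau>)) (at \<tau>)" unfolding A_def by blast
    from picard_step[OF G subsetD[OF sub g(2)] g(3)]
    obtain k where k: "k 0 = z" "\<And>\<tau>. \<tau> \<in> ?D \<Longrightarrow> (k has_derivative (\<lambda>h. h *s G (g \<tau>))) (at \<tau>)" by blast
    have "k \<tau> \<in> cball z d" if \<tau>: "\<tau> \<in> ?D" for \<tau>
    proof -
      have "norm (k \<tau> - k 0) \<le> M * norm (\<tau> - 0)"
        by (rule complex_path_bound[OF convex_ball k(2) M[OF g(2)] \<tau>]) (use \<epsilon> in auto)
      also have "\<dots> \<le> M * \<epsilon>" using \<tau> pos by (intro mult_left_mono) auto
      finally show ?thesis using \<epsilon> k(1) by (simp add: dist_norm norm_minus_commute)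
    qed
    with k have "A k" unfolding A_def by (intro conjI exI[of _ "\<lambda>\<tau>. G (g \<tau>)"] ballI) simp_all
    with k(2) show "\<exists>k. A k \<and> (\<forall>\<tau>\<in>?D. (k has_derivative (\<lambda>h. h *s G (g \<tau>))) (at \<tau>))"
      by (intro exI[of _ k] conjI ballI) simp_all
  qed
  then obtain f where Af: "\<And>n. A (f n)"
    and fder: "\<And>n \<tau>. \<tau> \<in> ?D \<Longrightarrow> (f (Suc n) has_derivative (\<lambda>h. h *s G (f n \<tau>))) (at \<tau>)" by blast
  have f: "f n 0 = z" "\<And>\<tau>. \<tau> \<in> ?D \<Longrightarrow> f n \<tau> \<in> cball z d" for n
    using Af[of n] unfolding A_def by auto
  have z0: "(0::complex) \<in> ?D" using \<epsilon> by simp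
  have step: "norm (f (Suc n) \<tau> - f n \<tau>) \<le> 2 * d / 2 ^ n" if "\<tau> \<in> ?D" for n \<tau>
    using that
  proof (induction n arbitrary: \<tau>)
    case 0
    have "norm (f (Suc 0) \<tau> - f 0 \<tau>) \<le> norm (f (Suc 0) \<tau> - z) + norm (f 0 \<tau> - z)"
      using norm_triangle_ineq4[of "f (Suc 0) \<tau> - z" "f 0 \<tau> - z"] by simp
    also have "\<dots> \<le> d + d"
      using f(2)[OF 0, of 0] f(2)[OF 0, of "Suc 0"] by (intro add_mono) (simp_all add: dist_norm norm_minus_commute)
    finally show ?case by simp
  next
    case (Suc n)
    have "norm ((f (Suc (Suc n)) \<tau> - f (Suc n) \<tau>) - (f (Suc (Suc n)) 0 - f (Suc n) 0)) \<le> (L * (2 * d / 2 ^ n)) * norm (\<tau> - 0)"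
    proof (rule complex_path_bound[OF convex_ball _ _ Suc.prems z0])
      fix t assume t: "t \<in> ?D"
      show "((\<lambda>\<tau>. f (Suc (Suc n)) \<tau> - f (Suc n) \<tau>) has_derivative (\<lambda>h. h *s (G (f (Suc n) t) - G (f n t)))) (at t)"
        unfolding vector_ssub_ldistrib by (intro has_derivative_diff fder t)
      have "norm (G (f (Suc n) t) - G (f n t)) \<le> L * norm (f (Suc n) t - f n t)"
        by (intro L f(2) t)
      also have "\<dots> \<le> L * (2 * d / 2 ^ n)" using pos by (intro mult_left_mono Suc.IH t)
      finally show "norm (G (f (Suc n) t) - G (f n t)) \<le> L * (2 * d / 2 ^ n)" .
    qed
    also have "\<dots> \<le> (L * (2 * d / 2 ^ n)) * \<epsilon>"
      using Suc.prems pos by (intro mult_left_mono) auto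
    also have "\<dots> = (L * \<epsilon>) * (2 * d / 2 ^ n)" by simp
    also have "\<dots> \<le> 1 / 2 * (2 * d / 2 ^ n)" using \<epsilon> pos by (intro mult_right_mono) auto
    finally show ?case by (simp add: f(1))
  qed
  \<comment> \<open>The exact partial sum of the geometric series is kept so that the induction on
    \<open>k\<close> closes.\<close>
  have tail: "norm (f (n + k) \<tau> - f n \<tau>) \<le> 4 * d / 2 ^ n * (1 - 1 / 2 ^ k)" if "\<tau> \<in> ?D" for n k \<tau>
  proof (induction k)
    case (Suc k)
    have "norm (f (n + Suc k) \<tau> - f n \<tau>) \<le> norm (f (Suc (n + k)) \<tau> - f (n + k) \<tau>) + norm (f (n + k) \<tau> - f n \<tau>)"
      using norm_triangle_ineq[of "f (Suc (n + k)) \<tau> - f (n + k) \<tau>" "f (n + k) \<tau> - f n \<tau>"] by simp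
    also have "\<dots> \<le> 2 * d / 2 ^ (n + k) + 4 * d / 2 ^ n * (1 - 1 / 2 ^ k)"
      by (intro add_mono step that Suc.IH)
    also have "\<dots> = 4 * d / 2 ^ n * (1 - 1 / 2 ^ Suc k)" by (simp add: power_add field_simps)
    finally show ?case .
  qed simp
  have tail': "norm (f m \<tau> - f n \<tau>) \<le> 4 * d / 2 ^ n" if "\<tau> \<in> ?D" "m \<ge> n" for m n \<tau>
  proof -
    have "4 * d / 2 ^ n * (1 - 1 / 2 ^ (m - n)) \<le> 4 * d / 2 ^ n * 1" using pos by (intro mult_left_mono) auto
    with tail[OF that(1), of n "m - n"] that(2) show ?thesis by simp
  qed
  have small: "\<exists>N. \<forall>n\<ge>N. 4 * d / 2 ^ n < e" if "e > 0" for e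
  proof -
    have "(\<lambda>n. (4 * d) * (1 / 2) ^ n) \<longlonglongrightarrow> (4 * d) * 0"
      by (intro tendsto_mult tendsto_const LIMSEQ_power_zero) simp
    then have "\<forall>\<^sub>F n in sequentially. (4 * d) * (1 / 2) ^ n < e"
      using that by (intro order_tendstoD(2)) simp_all
    then show ?thesis by (simp add: eventually_sequentially power_one_over)
  qed
  have "convergent (\<lambda>n. f n \<tau>)" if "\<tau> \<in> ?D" for \<tau>
  proof (intro Cauchy_convergent CauchyI')
    fix e :: real assume "e > 0"
    then obtain N where N: "\<And>n. n \<ge> N \<Longrightarrow> 4 * d / 2 ^ n < e" using small by blast
    show "\<exists>M. \<forall>m\<ge>M. \<forall>n>m. dist (f m \<tau>) (f n \<tau>) < e"
    proof (intro exI allI impI)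
      fix m n assume "N \<le> m" "m < n"
      then show "dist (f m \<tau>) (f n \<tau>) < e"
        using tail'[OF that, of m n] N[of m] by (simp add: dist_norm norm_minus_commute)
    qed
  qed
  then obtain \<Phi> where \<Phi>: "\<And>\<tau>. \<tau> \<in> ?D \<Longrightarrow> (\<lambda>n. f n \<tau>) \<longlonglongrightarrow> \<Phi> \<tau>"
    unfolding convergent_def by metis
  have \<Phi>in: "\<Phi> \<tau> \<in> cball z d" if "\<tau> \<in> ?D" for \<tau>
    by (rule closed_sequentially[OF closed_cball f(2)[OF that] \<Phi>[OF that]])
  have dist\<Phi>: "norm (f n \<tau> - \<Phi> \<tau>) \<le> 4 * d / 2 ^ n" if "\<tau> \<in> ?D" for n \<tau>
  proof -
    have "(\<lambda>m. norm (f m \<tau> - f n \<tau>)) \<longlonglongrightarrow> norm (\<Phi> \<tau> - f n \<tau>)" by (intro tendsto_intros \<Phi> that)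
    moreover have "\<forall>\<^sub>F m in sequentially. norm (f m \<tau> - f n \<tau>) \<le> 4 * d / 2 ^ n"
      unfolding eventually_sequentially using tail'[OF that] by blast
    ultimately have "norm (\<Phi> \<tau> - f n \<tau>) \<le> 4 * d / 2 ^ n" by (rule tendsto_upperbound) simp
    then show ?thesis by (simp add: norm_minus_commute)
  qed
  have "\<exists>g. \<forall>\<tau>\<in>?D. (\<lambda>n. f (Suc n) \<tau>) \<longlonglongrightarrow> g \<tau> \<and> (g has_derivative (\<lambda>h. h *s G (\<Phi> \<tau>))) (at \<tau> within ?D)"
  proof (rule has_derivative_sequence)
    show "convex (?D)" by (rule convex_ball)
    show "0 \<in> ?D" by (rule z0)
    show "(f (Suc n) has_derivative (\<lambda>h. h *s G (f n \<tau>))) (at \<tau> within ?D)" if "\<tau> \<in> ?D" for n \<tau>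
      by (rule has_derivative_at_withinI[OF fder[OF that]])
    show "(\<lambda>n. f (Suc n) 0) \<longlonglongrightarrow> z" by (simp add: f(1))
    fix e :: real assume e: "e > 0"
    have "e / (L + 1) > 0" using e pos by simp
    from small[OF this] obtain N where N: "\<And>n. n \<ge> N \<Longrightarrow> 4 * d / 2 ^ n < e / (L + 1)" by blast
    show "\<forall>\<^sub>F n in sequentially. \<forall>\<tau>\<in>?D. \<forall>h. norm (h *s G (f n \<tau>) - h *s G (\<Phi> \<tau>)) \<le> e * norm h"
      unfolding eventually_sequentially
    proof (intro exI allI impI ballI)
      fix n and \<tau> h :: complex assume n: "N \<le> n" and \<tau>: "\<tau> \<in> ?D"
      have "norm (G (f n \<tau>) - G (\<Phi> \<tau>)) \<le> L * norm (f n \<tau> - \<Phi> \<tau>)" by (intro L f(2) \<Phi>in \<tau>)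
      also have "\<dots> \<le> L * (e / (L + 1))"
        using dist\<Phi>[OF \<tau>, of n] N[OF n] pos by (intro mult_left_mono) auto
      also have "\<dots> \<le> e" using e pos by (simp add: field_simps)
      finally have "norm h * norm (G (f n \<tau>) - G (\<Phi> \<tau>)) \<le> norm h * e" by (intro mult_left_mono) auto
      then show "norm (h *s G (f n \<tau>) - h *s G (\<Phi> \<tau>)) \<le> e * norm h"
        by (simp add: mult.commute norm_vector_smult flip: vector_ssub_ldistrib)
    qed
  qed
  then obtain g where g: "\<And>\<tau>. \<tau> \<in> ?D \<Longrightarrow> (\<lambda>n. f (Suc n) \<tau>) \<longlonglongrightarrow> g \<tau>"
    "\<And>\<tau>. \<tau> \<in> ?D \<Longrightarrow> (g has_derivative (\<lambda>h. h *s G (\<Phi> \<tau>))) (at \<tau> within ?D)" by blast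
  have eq: "g \<tau> = \<Phi> \<tau>" if "\<tau> \<in> ?D" for \<tau>
    by (rule LIMSEQ_unique[OF g(1)[OF that] LIMSEQ_Suc[OF \<Phi>[OF that]]])
  have "(\<lambda>n. f (Suc n) 0) \<longlonglongrightarrow> z" by (simp add: f(1))
  then have "g 0 = z" using g(1)[OF z0] LIMSEQ_unique by blast
  moreover have "integral_path_on G (cball z d) (?D) g"
    unfolding integral_path_on_def
  proof (intro ballI conjI)
    fix \<tau> assume \<tau>: "\<tau> \<in> ?D"
    show "g \<tau> \<in> cball z d" unfolding eq[OF \<tau>] by (rule \<Phi>in[OF \<tau>])
    show "(g has_derivative (\<lambda>h. h *s G (g \<tau>))) (at \<tau>)"
      using g(2)[OF \<tau>] unfolding eq[OF \<tau>] at_within_open[OF \<tau> open_ball] .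
  qed
  ultimately show ?thesis by blast
qed

lemma integral_path_on_subset:
  "integral_path_on G S D g \<Longrightarrow> E \<subseteq> D \<Longrightarrow> S \<subseteq> T \<Longrightarrow> integral_path_on G T E g"
  unfolding integral_path_on_def by blast

text \<open>Picard iteration provides a path for each initial point separately. Holomorphic
  dependence on that point comes from the Lie series of the coordinates: its coefficients are
  holomorphic, and Cauchy's estimate along the paths makes it converge uniformly at each fixed
  time.\<close>

lemma local_flow:
  fixes G :: "complex^'n \<Rightarrow> complex^'n"
  assumes S: "open S" "holomorphic_map_on G S" "x0 \<in> S"
  obtains \<epsilon> d M \<Phi> where "\<epsilon> > 0" "d > 0" "M > 0"
    "\<And>z. z \<in> ball x0 d \<Longrightarrow> \<Phi> 0 z = z"
    "\<And>z. z \<in> ball x0 d \<Longrightarrow> integral_path_on G S (ball 0 \<epsilon>) (\<lambda>\<tau>. \<Phi> \<tau> z)"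
    "\<And>\<tau>. \<tau> \<in> ball 0 \<epsilon> \<Longrightarrow> holomorphic_map_on (\<Phi> \<tau>) (ball x0 d)"
    "\<And>z \<tau> \<sigma>. z \<in> ball x0 d \<Longrightarrow> \<tau> \<in> ball 0 \<epsilon> \<Longrightarrow> \<sigma> \<in> ball 0 \<epsilon> \<Longrightarrow> norm (\<Phi> \<tau> z - \<Phi> \<sigma> z) \<le> M * norm (\<tau> - \<sigma>)"
proof -
  obtain d0 M L where pos: "d0 > 0" "M > 0" "L > 0" and sub0: "cball x0 d0 \<subseteq> S"
    and M: "\<And>x. x \<in> cball x0 d0 \<Longrightarrow> norm (G x) \<le> M"
    and L: "\<And>x y. x \<in> cball x0 d0 \<Longrightarrow> y \<in> cball x0 d0 \<Longrightarrow> norm (G x - G y) \<le> L * norm (x - y)"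
    by (rule holomorphic_map_locally_lipschitz[OF S]) (rule that)
  \<comment> \<open>With half the radius, the balls of radius \<open>d\<close> about all points of
    \<open>ball x0 d\<close> stay in \<open>cball x0 d0\<close>, so the same
    \<open>\<epsilon>\<close> serves all of them.\<close>
  define d where "d = d0 / 2"
  have d: "d > 0" using pos by (simp add: d_def)
  define \<epsilon> where "\<epsilon> = min (d / M) (1 / (2 * L))"
  have \<epsilon>: "\<epsilon> > 0" "M * \<epsilon> \<le> d" "L * \<epsilon> \<le> 1 / 2"
  proof -
    show "\<epsilon> > 0" using pos d by (simp add: \<epsilon>_def)
    have "M * \<epsilon> \<le> M * (d / M)" using pos by (intro mult_left_mono) (auto simp: \<epsilon>_def)
    then show "M * \<epsilon> \<le> d" using pos by simp
    have "L * \<epsilon> \<le> L * (1 / (2 * L))" using pos by (intro mult_left_mono) (auto simp: \<epsilon>_def)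
    then show "L * \<epsilon> \<le> 1 / 2" using pos by simp
  qed
  have sub: "cball z d \<subseteq> cball x0 d0" if "z \<in> ball x0 d" for z
    using that by (intro cball_subset_cball_iff[THEN iffD2]) (simp add: d_def dist_commute)
  have "\<exists>g. g 0 = z \<and> integral_path_on G (cball z d) (ball 0 \<epsilon>) g" if z: "z \<in> ball x0 d" for z
  proof (rule picard_solution[OF S(2), where M = M and L = L])
    show "cball z d \<subseteq> S" using sub[OF z] sub0 by blast
    show "norm (G x) \<le> M" if "x \<in> cball z d" for x using M sub[OF z] that by blast
    show "norm (G x - G y) \<le> L * norm (x - y)" if "x \<in> cball z d" "y \<in> cball z d" for x y
      using L sub[OF z] that by blast
  qed (use \<epsilon> pos d in auto)
  then obtain \<Psi> where \<Psi>: "\<And>z. z \<in> ball x0 d \<Longrightarrow> \<Psi> z 0 = z"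
    "\<And>z. z \<in> ball x0 d \<Longrightarrow> integral_path_on G (cball z d) (ball 0 \<epsilon>) (\<Psi> z)" by metis
  have path: "integral_path_on G (cball x0 d0) (ball 0 \<epsilon>) (\<Psi> z)" if "z \<in> ball x0 d" for z
    using integral_path_on_subset[OF \<Psi>(2)[OF that] subset_refl sub[OF that]] .
  have pathS: "integral_path_on G S (ball 0 \<epsilon>) (\<Psi> z)" if "z \<in> ball x0 d" for z
    using integral_path_on_subset[OF path[OF that] subset_refl sub0] .
  have lip: "norm (\<Psi> z \<tau> - \<Psi> z \<sigma>) \<le> M * norm (\<tau> - \<sigma>)"
    if z: "z \<in> ball x0 d" and "\<tau> \<in> ball 0 \<epsilon>" "\<sigma> \<in> ball 0 \<epsilon>" for z \<tau> \<sigma>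
  proof (rule complex_path_bound[OF convex_ball _ _ that(2,3)])
    fix t assume t: "t \<in> ball (0::complex) \<epsilon>"
    show "(\<Psi> z has_derivative (\<lambda>h. h *s G (\<Psi> z t))) (at t)" by (rule integral_path_onD[OF path[OF z] t])
    show "norm (G (\<Psi> z t)) \<le> M" by (rule M[OF integral_path_onD(1)[OF path[OF z] t]])
  qed
  have hol: "holomorphic_map_on (\<lambda>z. \<Psi> z \<tau>) (ball x0 d)" if \<tau>: "\<tau> \<in> ball 0 \<epsilon>" for \<tau>
    unfolding holomorphic_map_on_def
  proof
    fix i
    define c where "c k = (\<lambda>z. (lie_derivative G ^^ k) (\<lambda>x. x $ i) z / fact k)" for k
    have ser: "(\<lambda>k. c k z * \<tau> ^ k) sums (\<Psi> z \<tau> $ i)" if z: "z \<in> ball x0 d" for z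
      using integral_path_series[OF S(1,2) holomorphic_fun_on_nth[of i] pathS[OF z] \<tau>]
      by (simp add: c_def \<Psi>(1)[OF z])
    have "norm \<tau> < \<epsilon>" using \<tau> by simp
    then obtain s where s: "norm \<tau> < s" "s < \<epsilon>" using dense by blast
    have s0: "s > 0" using s(1) norm_ge_zero[of \<tau>] by linarith
    define B where "B = norm x0 + d0"
    have cb: "norm (c k z) \<le> B / s ^ k" if z: "z \<in> ball x0 d" for k z
    proof -
      let ?u = "\<lambda>t. \<Psi> z t $ i"
      have holu: "?u holomorphic_on ball 0 \<epsilon>"
        by (rule holomorphic_on_compose_integral_path[OF holomorphic_fun_on_nth pathS[OF z]])
      have subs: "cball 0 s \<subseteq> ball (0::complex) \<epsilon>" using s by auto
      have "norm ((deriv ^^ k) ?u 0) \<le> fact k * B / s ^ k"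
      proof (rule higher_deriv_bound_cball[OF holu subs s0])
        fix t :: complex assume "t \<in> cball 0 s"
        then have "t \<in> ball 0 \<epsilon>" using subs by blast
        from integral_path_onD(1)[OF path[OF z] this] have "norm (\<Psi> z t) \<le> B"
          unfolding B_def using norm_triangle_sub[of "\<Psi> z t" x0] by (simp add: dist_norm norm_minus_commute)
        then show "norm (\<Psi> z t $ i) \<le> B" using Finite_Cartesian_Product.norm_nth_le order_trans by blast
      qed
      moreover have "(deriv ^^ k) ?u 0 = (lie_derivative G ^^ k) (\<lambda>x. x $ i) z"
        using higher_deriv_along_integral_path[OF S(1,2) holomorphic_fun_on_nth[of i] pathS[OF z], of 0 k] \<epsilon>(1)
        by (simp add: \<Psi>(1)[OF z])
      ultimately show ?thesis
        by (simp add: c_def norm_divide pos_divide_le_eq mult.commute)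
    qed
    have unif: "uniform_limit (ball x0 d) (\<lambda>n z. \<Sum>k<n. c k z * \<tau> ^ k) (\<lambda>z. \<Sum>k. c k z * \<tau> ^ k) sequentially"
    proof (rule Weierstrass_m_test)
      show "norm (c k z * \<tau> ^ k) \<le> B * (norm \<tau> / s) ^ k" if "z \<in> ball x0 d" for k z
      proof -
        have "norm (c k z) * norm \<tau> ^ k \<le> B / s ^ k * norm \<tau> ^ k"
          by (intro mult_right_mono cb that) simp
        then show ?thesis by (simp add: norm_mult norm_power power_divide)
      qed
      show "summable (\<lambda>k. B * (norm \<tau> / s) ^ k)"
        using s s0 by (intro summable_mult summable_geometric) simp
    qed
    have ck: "holomorphic_fun_on (c k) (ball x0 d)" for k
    proof -
      have "ball x0 d \<subseteq> S" using sub0 d pos by (auto simp: d_def)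
      from holomorphic_fun_on_subset[OF holomorphic_fun_on_iterated_lie_derivative[OF S(1,2) holomorphic_fun_on_nth] this]
      have "holomorphic_fun_on (\<lambda>z. (1 / fact k) * (lie_derivative G ^^ k) (\<lambda>x. x $ i) z) (ball x0 d)"
        by (rule holomorphic_fun_on_cmult)
      then show ?thesis by (simp add: c_def)
    qed
    have "holomorphic_fun_on (\<lambda>z. \<Sum>k. c k z * \<tau> ^ k) (ball x0 d)"
      by (rule holomorphic_fun_on_uniform_limit[OF open_ball _ unif])
        (intro holomorphic_fun_on_sum holomorphic_fun_on_mult holomorphic_fun_on_const ck)
    then show "holomorphic_fun_on (\<lambda>z. \<Psi> z \<tau> $ i) (ball x0 d)"
      by (rule holomorphic_fun_on_cong) (simp_all add: sums_unique[OF ser])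
  qed
  show thesis
    by (rule that[of \<epsilon> d M "\<lambda>\<tau> z. \<Psi> z \<tau>"]) (rule \<epsilon> d pos \<Psi>(1) pathS hol lip, assumption?)+
qed

text \<open>Holomorphy of a function that is holomorphic along integral paths spreads along these paths:
  apply Hartogs' lemma in the flow time.\<close>

lemma holomorphy_spreads_along_path:
  fixes G :: "complex^'n \<Rightarrow> complex^'n"
  assumes S: "open S" "holomorphic_map_on G S" "x0 \<in> S"
    and \<phi>: "\<And>\<tau>0 \<rho> g. integral_path_on G S (ball \<tau>0 \<rho>) g \<Longrightarrow> (\<lambda>\<tau>. \<phi> (g \<tau>)) holomorphic_on ball \<tau>0 \<rho>"
    and \<gamma>: "integral_path_on G S (ball 0 \<rho>) \<gamma>" "\<gamma> 0 = x0" "\<rho> > 0"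
  shows "\<exists>\<rho>'>0. \<forall>\<tau>0 U. norm \<tau>0 < \<rho>' \<and> open U \<and> \<gamma> \<tau>0 \<in> U \<and> holomorphic_fun_on \<phi> U
    \<longrightarrow> (\<exists>\<delta>>0. holomorphic_fun_on \<phi> (ball x0 \<delta>))"
proof -
  obtain \<epsilon> d M \<Phi> where pos: "\<epsilon> > 0" "d > 0" "M > 0"
    and \<Phi>0: "\<And>z. z \<in> ball x0 d \<Longrightarrow> \<Phi> 0 z = z"
    and path: "\<And>z. z \<in> ball x0 d \<Longrightarrow> integral_path_on G S (ball 0 \<epsilon>) (\<lambda>\<tau>. \<Phi> \<tau> z)"
    and hol: "\<And>\<tau>. \<tau> \<in> ball 0 \<epsilon> \<Longrightarrow> holomorphic_map_on (\<Phi> \<tau>) (ball x0 d)"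
    and lip: "\<And>z \<tau> \<sigma>. z \<in> ball x0 d \<Longrightarrow> \<tau> \<in> ball 0 \<epsilon> \<Longrightarrow> \<sigma> \<in> ball 0 \<epsilon> \<Longrightarrow> norm (\<Phi> \<tau> z - \<Phi> \<sigma> z) \<le> M * norm (\<tau> - \<sigma>)"
    by (rule local_flow[OF S]) (rule that)
  have x0: "x0 \<in> ball x0 d" using pos by simp
  show ?thesis
  \<comment> \<open>For \<open>norm \<tau>0 < \<epsilon> / 2\<close> the disc of radius
    \<open>\<epsilon> - norm \<tau>0\<close> about \<open>\<tau>0\<close> lies in the time domain of
    the flow and contains time 0, where the flow is the identity. The bound \<open>\<rho>\<close>
    lets \<open>\<gamma> \<tau>0\<close> be identified with the flow of \<open>x0\<close> by
    uniqueness.\<close>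
  proof (rule exI[of _ "min (\<epsilon> / 2) \<rho>"], intro conjI allI impI)
    show "min (\<epsilon> / 2) \<rho> > 0" using pos \<gamma>(3) by simp
    fix \<tau>0 U0 assume asm: "norm \<tau>0 < min (\<epsilon> / 2) \<rho> \<and> open U0 \<and> \<gamma> \<tau>0 \<in> U0 \<and> holomorphic_fun_on \<phi> U0"
    define m where "m = min \<epsilon> \<rho>"
    have m: "norm \<tau>0 < m" "m \<le> \<epsilon>" "m \<le> \<rho>" using asm pos by (auto simp: m_def)
    have \<tau>\<epsilon>: "norm \<tau>0 < \<epsilon> / 2" using asm by simp
    have t0: "\<tau>0 \<in> ball 0 \<epsilon>" using \<tau>\<epsilon> pos by simp
    define p where "p = \<gamma> \<tau>0"
    have p: "\<Phi> \<tau>0 x0 = p"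
      unfolding p_def
    proof (rule integral_path_unique[OF S(1,2)])
      show "integral_path_on G S (ball 0 m) (\<lambda>\<tau>. \<Phi> \<tau> x0)"
        by (rule integral_path_on_subset[OF path[OF x0] subset_ball[OF m(2)] subset_refl])
      show "integral_path_on G S (ball 0 m) \<gamma>"
        by (rule integral_path_on_subset[OF \<gamma>(1) subset_ball[OF m(3)] subset_refl])
      show "\<Phi> 0 x0 = \<gamma> 0" using \<Phi>0[OF x0] \<gamma>(2) by simp
      show "\<tau>0 \<in> ball 0 m" using m by simp
    qed
    define U where "U = U0 \<inter> S"
    have U: "open U" "U \<subseteq> S" "holomorphic_fun_on \<phi> U"
      using asm S(1) holomorphic_fun_on_subset[of \<phi> U0 U] by (auto simp: U_def)
    have "p \<in> S" using integral_path_onD(1)[OF path[OF x0] t0] p by simp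
    then have "p \<in> U" using asm by (simp add: U_def p_def)
    then obtain e0 where e0: "e0 > 0" "cball p e0 \<subseteq> U" using U(1) open_contains_cball by blast
    define e where "e = e0 / 2"
    have e: "e > 0" "cball p (2 * e) \<subseteq> U" using e0 by (auto simp: e_def)
    have "bounded (\<phi> ` cball p (2 * e))"
      by (intro compact_imp_bounded compact_continuous_image continuous_on_subset[OF holomorphic_fun_on_continuous[OF U(3)] e(2)])
        simp
    then obtain C where C: "\<And>x. x \<in> cball p (2 * e) \<Longrightarrow> norm (\<phi> x) \<le> C"
      unfolding bounded_pos by blast
    \<comment> \<open>Initial points that the flow carries at time \<open>\<tau>0\<close> close to
      \<open>p\<close>, where \<open>\<phi>\<close> is already holomorphic.\<close>
    define W where "W = {y \<in> ball x0 d. \<Phi> \<tau>0 y \<in> ball p e}"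
    have W: "open W" "x0 \<in> W"
    proof -
      have "W = ball x0 d \<inter> \<Phi> \<tau>0 -` ball p e" by (auto simp: W_def)
      then show "open W"
        using continuous_open_preimage[OF holomorphic_map_on_continuous[OF hol[OF t0]] open_ball open_ball] by simp
      show "x0 \<in> W" using x0 e by (simp add: W_def p)
    qed
    \<comment> \<open>The flow is \<open>M\<close>-Lipschitz in time, so within \<open>r\<close> of
      \<open>\<tau>0\<close> it moves by at most \<open>e\<close> and stays in
      \<open>cball p (2 * e)\<close>; the bound \<open>\<epsilon> / 2\<close> keeps these times in
      the domain of the flow.\<close>
    define r where "r = min (e / M) (\<epsilon> / 2)"
    have r: "r > 0" "M * r \<le> e" "ball \<tau>0 r \<subseteq> ball 0 \<epsilon>"
    proof -
      show "r > 0" using e pos by (simp add: r_def)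
      have "M * r \<le> M * (e / M)" using pos by (intro mult_left_mono) (auto simp: r_def)
      then show "M * r \<le> e" using pos by simp
      show "ball \<tau>0 r \<subseteq> ball 0 \<epsilon>"
      proof (intro ball_subset_ball_iff[THEN iffD2] disjI1)
        have "r \<le> \<epsilon> / 2" unfolding r_def by (rule min.cobounded2)
        with \<tau>\<epsilon> show "dist \<tau>0 0 + r \<le> \<epsilon>" by simp
      qed
    qed
    have near: "\<Phi> \<tau> y \<in> cball p (2 * e)" if y: "y \<in> W" and \<tau>: "\<tau> \<in> ball \<tau>0 r" for \<tau> y
    proof -
      have yb: "y \<in> ball x0 d" "dist p (\<Phi> \<tau>0 y) < e" using y by (auto simp: W_def)
      have "norm (\<Phi> \<tau>0 y - \<Phi> \<tau> y) \<le> M * norm (\<tau>0 - \<tau>)"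
        using r(3) \<tau> by (intro lip yb t0) auto
      also have "\<dots> \<le> M * r" using \<tau> pos by (intro mult_left_mono) (auto simp: dist_norm)
      finally have "dist (\<Phi> \<tau>0 y) (\<Phi> \<tau> y) \<le> e" using r(2) by (simp add: dist_norm)
      then show ?thesis using dist_triangle[of p "\<Phi> \<tau> y" "\<Phi> \<tau>0 y"] yb(2) by simp
    qed
    have pathU: "integral_path_on G U (ball \<tau>0 r) (\<lambda>\<tau>. \<Phi> \<tau> y)" if y: "y \<in> W" for y
      unfolding integral_path_on_def
    proof (intro ballI conjI)
      fix \<tau> assume \<tau>: "\<tau> \<in> ball \<tau>0 r"
      show "\<Phi> \<tau> y \<in> U" using near[OF y \<tau>] e(2) by blast
      show "((\<lambda>\<tau>. \<Phi> \<tau> y) has_derivative (\<lambda>h. h *s G (\<Phi> \<tau> y))) (at \<tau>)"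
        using y r(3) \<tau> by (intro integral_path_onD(2)[OF path]) (auto simp: W_def)
    qed
    have GU: "holomorphic_map_on G U"
      by (rule holomorphic_map_on_subset[OF S(2) U(2)])
    \<comment> \<open>Taylor coefficients in time at \<open>\<tau>0\<close>. As Lie derivatives they
      involve \<open>\<phi>\<close> only on \<open>U\<close>, hence are holomorphic in the initial
      point although nothing is known yet about \<open>\<phi>\<close> near
      \<open>x0\<close>.\<close>
    define c where "c j = (\<lambda>y. (lie_derivative G ^^ j) \<phi> (\<Phi> \<tau>0 y) / fact j)" for j
    have tr: "\<tau>0 \<in> ball \<tau>0 r" using r by simp
    have cder: "(deriv ^^ j) (\<lambda>\<tau>. \<phi> (\<Phi> \<tau> y)) \<tau>0 / fact j = c j y" if "y \<in> W" for j y
      unfolding c_def higher_deriv_along_integral_path[OF U(1) GU U(3) pathU[OF that] open_ball tr] ..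
    have choldW: "holomorphic_fun_on (c j) W" for j
    proof -
      have \<Phi>W: "holomorphic_map_on (\<Phi> \<tau>0) W"
        by (rule holomorphic_map_on_subset[OF hol[OF t0]]) (auto simp: W_def)
      have "\<Phi> \<tau>0 ` W \<subseteq> U" using near[OF _ tr] e(2) by blast
      then have "holomorphic_fun_on (\<lambda>y. (lie_derivative G ^^ j) \<phi> (\<Phi> \<tau>0 y)) W"
        by (rule holomorphic_fun_on_compose[OF \<Phi>W holomorphic_fun_on_iterated_lie_derivative[OF U(1) GU U(3)]])
      from holomorphic_fun_on_cmult[OF this, of "1 / fact j"] show ?thesis by (simp add: c_def)
    qed
    have bound: "norm (c j y) \<le> C / (r / 2) ^ j" if y: "y \<in> W" for j y
    proof -
      have holf: "(\<lambda>\<tau>. \<phi> (\<Phi> \<tau> y)) holomorphic_on ball \<tau>0 r"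
        by (rule holomorphic_on_compose_integral_path[OF U(3) pathU[OF y]])
      have sub: "cball \<tau>0 (r / 2) \<subseteq> ball \<tau>0 r" using r by auto
      have "norm ((deriv ^^ j) (\<lambda>\<tau>. \<phi> (\<Phi> \<tau> y)) \<tau>0) \<le> fact j * C / (r / 2) ^ j"
        by (rule higher_deriv_bound_cball[OF holf sub]) (use r(1) sub in \<open>auto intro!: C near y\<close>)
      then show ?thesis unfolding cder[OF y, symmetric]
        by (simp add: norm_divide pos_divide_le_eq mult.commute)
    qed
    have sub: "ball \<tau>0 (\<epsilon> - norm \<tau>0) \<subseteq> ball 0 \<epsilon>"
      by (intro ball_subset_ball_iff[THEN iffD2]) (simp add: dist_norm)
    have "\<exists>\<delta>>0. holomorphic_fun_on (\<lambda>y. \<phi> (\<Phi> 0 y)) (ball x0 \<delta>)"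
    proof (rule hartogs_extension[where f = "\<lambda>\<tau> y. \<phi> (\<Phi> \<tau> y)" and \<tau> = 0 and \<tau>0 = \<tau>0
        and R = "\<epsilon> - norm \<tau>0" and r = "r / 2" and c = c and W = W and C = C])
      show "(\<lambda>\<tau>. \<phi> (\<Phi> \<tau> y)) holomorphic_on ball \<tau>0 (\<epsilon> - norm \<tau>0)" if "y \<in> W" for y
        using that by (intro \<phi> integral_path_on_subset[OF path sub subset_refl]) (simp add: W_def)
      show "0 < r / 2" using r(1) by simp
      show "0 \<in> ball \<tau>0 (\<epsilon> - norm \<tau>0)" using \<tau>\<epsilon> by (simp add: dist_norm)
    qed (fact W choldW cder bound)+
    then obtain \<delta> where \<delta>: "\<delta> > 0" "holomorphic_fun_on (\<lambda>y. \<phi> (\<Phi> 0 y)) (ball x0 \<delta>)" by blast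
    have "holomorphic_fun_on (\<lambda>y. \<phi> (\<Phi> 0 y)) (ball x0 (min \<delta> d))"
      by (rule holomorphic_fun_on_subset[OF \<delta>(2) subset_ball]) simp
    then have "holomorphic_fun_on \<phi> (ball x0 (min \<delta> d))"
      by (rule holomorphic_fun_on_cong) (simp_all add: \<Phi>0)
    then show "\<exists>\<delta>>0. holomorphic_fun_on \<phi> (ball x0 \<delta>)" using \<delta>(1) pos(2) by (intro exI[of _ "min \<delta> d"]) simp
  qed
qed

subsection \<open>Charts\<close>

locale complex_atlas =
  fixes \<A> :: "('m::{t2_space, second_countable_topology}, 'n::finite) chart set"
  assumes atlas: "complex_manifold \<A>"
begin

lemma chart:
  assumes "\<kappa> \<in> \<A>"
  shows chart_domain_open: "open (fst \<kappa>)" and chart_image_open: "open (chart_image \<kappa>)"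
    and chart_homeomorphism: "homeomorphism (fst \<kappa>) (chart_image \<kappa>) (snd \<kappa>) (chart_inv \<kappa>)"
  using atlas assms unfolding complex_manifold_def is_chart_def by blast+

lemma chart_inv_apply: "\<kappa> \<in> \<A> \<Longrightarrow> p \<in> fst \<kappa> \<Longrightarrow> chart_inv \<kappa> (snd \<kappa> p) = p"
  using chart_homeomorphism homeomorphism_apply1 by blast

lemma chart_apply_inv: "\<kappa> \<in> \<A> \<Longrightarrow> z \<in> chart_image \<kappa> \<Longrightarrow> snd \<kappa> (chart_inv \<kappa> z) = z"
  using chart_homeomorphism homeomorphism_apply2 by blast

lemma chart_inv_in: "\<kappa> \<in> \<A> \<Longrightarrow> z \<in> chart_image \<kappa> \<Longrightarrow> chart_inv \<kappa> z \<in> fst \<kappa>"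
  using chart_homeomorphism[of \<kappa>] unfolding homeomorphism_def by blast

lemma chart_in_image: "p \<in> fst \<kappa> \<Longrightarrow> snd \<kappa> p \<in> chart_image \<kappa>"
  by (simp add: chart_image_def)

lemma chart_at: "\<exists>\<kappa>\<in>\<A>. p \<in> fst \<kappa>"
  using atlas unfolding complex_manifold_def by blast

lemma chart_inv_continuous: "\<kappa> \<in> \<A> \<Longrightarrow> continuous_on (chart_image \<kappa>) (chart_inv \<kappa>)"
  using chart_homeomorphism homeomorphism_cont2 by blast

lemma chart_continuous: "\<kappa> \<in> \<A> \<Longrightarrow> continuous_on (fst \<kappa>) (snd \<kappa>)"
  using chart_homeomorphism homeomorphism_cont1 by blast

lemma chart_image_Int_eq:
  assumes "\<kappa> \<in> \<A>"
  shows "snd \<kappa> ` (fst \<kappa> \<inter> U) = chart_image \<kappa> \<inter> chart_inv \<kappa> -` U"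
proof (intro equalityI subsetI)
  fix z assume "z \<in> snd \<kappa> ` (fst \<kappa> \<inter> U)"
  then obtain p where "p \<in> fst \<kappa>" "p \<in> U" "z = snd \<kappa> p" by blast
  then show "z \<in> chart_image \<kappa> \<inter> chart_inv \<kappa> -` U"
    using chart_inv_apply[OF assms] by (simp add: chart_in_image)
next
  fix z assume z: "z \<in> chart_image \<kappa> \<inter> chart_inv \<kappa> -` U"
  then have "z = snd \<kappa> (chart_inv \<kappa> z)" "chart_inv \<kappa> z \<in> fst \<kappa> \<inter> U"
    using chart_apply_inv[OF assms] chart_inv_in[OF assms] by auto
  then show "z \<in> snd \<kappa> ` (fst \<kappa> \<inter> U)" by (rule image_eqI)
qed

lemma chart_image_Int_open: "\<kappa> \<in> \<A> \<Longrightarrow> open U \<Longrightarrow> open (snd \<kappa> ` (fst \<kappa> \<inter> U))"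
  unfolding chart_image_Int_eq
  by (rule continuous_open_preimage[OF chart_inv_continuous chart_image_open])

lemma transition_holomorphic:
  assumes "\<kappa> \<in> \<A>" "\<mu> \<in> \<A>"
  shows "holomorphic_map_on (transition \<kappa> \<mu>) (snd \<kappa> ` (fst \<kappa> \<inter> fst \<mu>))"
  using atlas assms unfolding complex_manifold_def compatible_def by blast

lemma chart_inv_transition:
  assumes "\<kappa> \<in> \<A>" "\<mu> \<in> \<A>" "z \<in> snd \<kappa> ` (fst \<kappa> \<inter> fst \<mu>)"
  shows "chart_inv \<mu> (transition \<kappa> \<mu> z) = chart_inv \<kappa> z" "transition \<kappa> \<mu> z \<in> chart_image \<mu>"
proof -
  obtain x where x: "z = snd \<kappa> x" "x \<in> fst \<kappa>" "x \<in> fst \<mu>" using assms(3) by blast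
  have "chart_inv \<kappa> z = x" unfolding x(1) by (rule chart_inv_apply[OF assms(1) x(2)])
  then show "chart_inv \<mu> (transition \<kappa> \<mu> z) = chart_inv \<kappa> z" "transition \<kappa> \<mu> z \<in> chart_image \<mu>"
    using chart_inv_apply[OF assms(2) x(3)] chart_in_image[OF x(3)] by (simp_all add: transition_def)
qed

text \<open>The hypothesis is the equation in the single chart \<open>\<kappa>\<close>; the
  transformation law of \<open>F\<close> and the chain rule give it in every other chart that the
  path meets.\<close>

lemma solution_from_chart:
  assumes F: "holomorphic_vector_field \<A> F" and \<kappa>: "\<kappa> \<in> \<A>"
    and D: "open D" "connected D"
    and g: "integral_path_on (F \<kappa> \<circ> chart_inv \<kappa>) (chart_image \<kappa>) D g"
  shows "solution \<A> F D (\<lambda>\<zeta>. chart_inv \<kappa> (g \<zeta>))"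
  unfolding solution_def
proof (intro conjI ballI impI D)
  have "continuous_on D g"
    by (intro continuous_at_imp_continuous_on ballI has_derivative_continuous[OF integral_path_onD(2)[OF g]])
  then show "continuous_on D (\<lambda>\<zeta>. chart_inv \<kappa> (g \<zeta>))"
    by (rule continuous_on_compose2[OF chart_inv_continuous[OF \<kappa>]])
      (use integral_path_onD(1)[OF g] in blast)
  fix \<zeta> \<mu> assume \<zeta>: "\<zeta> \<in> D" and \<mu>: "\<mu> \<in> \<A>" and p: "chart_inv \<kappa> (g \<zeta>) \<in> fst \<mu>"
  let ?p = "chart_inv \<kappa> (g \<zeta>)"
  have gz: "g \<zeta> \<in> chart_image \<kappa>" by (rule integral_path_onD(1)[OF g \<zeta>])
  have sp: "snd \<kappa> ?p = g \<zeta>" by (rule chart_apply_inv[OF \<kappa> gz])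
  have pk: "?p \<in> fst \<kappa>" by (rule chart_inv_in[OF \<kappa> gz])
  have dom: "g \<zeta> \<in> snd \<kappa> ` (fst \<kappa> \<inter> fst \<mu>)" using sp pk p by (metis IntI image_eqI)
  note tr = transition_holomorphic[OF \<kappa> \<mu>]
  have der: "((\<lambda>s. transition \<kappa> \<mu> (g s)) has_derivative
      (\<lambda>h. frechet_derivative (transition \<kappa> \<mu>) (at (g \<zeta>)) (h *s (F \<kappa> \<circ> chart_inv \<kappa>) (g \<zeta>)))) (at \<zeta>)"
    by (rule has_derivative_compose[OF integral_path_onD(2)[OF g \<zeta>] holomorphic_map_has_frechet_derivative[OF tr dom]])
  have eq: "frechet_derivative (transition \<kappa> \<mu>) (at (g \<zeta>)) (F \<kappa> ?p) = F \<mu> ?p"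
    using F \<kappa> \<mu> pk p sp unfolding holomorphic_vector_field_def by (metis IntI)
  show "((\<lambda>s. snd \<mu> (chart_inv \<kappa> (g s))) has_derivative (\<lambda>h. h *s F \<mu> ?p)) (at \<zeta>)"
    using der[unfolded holomorphic_map_fderiv_smult[OF tr dom] o_apply, unfolded eq]
    by (simp only: transition_def o_apply)
qed

section \<open>Holomorphy near a point of the manifold\<close>

text \<open>Required in one chart only; compatibility of the charts transfers it to all charts at
  \<open>p\<close>.\<close>

definition holomorphic_near :: "('m \<Rightarrow> complex) \<Rightarrow> 'm \<Rightarrow> bool" where
  "holomorphic_near \<phi> p \<longleftrightarrow> (\<exists>\<kappa>\<in>\<A>. p \<in> fst \<kappa> \<and>
    (\<exists>U. open U \<and> snd \<kappa> p \<in> U \<and> U \<subseteq> chart_image \<kappa> \<and> holomorphic_fun_on (\<lambda>z. \<phi> (chart_inv \<kappa> z)) U))"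

lemma holomorphic_nearI:
  assumes \<kappa>: "\<kappa> \<in> \<A>" "p \<in> fst \<kappa>" and U: "open U" "snd \<kappa> p \<in> U" "holomorphic_fun_on (\<lambda>z. \<phi> (chart_inv \<kappa> z)) U"
  shows "holomorphic_near \<phi> p"
  unfolding holomorphic_near_def
proof (intro bexI[OF _ \<kappa>(1)] conjI \<kappa>(2), rule exI[of _ "U \<inter> chart_image \<kappa>"], intro conjI)
  show "open (U \<inter> chart_image \<kappa>)" by (intro open_Int U chart_image_open \<kappa>)
  show "snd \<kappa> p \<in> U \<inter> chart_image \<kappa>" using U \<kappa> by (simp add: chart_in_image)
  show "holomorphic_fun_on (\<lambda>z. \<phi> (chart_inv \<kappa> z)) (U \<inter> chart_image \<kappa>)"
    by (rule holomorphic_fun_on_subset[OF U(3)]) simp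
qed simp

lemma holomorphic_near_any_chart:
  assumes "holomorphic_near \<phi> p" and \<mu>: "\<mu> \<in> \<A>" "p \<in> fst \<mu>"
  shows "\<exists>U. open U \<and> snd \<mu> p \<in> U \<and> holomorphic_fun_on (\<lambda>z. \<phi> (chart_inv \<mu> z)) U"
proof -
  obtain \<kappa> U where \<kappa>: "\<kappa> \<in> \<A>" "p \<in> fst \<kappa>"
    and U: "open U" "snd \<kappa> p \<in> U" "U \<subseteq> chart_image \<kappa>" "holomorphic_fun_on (\<lambda>z. \<phi> (chart_inv \<kappa> z)) U"
    using assms(1) unfolding holomorphic_near_def by blast
  let ?V = "snd \<mu> ` (fst \<mu> \<inter> fst \<kappa>)"
  note tr = transition_holomorphic[OF \<mu>(1) \<kappa>(1)]
  define W where "W = ?V \<inter> transition \<mu> \<kappa> -` U"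
  have oV: "open ?V" by (rule chart_image_Int_open[OF \<mu>(1) chart_domain_open[OF \<kappa>(1)]])
  have W: "open W" unfolding W_def
    by (rule continuous_open_preimage[OF holomorphic_map_on_continuous[OF tr] oV U(1)])
  have "transition \<mu> \<kappa> (snd \<mu> p) = snd \<kappa> p"
    using chart_inv_apply[OF \<mu>] by (simp add: transition_def)
  then have pW: "snd \<mu> p \<in> W" using U(2) \<mu> \<kappa> by (auto simp: W_def)
  have "holomorphic_fun_on (\<lambda>z. \<phi> (chart_inv \<kappa> (transition \<mu> \<kappa> z))) W"
    by (rule holomorphic_fun_on_compose[OF holomorphic_map_on_subset[OF tr] U(4)]) (auto simp: W_def)
  then have "holomorphic_fun_on (\<lambda>z. \<phi> (chart_inv \<mu> z)) W"
  proof (rule holomorphic_fun_on_cong[OF _ W])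
    fix z assume "z \<in> W"
    then have "z \<in> ?V" by (simp add: W_def)
    from chart_inv_transition(1)[OF \<mu>(1) \<kappa>(1) this]
    show "\<phi> (chart_inv \<kappa> (transition \<mu> \<kappa> z)) = \<phi> (chart_inv \<mu> z)" by simp
  qed
  with W pW show ?thesis by blast
qed

lemma holomorphic_near_open: "open {p. holomorphic_near \<phi> p}"
proof (subst open_subopen, intro ballI)
  fix p assume "p \<in> {p. holomorphic_near \<phi> p}"
  then obtain \<kappa> U where \<kappa>: "\<kappa> \<in> \<A>" "p \<in> fst \<kappa>"
    and U: "open U" "snd \<kappa> p \<in> U" "U \<subseteq> chart_image \<kappa>" "holomorphic_fun_on (\<lambda>z. \<phi> (chart_inv \<kappa> z)) U"
    unfolding holomorphic_near_def by blast
  have "open (fst \<kappa> \<inter> snd \<kappa> -` U)"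
    by (rule continuous_open_preimage[OF chart_continuous[OF \<kappa>(1)] chart_domain_open[OF \<kappa>(1)] U(1)])
  moreover have "fst \<kappa> \<inter> snd \<kappa> -` U \<subseteq> {p. holomorphic_near \<phi> p}"
    using holomorphic_nearI[OF \<kappa>(1) _ U(1) _ U(4)] by blast
  ultimately show "\<exists>T. open T \<and> p \<in> T \<and> T \<subseteq> {p. holomorphic_near \<phi> p}"
    using \<kappa> U by blast
qed

text \<open>The points with \<open>holomorphic_near\<close> form an open set, which serves as the
  neighbourhood of \<open>S\<close> in the definition.\<close>

lemma holomorphic_on_manifold_near:
  assumes "\<And>p. p \<in> S \<Longrightarrow> holomorphic_near \<phi> p"
  shows "holomorphic_on_manifold \<A> \<phi> S"
  unfolding holomorphic_on_manifold_def
proof (rule exI[of _ "{p. holomorphic_near \<phi> p}"], intro conjI ballI holomorphic_near_open)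
  show "S \<subseteq> {p. holomorphic_near \<phi> p}" using assms by blast
  fix \<kappa> assume \<kappa>: "\<kappa> \<in> \<A>"
  show "holomorphic_fun_on (\<phi> \<circ> chart_inv \<kappa>) (snd \<kappa> ` (fst \<kappa> \<inter> {p. holomorphic_near \<phi> p}))"
  proof (rule holomorphic_fun_on_local)
    fix z assume "z \<in> snd \<kappa> ` (fst \<kappa> \<inter> {p. holomorphic_near \<phi> p})"
    then obtain p where "p \<in> fst \<kappa>" "holomorphic_near \<phi> p" "z = snd \<kappa> p" by blast
    with holomorphic_near_any_chart[of \<phi> p, OF _ \<kappa>]
    show "\<exists>U. z \<in> U \<and> holomorphic_fun_on (\<phi> \<circ> chart_inv \<kappa>) U" by (auto simp: o_def)
  qed
qed

subsection \<open>Spreading holomorphy along the leaves\<close>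

text \<open>The radius is fixed before \<open>t\<close>, so around a time where holomorphy fails it
  fails on a whole disc. This is the openness that the connectedness argument requires.\<close>

lemma holomorphic_near_solution_local:
  assumes F: "holomorphic_vector_field \<A> F" and \<phi>: "F_holomorphic \<A> F \<phi>"
    and \<gamma>: "solution \<A> F D \<gamma>" and s: "s \<in> D"
  shows "\<exists>\<rho>>0. ball s \<rho> \<subseteq> D \<and> (\<forall>t\<in>ball s \<rho>. holomorphic_near \<phi> (\<gamma> t) \<longrightarrow> holomorphic_near \<phi> (\<gamma> s))"
proof -
  have D: "open D" "continuous_on D \<gamma>"
    and der: "\<And>\<zeta> \<kappa>. \<zeta> \<in> D \<Longrightarrow> \<kappa> \<in> \<A> \<Longrightarrow> \<gamma> \<zeta> \<in> fst \<kappa> \<Longrightarrow>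
      ((\<lambda>s. snd \<kappa> (\<gamma> s)) has_derivative (\<lambda>h. h *s F \<kappa> (\<gamma> \<zeta>))) (at \<zeta>)"
    using \<gamma> unfolding solution_def by auto
  obtain \<kappa> where \<kappa>: "\<kappa> \<in> \<A>" "\<gamma> s \<in> fst \<kappa>" using chart_at by blast
  have "open (D \<inter> \<gamma> -` fst \<kappa>)"
    by (rule continuous_open_preimage[OF D(2,1) chart_domain_open[OF \<kappa>(1)]])
  then obtain \<rho> where \<rho>: "\<rho> > 0" "ball s \<rho> \<subseteq> D \<inter> \<gamma> -` fst \<kappa>"
    using s \<kappa>(2) open_contains_ball[of "D \<inter> \<gamma> -` fst \<kappa>"] by blast
  define G where "G = F \<kappa> \<circ> chart_inv \<kappa>"
  define g where "g \<tau> = snd \<kappa> (\<gamma> (s + \<tau>))" for \<tau>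
  have path: "integral_path_on G (chart_image \<kappa>) (ball 0 \<rho>) g"
    unfolding integral_path_on_def
  proof (intro ballI conjI)
    fix \<tau> :: complex assume "\<tau> \<in> ball 0 \<rho>"
    then have "s + \<tau> \<in> ball s \<rho>" by (simp add: dist_norm)
    then have st: "s + \<tau> \<in> D" "\<gamma> (s + \<tau>) \<in> fst \<kappa>" using \<rho> by auto
    show "g \<tau> \<in> chart_image \<kappa>" unfolding g_def by (rule chart_in_image[OF st(2)])
    have Gg: "G (g \<tau>) = F \<kappa> (\<gamma> (s + \<tau>))"
      by (simp add: G_def g_def chart_inv_apply[OF \<kappa>(1) st(2)])
    have "((\<lambda>\<tau>. s + \<tau>) has_derivative (\<lambda>h. h)) (at \<tau>)"
      using has_derivative_add[OF has_derivative_const[of s] has_derivative_ident, of "at \<tau>"] by (simp only: add_0)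
    from has_derivative_compose[OF this der[OF st(1) \<kappa>(1) st(2)]]
    show "(g has_derivative (\<lambda>h. h *s G (g \<tau>))) (at \<tau>)"
      unfolding Gg unfolding g_def .
  qed
  have G: "holomorphic_map_on G (chart_image \<kappa>)"
    using F \<kappa>(1) unfolding holomorphic_vector_field_def G_def by blast
  have hol: "(\<lambda>\<tau>. \<phi> (chart_inv \<kappa> (k \<tau>))) holomorphic_on ball \<tau>0 R"
    if "integral_path_on G (chart_image \<kappa>) (ball \<tau>0 R) k" for \<tau>0 R k
  proof -
    have "solution \<A> F (ball \<tau>0 R) (\<lambda>\<zeta>. chart_inv \<kappa> (k \<zeta>))"
      by (rule solution_from_chart[OF F \<kappa>(1) open_ball connected_ball that[unfolded G_def]])
    with \<phi> have "(\<phi> \<circ> (\<lambda>\<zeta>. chart_inv \<kappa> (k \<zeta>))) holomorphic_on ball \<tau>0 R"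
      unfolding F_holomorphic_def by blast
    then show ?thesis by (simp add: o_def)
  qed
  have g0: "g 0 = snd \<kappa> (\<gamma> s)" by (simp add: g_def)
  obtain \<rho>' where \<rho>': "\<rho>' > 0" "\<forall>\<tau>0 U. norm \<tau>0 < \<rho>' \<and> open U \<and> g \<tau>0 \<in> U \<and> holomorphic_fun_on (\<lambda>z. \<phi> (chart_inv \<kappa> z)) U
    \<longrightarrow> (\<exists>\<delta>>0. holomorphic_fun_on (\<lambda>z. \<phi> (chart_inv \<kappa> z)) (ball (snd \<kappa> (\<gamma> s)) \<delta>))"
    using holomorphy_spreads_along_path[OF chart_image_open[OF \<kappa>(1)] G chart_in_image[OF \<kappa>(2)], of "\<lambda>z. \<phi> (chart_inv \<kappa> z)", OF hol path g0 \<rho>(1)]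
    by auto
  show ?thesis
  proof (rule exI[of _ "min \<rho> \<rho>'"], intro conjI ballI impI)
    show "min \<rho> \<rho>' > 0" using \<rho> \<rho>' by simp
    show "ball s (min \<rho> \<rho>') \<subseteq> D" using \<rho>(2) by auto
    fix t assume t: "t \<in> ball s (min \<rho> \<rho>')" and near: "holomorphic_near \<phi> (\<gamma> t)"
    have tk: "\<gamma> t \<in> fst \<kappa>" using t \<rho>(2) by auto
    from holomorphic_near_any_chart[OF near \<kappa>(1) tk] obtain U where U: "open U" "snd \<kappa> (\<gamma> t) \<in> U"
      "holomorphic_fun_on (\<lambda>z. \<phi> (chart_inv \<kappa> z)) U" by blast
    have "norm (t - s) < \<rho>'" using t by (simp add: dist_norm norm_minus_commute)
    moreover have "g (t - s) = snd \<kappa> (\<gamma> t)" by (simp add: g_def)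
    ultimately obtain \<delta> where "\<delta> > 0" "holomorphic_fun_on (\<lambda>z. \<phi> (chart_inv \<kappa> z)) (ball (snd \<kappa> (\<gamma> s)) \<delta>)"
      using \<rho>'(2)[rule_format, of "t - s" U] U by auto
    then show "holomorphic_near \<phi> (\<gamma> s)"
      by (intro holomorphic_nearI[OF \<kappa> open_ball]) auto
  qed
qed

text \<open>The times with and without holomorphy form two disjoint open sets covering the connected
  set \<open>D\<close>.\<close>

lemma holomorphic_near_solution:
  assumes F: "holomorphic_vector_field \<A> F" and \<phi>: "F_holomorphic \<A> F \<phi>"
    and \<gamma>: "solution \<A> F D \<gamma>" and s: "s \<in> D" "holomorphic_near \<phi> (\<gamma> s)" and t: "t \<in> D"
  shows "holomorphic_near \<phi> (\<gamma> t)"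
proof (rule ccontr)
  assume nt: "\<not> holomorphic_near \<phi> (\<gamma> t)"
  have D: "open D" "connected D" "continuous_on D \<gamma>" using \<gamma> unfolding solution_def by auto
  let ?A = "D \<inter> \<gamma> -` {p. holomorphic_near \<phi> p}"
  let ?B = "{s\<in>D. \<not> holomorphic_near \<phi> (\<gamma> s)}"
  have "open ?A" by (rule continuous_open_preimage[OF D(3,1) holomorphic_near_open])
  moreover have "open ?B"
  proof (subst open_contains_ball, intro ballI)
    fix x assume x: "x \<in> ?B"
    then obtain \<rho> where "\<rho> > 0" "ball x \<rho> \<subseteq> D" "\<forall>t\<in>ball x \<rho>. holomorphic_near \<phi> (\<gamma> t) \<longrightarrow> holomorphic_near \<phi> (\<gamma> x)"
      using holomorphic_near_solution_local[OF F \<phi> \<gamma>] by blast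
    with x show "\<exists>e>0. ball x e \<subseteq> ?B" by blast
  qed
  ultimately have "?A \<inter> D = {} \<or> ?B \<inter> D = {}"
    using D(2) by (intro connectedD) auto
  with s t nt show False by blast
qed

text \<open>Lying on a common integral curve is symmetric, so the chain from \<open>p\<close> to
  \<open>q\<close> can be traversed backwards and continued to \<open>x\<close>.\<close>

lemma holomorphic_near_leaf:
  assumes F: "holomorphic_vector_field \<A> F" and \<phi>: "F_holomorphic \<A> F \<phi>"
    and q: "q \<in> leaf_through \<A> F p" "holomorphic_near \<phi> q" and x: "x \<in> leaf_through \<A> F p"
  shows "holomorphic_near \<phi> x"
proof -
  define R where "R = {(x, y). \<exists>C. integral_curve \<A> F C \<and> x \<in> C \<and> y \<in> C}"
  have step: "holomorphic_near \<phi> y" if "(x, y) \<in> R" "holomorphic_near \<phi> x" for x y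
  proof -
    from that(1) obtain D \<gamma> s t where "solution \<A> F D \<gamma>" "s \<in> D" "x = \<gamma> s" "t \<in> D" "y = \<gamma> t"
      unfolding R_def integral_curve_def by blast
    with holomorphic_near_solution[OF F \<phi>] that(2) show ?thesis by blast
  qed
  have star: "holomorphic_near \<phi> y" if "(x, y) \<in> R\<^sup>*" "holomorphic_near \<phi> x" for x y
    using that by (induction rule: rtrancl_induct) (auto intro: step)
  have "sym R" unfolding R_def sym_def by blast
  then have "sym (R\<^sup>*)" by (rule sym_rtrancl)
  moreover have "(p, q) \<in> R\<^sup>*" "(p, x) \<in> R\<^sup>*" using q(1) x unfolding leaf_through_def R_def by auto
  ultimately have "(q, x) \<in> R\<^sup>*" by (meson symD rtrancl_trans)
  then show ?thesis using star q(2) by blast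
qed

text \<open>Every leaf of the saturation meets every neighbourhood of \<open>z0\<close>, in
  particular the open set of points where \<open>\<phi>\<close> is holomorphic.\<close>

lemma holomorphic_near_Sat:
  assumes F: "holomorphic_vector_field \<A> F" and \<phi>: "F_holomorphic \<A> F \<phi>"
    and z0: "holomorphic_near \<phi> z0" and x: "x \<in> Sat \<A> z0 F"
  shows "holomorphic_near \<phi> x"
proof -
  obtain p where p: "x \<in> leaf_through \<A> F p"
    "\<And>U. open U \<Longrightarrow> z0 \<in> U \<Longrightarrow> leaf_through \<A> F p \<inter> U \<noteq> {}"
    using x unfolding Sat_def maximal_integral_curve_def by blast
  from p(2)[OF holomorphic_near_open, of \<phi>] z0 obtain q where "q \<in> leaf_through \<A> F p" "holomorphic_near \<phi> q"
    by blast
  then show ?thesis using holomorphic_near_leaf[OF F \<phi> _ _ p(1)] by blast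
qed

section \<open>The node in its linearizing chart\<close>

text \<open>The Taylor series is given in some chart at \<open>z0\<close>, but the estimates live in
  the linearizing chart. Little-o is weakened to big-O with constant 1, and the holomorphic
  transition map carries the approximations over.\<close>

lemma taylor_approx_in_chart:
  assumes T: "has_taylor_series_at \<A> \<phi> z0" and H: "H \<in> \<A>" "z0 \<in> fst H" "snd H z0 = 0"
  shows "taylor_approx n (\<lambda>w. \<phi> (chart_inv H w))"
proof -
  obtain \<kappa> a where \<kappa>: "\<kappa> \<in> \<A>" "z0 \<in> fst \<kappa>" "snd \<kappa> z0 = 0"
    and a: "\<And>n. (\<lambda>z. cmod (\<phi> (chart_inv \<kappa> z) - (\<Sum>j\<le>n. \<Sum>(k, m)\<in>bidegree j. a k m * monomial z k m)))
            \<in> o[nhds 0](\<lambda>z. norm z ^ n)"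
    using T unfolding has_taylor_series_at_def by blast
  define Q where "Q z = (\<Sum>j\<le>n. \<Sum>(k, m)\<in>bidegree j. a k m * monomial z k m)" for z
  have Qr: "rpoly Q"
    unfolding Q_def case_prod_unfold by (intro rpoly_sum rpoly_monomial)
  have "\<forall>\<^sub>F z in nhds 0. norm (cmod (\<phi> (chart_inv \<kappa> z) - Q z)) \<le> 1 * norm (norm z ^ n)"
    unfolding Q_def by (rule landau_o.smallD[OF a]) simp
  then obtain d where "d > 0" "\<And>z. dist z 0 < d \<Longrightarrow> norm (cmod (\<phi> (chart_inv \<kappa> z) - Q z)) \<le> 1 * norm (norm z ^ n)"
    unfolding eventually_nhds_metric by blast
  then have \<kappa>T: "taylor_approx n (\<lambda>z. \<phi> (chart_inv \<kappa> z))"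
    unfolding taylor_approx_def using Qr by (intro exI[of _ Q] exI[of _ 1] exI[of _ d]) simp
  let ?S = "snd H ` (fst H \<inter> fst \<kappa>)"
  have S: "open ?S" "0 \<in> ?S"
    using chart_image_Int_open[OF H(1) chart_domain_open[OF \<kappa>(1)]] H \<kappa> by (auto intro: image_eqI[of _ _ z0])
  have "transition H \<kappa> 0 = 0"
    using chart_inv_apply[OF H(1,2)] H(3) \<kappa>(3) by (simp add: transition_def)
  from holomorphic_taylor_substitution[OF S transition_holomorphic[OF H(1) \<kappa>(1)] this \<kappa>T]
  have "taylor_approx n (\<lambda>w. \<phi> (chart_inv \<kappa> (transition H \<kappa> w)))" .
  then obtain Q d C where Q: "rpoly Q" "d > 0" "\<And>w. norm w < d \<Longrightarrow> norm (\<phi> (chart_inv \<kappa> (transition H \<kappa> w)) - Q w) \<le> C * norm w ^ n"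
    by (elim taylor_approxE) (rule that)
  obtain e where e: "e > 0" "ball 0 e \<subseteq> ?S" using S open_contains_ball by blast
  have "norm (\<phi> (chart_inv H w) - Q w) \<le> C * norm w ^ n" if w: "norm w < min d e" for w
  proof -
    have "w \<in> ?S" using w e by auto
    from chart_inv_transition(1)[OF H(1) \<kappa>(1) this] Q(3)[of w] w show ?thesis by simp
  qed
  with Q(1,2) e(1) show ?thesis unfolding taylor_approx_def
    by (intro exI[of _ Q] exI[of _ C] exI[of _ "min d e"]) simp
qed

text \<open>In the chart the field is \<open>\<alpha>\<close> times a node with positive real rates.
  The time change \<open>\<zeta> = \<alpha> * \<xi>\<close> maps the half-plane \<open>D\<close>
  onto \<open>Re \<zeta> < 0\<close>, where the node flow does not increase the norm, so curves
  starting in a ball of the chart image remain in it.\<close>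

lemma holomorphic_near_linearizable_node:
  assumes F: "holomorphic_vector_field \<A> F" and \<phi>: "F_holomorphic \<A> F \<phi>"
    and H: "H \<in> \<A>" "z0 \<in> fst H" "snd H z0 = 0"
    and lin: "\<And>p i. p \<in> fst H \<Longrightarrow> F H p $ i = \<alpha> * of_real (r i) * snd H p $ i"
    and r: "\<And>i. r i > 0" and \<alpha>: "\<alpha> \<noteq> 0" and T: "has_taylor_series_at \<A> \<phi> z0"
  shows "holomorphic_near \<phi> z0"
proof -
  have "0 \<in> chart_image H" using chart_in_image[OF H(2)] H(3) by simp
  then obtain \<rho> where \<rho>: "\<rho> > 0" "ball 0 \<rho> \<subseteq> chart_image H"
    using chart_image_open[OF H(1)] open_contains_ball by blast
  have hol: "(\<lambda>\<zeta>. \<phi> (chart_inv H (node_flow r \<zeta> w))) holomorphic_on {\<zeta>. Re \<zeta> < 0}" if w: "norm w < \<rho>" for w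
  proof -
    define D where "D = {\<xi>. Re (\<alpha> * \<xi>) < 0}"
    have D: "open D" "connected D"
    proof -
      show "open D" unfolding D_def by (intro open_Collect_less continuous_intros)
      have "D = {\<xi>. inner (cnj \<alpha>) \<xi> < 0}" by (simp add: D_def inner_complex_def)
      then show "connected D" using convex_halfspace_lt convex_connected by metis
    qed
    have nf: "norm (node_flow r \<zeta> w) \<le> norm w" if "Re \<zeta> < 0" for \<zeta>
      using norm_node_flow_le[OF that, where c = 0 and r = r and w = w] r by (simp add: less_imp_le)
    let ?g = "\<lambda>\<xi>. node_flow r (\<alpha> * \<xi>) w"
    have path: "integral_path_on (F H \<circ> chart_inv H) (chart_image H) D ?g"
      unfolding integral_path_on_def
    proof (intro ballI conjI)
      fix \<xi> assume "\<xi> \<in> D"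
      then have "norm (?g \<xi>) < \<rho>" using nf[of "\<alpha> * \<xi>"] w by (simp add: D_def)
      then show gi: "?g \<xi> \<in> chart_image H" using \<rho> by auto
      show "(?g has_derivative (\<lambda>h. h *s (F H \<circ> chart_inv H) (?g \<xi>))) (at \<xi>)"
      proof (rule has_derivative_vecI)
        fix i
        have eq: "(F H \<circ> chart_inv H) (?g \<xi>) $ i = \<alpha> * of_real (r i) * ?g \<xi> $ i"
          using lin[OF chart_inv_in[OF H(1) gi]] chart_apply_inv[OF H(1) gi] by simp
        have "((\<lambda>\<xi>. exp (of_real (r i) * (\<alpha> * \<xi>)) * w $ i) has_field_derivative
            (exp (of_real (r i) * (\<alpha> * \<xi>)) * (of_real (r i) * (\<alpha> * 1))) * w $ i) (at \<xi>)"
          by (intro DERIV_cmult_right DERIV_cmult DERIV_fun_exp DERIV_ident)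
        moreover have "(exp (of_real (r i) * (\<alpha> * \<xi>)) * (of_real (r i) * (\<alpha> * 1))) * w $ i = \<alpha> * of_real (r i) * ?g \<xi> $ i"
          by (simp add: node_flow_def)
        moreover have "(\<lambda>h. h * (\<alpha> * of_real (r i) * ?g \<xi> $ i)) = (*) (\<alpha> * of_real (r i) * ?g \<xi> $ i)"
          by (simp add: fun_eq_iff mult.commute)
        moreover have "(\<lambda>\<xi>. ?g \<xi> $ i) = (\<lambda>\<xi>. exp (of_real (r i) * (\<alpha> * \<xi>)) * w $ i)"
          by (simp add: node_flow_def)
        ultimately show "((\<lambda>\<xi>. ?g \<xi> $ i) has_derivative (\<lambda>h. (h *s (F H \<circ> chart_inv H) (?g \<xi>)) $ i)) (at \<xi>)"
          unfolding vector_smult_component eq has_field_derivative_def by (simp only:)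
      qed
    qed
    have "solution \<A> F D (\<lambda>\<xi>. chart_inv H (?g \<xi>))"
      by (rule solution_from_chart[OF F H(1) D path])
    with \<phi> have "(\<phi> \<circ> (\<lambda>\<xi>. chart_inv H (?g \<xi>))) holomorphic_on D"
      unfolding F_holomorphic_def by blast
    moreover have "(\<lambda>\<zeta>. \<zeta> / \<alpha>) holomorphic_on {\<zeta>. Re \<zeta> < 0}"
      using \<alpha> by (intro holomorphic_intros) auto
    moreover have "(\<lambda>\<zeta>. \<zeta> / \<alpha>) ` {\<zeta>. Re \<zeta> < 0} \<subseteq> D"
    proof (rule image_subsetI)
      fix \<zeta> assume "\<zeta> \<in> {\<zeta>. Re \<zeta> < 0}"
      moreover have "\<alpha> * (\<zeta> / \<alpha>) = \<zeta>" using \<alpha> by simp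
      ultimately show "\<zeta> / \<alpha> \<in> D" by (simp only: D_def mem_Collect_eq)
    qed
    ultimately have "((\<phi> \<circ> (\<lambda>\<xi>. chart_inv H (?g \<xi>))) \<circ> (\<lambda>\<zeta>. \<zeta> / \<alpha>)) holomorphic_on {\<zeta>. Re \<zeta> < 0}"
      by (intro holomorphic_on_compose_gen[where t = D])
    then show ?thesis using \<alpha> by (simp add: o_def)
  qed
  obtain \<delta> where \<delta>: "\<delta> > 0" "holomorphic_fun_on (\<lambda>w. \<phi> (chart_inv H w)) (ball 0 \<delta>)"
    using holomorphic_near_node[OF r taylor_approx_in_chart[OF T H] \<rho>(1) hol] by blast
  show ?thesis
    by (rule holomorphic_nearI[OF H(1,2) open_ball _ \<delta>(2)]) (simp add: H(3) \<delta>(1))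
qed

end

section \<open>Eigenvalues of diagonal matrices and the conclusion\<close>

lemma diagonal_mult_nth:
  fixes A :: "complex^'n^'n"
  assumes "diagonal_matrix A"
  shows "(A *v x) $ i = A $ i $ i * x $ i"
proof -
  have "(A *v x) $ i = (\<Sum>j\<in>UNIV. A $ i $ j * x $ j)" by (simp add: matrix_vector_mult_def)
  also have "\<dots> = (\<Sum>j\<in>UNIV. if j = i then A $ i $ i * x $ i else 0)"
    using assms unfolding diagonal_matrix_def by (intro sum.cong refl) auto
  finally show ?thesis by simp
qed

lemma diagonal_eigenvalue:
  fixes A :: "complex^'n^'n"
  assumes "diagonal_matrix A"
  shows "is_eigenvalue A (A $ i $ i)"
  unfolding is_eigenvalue_def
  by (rule exI[of _ "axis i 1"]) (auto simp: vec_eq_iff diagonal_mult_nth[OF assms] axis_def)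

theorem theorem6p2:
  fixes \<A> :: "('m::{t2_space, second_countable_topology}, 'n::finite) chart set"
    and F :: "('m, 'n) vfield"
    and z0 :: 'm
    and A :: "complex^'n^'n"
    and \<phi> :: "'m \<Rightarrow> complex"
  assumes "complex_manifold \<A>"
    and "holomorphic_vector_field \<A> F"
    and "isolated_critical_point \<A> F z0"
    and "linearizable_with \<A> F z0 A"
    and "diagonal_matrix A"
    and "\<And>\<alpha> \<beta>. is_eigenvalue A \<alpha> \<Longrightarrow> is_eigenvalue A \<beta> \<Longrightarrow> \<exists>r::real. r > 0 \<and> \<alpha> / \<beta> = of_real r"
    and "F_holomorphic \<A> F \<phi>"
    and "has_taylor_series_at \<A> \<phi> z0"
  shows "holomorphic_on_manifold \<A> \<phi> (Sat \<A> z0 F)"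
proof -
  interpret complex_atlas \<A> by unfold_locales fact
  obtain H where H: "H \<in> \<A>" "z0 \<in> fst H" "snd H z0 = 0" and lin: "\<And>p. p \<in> fst H \<Longrightarrow> F H p = A *v snd H p"
    using assms(4) unfolding linearizable_with_def by blast
  \<comment> \<open>\<open>undefined\<close> is an arbitrary index: any one of the eigenvalues can
    set the time scale.\<close>
  define \<alpha> where "\<alpha> = A $ undefined $ undefined"
  have "\<exists>r::real. r > 0 \<and> A $ i $ i / \<alpha> = of_real r" for i
    unfolding \<alpha>_def by (intro assms(6) diagonal_eigenvalue assms(5))
  then have "\<forall>i. \<exists>r::real. r > 0 \<and> A $ i $ i / \<alpha> = of_real r" ..
  from choice[OF this] obtain r :: "'n \<Rightarrow> real" where "\<forall>i. r i > 0 \<and> A $ i $ i / \<alpha> = of_real (r i)" ..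
  then have r: "\<And>i. r i > 0" "\<And>i. A $ i $ i / \<alpha> = of_real (r i)" by simp_all
  \<comment> \<open>Because \<open>x / 0 = 0\<close>, a vanishing \<open>\<alpha>\<close> would make
    the positive number \<open>r undefined\<close> zero.\<close>
  have \<alpha>: "\<alpha> \<noteq> 0" using r(1)[of undefined] r(2)[of undefined] by auto
  have Aii: "A $ i $ i = \<alpha> * of_real (r i)" for i
    unfolding r(2)[symmetric] using \<alpha> by simp
  have lin': "F H p $ i = \<alpha> * of_real (r i) * snd H p $ i" if "p \<in> fst H" for p i
    unfolding lin[OF that] diagonal_mult_nth[OF assms(5)] Aii ..
  have "holomorphic_near \<phi> z0"
    by (rule holomorphic_near_linearizable_node[OF assms(2,7) H lin' r(1) \<alpha> assms(8)])
  then show ?thesis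
    by (rule holomorphic_on_manifold_near[OF holomorphic_near_Sat[OF assms(2,7)]])
qed

end
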